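(* Let $I\subseteq R=\mathbb{K}[x_1,\ldots,x_n]$ be a homogeneous, geometrically vertex decomposable ideal, and let $\mathrm{in}_y(I)=C_{y,I}\cap(N_{y,I}+\langle y\rangle)$ be its geometric vertex decomposition with respect to a variable $y=x_j$ and a $y$-compatible monomial order, such that the contractions of $C_{y,I}$ and $N_{y,I}$ to $\mathbb{K}[x_1,\ldots,\widehat{x_j},\ldots,x_n]$ are geometrically vertex decomposable. If the decomposition is nondegenerate, then the $h$-polynomial of $R/I$ satisfies $$h_{R/I}(t)=h_{R/N_{y,I}}(t)+t\,h_{R/C_{y,I}}(t).$$
   Context: $\mathbb{K}$ is an algebraically closed field of characteristic $0$ and $R=\mathbb{K}[x_1,\ldots,x_n]$ has the standard grading. Fix a variable $y=x_j$. A nonzero $f\in R$ is written $f=\sum_{i=0}^d\alpha_i y^i$ with $\alpha_i\in\mathbb{K}[x_1,\ldots,\widehat{x_j},\ldots,x_n]$ and $\alpha_d\ne0$; its initial $y$-form is $\mathrm{in}_y(f)=\alpha_d y^d$. For an ideal $J$, $\mathrm{in}_y(J)=\langle \mathrm{in}_y(f) : f\in J\rangle$. A monomial order $<$ is $y$-compatible if $\mathrm{in}_<(\mathrm{in}_y(f))=\mathrm{in}_<(f)$ for all $f\in R$. Given an ideal $I$ and a Gröbner basis $\{g_1,\ldots,g_m\}$ of $I$ with respect to a $y$-compatible order, write $g_i=y^{d_i}q_i+r_i$ with $\mathrm{in}_y(g_i)=y^{d_i}q_i$ and $y$ not dividing any term of $q_i$. Put $C_{y,I}=\langle q_1,\ldots,q_m\rangle$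 and $N_{y,I}=\langle q_i : d_i=0\rangle$; these do not depend on the choice of order or Gröbner basis, and are regarded as ideals of $R$ unless their contraction is mentioned. If $\mathrm{in}_y(I)=C_{y,I}\cap(N_{y,I}+\langle y\rangle)$, this is called a geometric vertex decomposition of $I$ with respect to $y$. It is degenerate if $\sqrt{C_{y,I}}=\sqrt{N_{y,I}}$ or $C_{y,I}=\langle1\rangle$, and nondegenerate otherwise. An ideal $I$ is unmixed if $\dim(R/I)=\dim(R/P)$ for all associated primes $P$ of $R/I$. An ideal $I\subseteq\mathbb{K}[x_1,\ldots,x_n]$ is geometrically vertex decomposable if $I$ is unmixed and either (1) $I=\langle1\rangle$ or $I$ is generated by a (possibly empty) subset of the variables, or (2) there is a variable $y=x_j$ and a $y$-compatible monomial order giving a geometric vertex decomposition $\mathrm{in}_y(I)=C_{y,I}\cap(N_{y,I}+\langle y\rangle)$ such that the contractions of $C_{y,I}$ and $N_{y,I}$ to $\mathbb{K}[x_1,\ldots,\widehat{x_j},\ldots,x_n]$ are geometrically vertex decomposable. The $h$-polynomial $h_M(t)$ of a finitely generated graded module $M$ of dimension $d$ is the polynomial for which the Hilbert series of $M$ equals $h_M(t)/(1-t)^d$. *)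

theory Defs
  imports
    "HOL-Library.Poly_Mapping"
    "HOL-Library.Extended_Nat"
    "HOL-Computational_Algebra.Polynomial_FPS"
    "HOL-Algebra.Embedded_Algebras"
    "HOL-Algebra.QuotRing"
begin

section \<open>Polynomial rings in finite sets of variables\<close>

text \<open>
  All polynomials live in one type, with variables \<open>x\<^sub>i\<close> indexed by \<open>i :: nat\<close>; the ring
  in the variables \<open>V\<close> is a HOL-Algebra ring on a subset of this type. Passing to
  fewer variables is then an inclusion of carriers, and contraction is intersection.
\<close>

type_synonym monomial = "nat \<Rightarrow>\<^sub>0 nat"
type_synonym 'k mpoly = "monomial \<Rightarrow>\<^sub>0 'k"

definition monomials :: "nat set \<Rightarrow> monomial set" where
  "monomials V = {m. Poly_Mapping.keys m \<subseteq> V}"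

definition mpoly_ring :: "nat set \<Rightarrow> 'k::field mpoly ring" where
  "mpoly_ring V =
     \<lparr>carrier = {p. Poly_Mapping.keys p \<subseteq> monomials V}, mult = (*), one = 1, zero = 0, add = (+)\<rparr>"

definition var :: "nat \<Rightarrow> 'k::field mpoly" where
  "var i = Poly_Mapping.single (Poly_Mapping.single i 1) 1"

lemma cring_mpoly_ring: "cring (mpoly_ring V :: 'k::field mpoly ring)"
proof -
  have times: "Poly_Mapping.keys (p * q) \<subseteq> monomials V"
    if "Poly_Mapping.keys p \<subseteq> monomials V" "Poly_Mapping.keys q \<subseteq> monomials V"
    for p q :: "'k mpoly"
  proof
    fix m assume "m \<in> Poly_Mapping.keys (p * q)"
    then obtain a b where "m = a + b" "a \<in> Poly_Mapping.keys p" "b \<in> Poly_Mapping.keys q"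
      using keys_mult[of p q] by blast
    then show "m \<in> monomials V"
      using that Poly_Mapping.keys_add[of a b] unfolding monomials_def by blast
  qed
  have plus: "Poly_Mapping.keys (p + q) \<subseteq> monomials V"
    if "Poly_Mapping.keys p \<subseteq> monomials V" "Poly_Mapping.keys q \<subseteq> monomials V"
    for p q :: "'k mpoly"
    using that Poly_Mapping.keys_add[of p q] by blast
  show ?thesis
  proof (rule cringI)
    show "abelian_group (mpoly_ring V :: 'k mpoly ring)"
    proof (rule abelian_groupI)
      fix p :: "'k mpoly" assume "p \<in> carrier (mpoly_ring V)"
      then have "- p \<in> carrier (mpoly_ring V)" by (simp add: mpoly_ring_def)
      then show "\<exists>q\<in>carrier (mpoly_ring V). q \<oplus>\<^bsub>mpoly_ring V\<^esub> p = \<zero>\<^bsub>mpoly_ring V\<^esub>"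
        by (intro bexI[of _ "- p"]) (simp_all add: mpoly_ring_def)
    qed (auto simp: mpoly_ring_def algebra_simps dest: plus[THEN subsetD, rotated 2])
    show "comm_monoid (mpoly_ring V :: 'k mpoly ring)"
      by (rule comm_monoidI)
         (auto simp: mpoly_ring_def algebra_simps monomials_def
               dest: times[unfolded monomials_def, THEN subsetD, rotated 2])
  qed (simp add: mpoly_ring_def algebra_simps)
qed


section \<open>Grading, dimension and the h-polynomial\<close>

definition total_degree :: "monomial \<Rightarrow> nat" where
  "total_degree m = (\<Sum>i\<in>Poly_Mapping.keys m. Poly_Mapping.lookup m i)"

definition homogeneous_part :: "nat set \<Rightarrow> nat \<Rightarrow> 'k::field mpoly set" where
  "homogeneous_part V d =
     {f \<in> carrier (mpoly_ring V). \<forall>m\<in>Poly_Mapping.keys f. total_degree m = d}"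

definition homogeneous_ideal :: "nat set \<Rightarrow> 'k::field mpoly set \<Rightarrow> bool" where
  "homogeneous_ideal V I \<longleftrightarrow>
     (\<exists>S. S \<subseteq> (\<Union>d. homogeneous_part V d) \<and> I = genideal (mpoly_ring V) S)"

text \<open>
  The supremum of the lengths of chains of prime ideals. The zero ring, which has no
  prime ideals, gets dimension \<open>0\<close>.
\<close>

definition krull_dim :: "('a, 'b) ring_scheme \<Rightarrow> enat" where
  "krull_dim A = Sup {enat l | l. \<exists>P :: nat \<Rightarrow> 'a set.
     (\<forall>i\<le>l. primeideal (P i) A) \<and> (\<forall>i<l. P i \<subset> P (Suc i))}"

text \<open>
  \<open>dim\<^sub>K (R/I)\<^sub>d\<close>, where \<open>(R/I)\<^sub>d\<close> is the image of \<open>R\<^sub>d\<close> in \<open>R/I\<close>, and the scalars are the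
  image of the constants \<open>R\<^sub>0\<close>.
\<close>

definition hilbert_function :: "nat set \<Rightarrow> 'k::field mpoly set \<Rightarrow> nat \<Rightarrow> nat" where
  "hilbert_function V I d =
     ring.dim (mpoly_ring V Quot I)
       (a_r_coset (mpoly_ring V) I ` homogeneous_part V 0)
       (a_r_coset (mpoly_ring V) I ` homogeneous_part V d)"

definition hilbert_series :: "nat set \<Rightarrow> 'k::field mpoly set \<Rightarrow> rat fps" where
  "hilbert_series V I = Abs_fps (\<lambda>d. of_nat (hilbert_function V I d))"

definition h_polynomial :: "nat set \<Rightarrow> 'k::field mpoly set \<Rightarrow> rat poly" where
  "h_polynomial V I =
     (THE h. hilbert_series V I =
        fps_of_poly h / (1 - fps_X) ^ the_enat (krull_dim (mpoly_ring V Quot I)))"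


section \<open>Unmixed ideals and radicals\<close>

definition associated_primes :: "nat set \<Rightarrow> 'k::field mpoly set \<Rightarrow> 'k mpoly set set" where
  "associated_primes V I =
     {P. primeideal P (mpoly_ring V) \<and>
         (\<exists>f\<in>carrier (mpoly_ring V). P = {r \<in> carrier (mpoly_ring V). r * f \<in> I})}"

definition unmixed :: "nat set \<Rightarrow> 'k::field mpoly set \<Rightarrow> bool" where
  "unmixed V I \<longleftrightarrow>
     (\<forall>P\<in>associated_primes V I.
        krull_dim (mpoly_ring V Quot I) = krull_dim (mpoly_ring V Quot P))"

definition ideal_radical :: "nat set \<Rightarrow> 'k::field mpoly set \<Rightarrow> 'k mpoly set" where
  "ideal_radical V J = {f \<in> carrier (mpoly_ring V). \<exists>e>0. f ^ e \<in> J}"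


section \<open>Initial forms and Groebner bases\<close>

text \<open>A pair \<open>(a, b)\<close> in the relation means \<open>a \<le> b\<close>.\<close>

definition monomial_order :: "nat set \<Rightarrow> monomial rel \<Rightarrow> bool" where
  "monomial_order V r \<longleftrightarrow> well_order_on (monomials V) r \<and>
     (\<forall>a b. \<forall>c\<in>monomials V. (a, b) \<in> r \<longrightarrow> (a + c, b + c) \<in> r)"

definition initial_term :: "monomial rel \<Rightarrow> 'k::field mpoly \<Rightarrow> 'k mpoly" where
  "initial_term r f =
     (if f = 0 then 0
      else let m = (THE m. m \<in> Poly_Mapping.keys f \<and> (\<forall>m'\<in>Poly_Mapping.keys f. (m', m) \<in> r))
           in Poly_Mapping.single m (Poly_Mapping.lookup f m))"

definition groebner_basis ::
    "nat set \<Rightarrow> monomial rel \<Rightarrow> 'k::field mpoly set \<Rightarrow> 'k mpoly set \<Rightarrow> bool" where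
  "groebner_basis V r G I \<longleftrightarrow> finite G \<and> G \<subseteq> I - {0} \<and>
     genideal (mpoly_ring V) (initial_term r ` G) = genideal (mpoly_ring V) (initial_term r ` I)"

text \<open>
  The degree of a nonzero polynomial in the variable \<open>y = x\<^sub>j\<close> (unspecified for the zero polynomial),
  and the coefficient \<open>\<alpha>\<^sub>d\<close> of the highest power of \<open>y\<close>, which is free of \<open>y\<close>.
\<close>

definition deg_in :: "nat \<Rightarrow> 'k::field mpoly \<Rightarrow> nat" where
  "deg_in j f = Max ((\<lambda>m. Poly_Mapping.lookup m j) ` Poly_Mapping.keys f)"

definition lead_coeff_in :: "nat \<Rightarrow> 'k::field mpoly \<Rightarrow> 'k mpoly" where
  "lead_coeff_in j f =
     (\<Sum>m\<in>{m \<in> Poly_Mapping.keys f. Poly_Mapping.lookup m j = deg_in j f}.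
        Poly_Mapping.single (Poly_Mapping.update j 0 m) (Poly_Mapping.lookup f m))"

text \<open>On \<open>f = 0\<close> this yields \<open>0\<close>, as the leading coefficient is then an empty sum.\<close>

definition initial_form :: "nat \<Rightarrow> 'k::field mpoly \<Rightarrow> 'k mpoly" where
  "initial_form j f = lead_coeff_in j f * var j ^ deg_in j f"

definition initial_form_ideal :: "nat set \<Rightarrow> nat \<Rightarrow> 'k::field mpoly set \<Rightarrow> 'k mpoly set" where
  "initial_form_ideal V j J = genideal (mpoly_ring V) (initial_form j ` J)"

definition compatible_order :: "'k::field itself \<Rightarrow> nat set \<Rightarrow> nat \<Rightarrow> monomial rel \<Rightarrow> bool" where
  "compatible_order TYPE('k) V j r \<longleftrightarrow> monomial_order V r \<and>
     (\<forall>f\<in>carrier (mpoly_ring V :: 'k mpoly ring).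
        initial_term r (initial_form j f) = initial_term r f)"


section \<open>Geometric vertex decomposition\<close>

text \<open>The ideals \<open>C\<close> and \<open>N\<close> of the ring in the variables \<open>V\<close>, read off from a Groebner basis \<open>G\<close>.\<close>

definition C_ideal :: "nat set \<Rightarrow> nat \<Rightarrow> 'k::field mpoly set \<Rightarrow> 'k mpoly set" where
  "C_ideal V j G = genideal (mpoly_ring V) (lead_coeff_in j ` G)"

definition N_ideal :: "nat set \<Rightarrow> nat \<Rightarrow> 'k::field mpoly set \<Rightarrow> 'k mpoly set" where
  "N_ideal V j G = genideal (mpoly_ring V) (lead_coeff_in j ` {g \<in> G. deg_in j g = 0})"

definition geometric_vertex_decomposition ::
    "nat set \<Rightarrow> nat \<Rightarrow> monomial rel \<Rightarrow> 'k::field mpoly set \<Rightarrow> 'k mpoly set \<Rightarrow> bool" where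
  "geometric_vertex_decomposition V j r G I \<longleftrightarrow>
     j \<in> V \<and> compatible_order TYPE('k) V j r \<and> ideal I (mpoly_ring V) \<and> groebner_basis V r G I \<and>
     initial_form_ideal V j I =
       C_ideal V j G \<inter>
         (N_ideal V j G <+>\<^bsub>mpoly_ring V\<^esub> genideal (mpoly_ring V) {var j})"

definition degenerate :: "nat set \<Rightarrow> nat \<Rightarrow> 'k::field mpoly set \<Rightarrow> bool" where
  "degenerate V j G \<longleftrightarrow>
     ideal_radical V (C_ideal V j G) = ideal_radical V (N_ideal V j G) \<or>
     C_ideal V j G = genideal (mpoly_ring V) {1}"

definition contraction :: "nat set \<Rightarrow> nat \<Rightarrow> 'k::field mpoly set \<Rightarrow> 'k mpoly set" where
  "contraction V j J = J \<inter> carrier (mpoly_ring (V - {j}))"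

inductive geometrically_vertex_decomposable :: "nat set \<Rightarrow> 'k::field mpoly set \<Rightarrow> bool" where
  unit: "unmixed V I \<Longrightarrow> I = genideal (mpoly_ring V) {1} \<Longrightarrow>
    geometrically_vertex_decomposable V I"
| variables: "unmixed V I \<Longrightarrow> W \<subseteq> V \<Longrightarrow> I = genideal (mpoly_ring V) (var ` W) \<Longrightarrow>
    geometrically_vertex_decomposable V I"
| decompose: "unmixed V I \<Longrightarrow> geometric_vertex_decomposition V j r G I \<Longrightarrow>
    geometrically_vertex_decomposable (V - {j}) (contraction V j (C_ideal V j G)) \<Longrightarrow>
    geometrically_vertex_decomposable (V - {j}) (contraction V j (N_ideal V j G)) \<Longrightarrow>
    geometrically_vertex_decomposable V I"

end

theory Submission
  imports Defs
begin

text \<open>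
  Let \<open>y = x\<^sub>j\<close>, and let \<open>R'\<close> be the ring in the other variables, with the contractions of \<open>N\<close> and
  \<open>C\<close> denoted by the same letters. The elements of \<open>I\<close> of \<open>y\<close>-degree at most \<open>k\<close> have as
  coefficients of \<open>y\<^sup>k\<close> an ideal \<open>L\<^sub>k\<close> of \<open>R'\<close>, and the initial ideal is the direct sum of
  the \<open>L\<^sub>k y\<^sup>k\<close>. That it equals \<open>C \<inter> (N + \<langle>y\<rangle>)\<close> therefore means \<open>L\<^sub>0 = N\<close> and \<open>L\<^sub>k = C\<close> for
  \<open>k \<ge> 1\<close> (\<open>coeff_ideals_of_decomposition\<close>). Filtering \<open>R/I\<close> by \<open>y\<close>-degree, the Hilbert
  series of \<open>R/I\<close> is that of \<open>R'/N\<close> plus \<open>t/(1 - t)\<close> times that of \<open>R'/C\<close>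
  (\<open>quotient_series_split\<close>). Multiplication with \<open>(1 - t)\<^sup>d\<close>, where \<open>d = dim R/I\<close>, gives the formula
  once two things are known: \<open>dim R'/N = d\<close> and \<open>dim R'/C = d - 1\<close>, and the \<open>h\<close>-polynomials exist.

  Existence follows along the recursive definition (\<open>geometrically_vertex_decomposable_properties\<close>).
  Only the inequalities \<open>dim R'/N \<le> d\<close> and \<open>dim R'/C < d\<close> (for \<open>C \<noteq> \<langle>1\<rangle>\<close>) enter there; the first
  holds because \<open>N\<close> is the elimination ideal of \<open>I\<close>. The second follows from the first if
  \<open>dim R'/C < dim R'/N\<close>; otherwise \<open>C\<close> and \<open>N \<subseteq> C\<close> have a common component \<open>P\<close> of dimension
  \<open>dim R'/C\<close>, and \<open>I \<subseteq> P R\<close>, where \<open>R/P R\<close> has one dimension more (\<open>Suc_idim_C_le\<close>). For this \<open>N\<close> has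
  to be radical, which is established by the same recursion.

  The equalities come from the unmixedness of \<open>I\<close> (\<open>idims_nondegenerate\<close>). For every \<open>c \<in> C\<close> the
  ideal \<open>I\<close> contains an element \<open>c y + r\<close> with \<open>r \<in> R'\<close>. Hence modulo a prime \<open>Q \<supseteq> I\<close> not
  containing \<open>C\<close>, \<open>y\<close> is a fraction of elements of \<open>R'\<close>, and \<open>R/Q\<close> has the dimension of
  \<open>R'/(Q \<inter> R')\<close>. Since the decomposition is nondegenerate, some associated prime of \<open>I\<close> is of
  this kind; so \<open>d \<le> dim R'/N\<close>. Since \<open>C \<noteq> \<langle>1\<rangle>\<close>, no element of \<open>I\<close> is monic in \<open>y\<close>, and the same holds
  for some associated prime \<open>Q\<close> of \<open>I\<close>. If now \<open>dim R'/C \<le> d - 2\<close>, then \<open>y\<close> would be a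
  fraction over \<open>A = R'/(Q \<inter> R')\<close> whose conductor has codimension at least two. Over a polynomial
  ring \<open>S \<subseteq> A\<close> with \<open>A\<close> finite over \<open>S\<close>, the conductor then contains coprime elements of \<open>S\<close>, all powers of \<open>y\<close> lie
  in one finite free \<open>S\<close>-module, and \<open>y\<close> is integral
  (\<open>monic_of_conductor_codimension_two\<close>): a monic element of \<open>Q\<close>, which is impossible.

  Dimensions are handled combinatorially: the Krull dimension of a quotient of a polynomial ring is
  the maximal number of variables such that the ideal contains no nonzero polynomial in them
  (\<open>krull_dim_eq_idim\<close>).
\<close>

(* coeff, monom and smult are to denote the operations on univariate polynomials. *)
hide_const (open) up_ring.coeff up_ring.monom module.smult



section \<open>Polynomials, evaluation and the expansion in one variable\<close>

abbreviation polys :: "nat set \<Rightarrow> 'k::field mpoly set" where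
  "polys V \<equiv> carrier (mpoly_ring V)"

abbreviation const :: "'k::field \<Rightarrow> 'k mpoly" where
  "const c \<equiv> Poly_Mapping.single 0 c"

lemma polys_iff: "f \<in> polys V \<longleftrightarrow> Poly_Mapping.keys f \<subseteq> monomials V"
  by (simp add: mpoly_ring_def)

lemma mpoly_ring_simps [simp]:
  "mult (mpoly_ring V) = (*)" "one (mpoly_ring V) = 1"
  "zero (mpoly_ring V) = 0" "add (mpoly_ring V) = (+)"
  by (simp_all add: mpoly_ring_def)

lemma polys_0 [simp, intro]: "0 \<in> polys V"
  using ring.ring_simprules(2)[OF cring.axioms(1)[OF cring_mpoly_ring[of V]]] by simp

lemma polys_1 [simp, intro]: "1 \<in> polys V"
  using ring.ring_simprules(6)[OF cring.axioms(1)[OF cring_mpoly_ring[of V]]] by simp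

lemma polys_add [intro]: "f \<in> polys V \<Longrightarrow> g \<in> polys V \<Longrightarrow> f + g \<in> polys V"
  using ring.ring_simprules(1)[OF cring.axioms(1)[OF cring_mpoly_ring[of V]]] by simp

lemma polys_mult [intro]: "f \<in> polys V \<Longrightarrow> g \<in> polys V \<Longrightarrow> f * g \<in> polys V"
  using ring.ring_simprules(5)[OF cring.axioms(1)[OF cring_mpoly_ring[of V]]] by simp

lemma polys_uminus [intro]: "f \<in> polys V \<Longrightarrow> - f \<in> polys V"
  by (simp add: polys_iff)

lemma polys_diff [intro]: "f \<in> polys V \<Longrightarrow> g \<in> polys V \<Longrightarrow> f - g \<in> polys V"
  using polys_add[of f V "- g"] by auto

lemma polys_power [intro]: "f \<in> polys V \<Longrightarrow> f ^ n \<in> polys V"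
  by (induction n) auto

lemma polys_sum [intro]: "(\<And>i. i \<in> A \<Longrightarrow> f i \<in> polys V) \<Longrightarrow> sum f A \<in> polys V"
  by (induction A rule: infinite_finite_induct) auto

lemma polys_prod [intro]: "(\<And>i. i \<in> A \<Longrightarrow> f i \<in> polys V) \<Longrightarrow> prod f A \<in> polys V"
  by (induction A rule: infinite_finite_induct) auto

lemma polys_const [simp, intro]: "const c \<in> polys V"
  by (auto simp: polys_iff monomials_def)

lemma polys_var [simp, intro]: "i \<in> V \<Longrightarrow> var i \<in> polys V"
  by (auto simp: polys_iff var_def monomials_def split: if_splits)

lemma polys_UNIV [simp]: "f \<in> polys UNIV"
  by (simp add: polys_iff monomials_def)

lemma polys_mono: "V \<subseteq> W \<Longrightarrow> polys V \<subseteq> polys W"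
  unfolding mpoly_ring_def monomials_def by (simp add: subset_iff)

lemma const_add: "const (a + b) = const a + const b"
  by (simp add: single_add)

lemma const_mult: "const (a * b) = const a * const b"
  by (simp add: mult_single)

lemma const_inverse: "c \<noteq> 0 \<Longrightarrow> const c * const (inverse c) = 1"
  by (simp flip: const_mult)

lemma const_eq_0_iff [simp]: "const c = 0 \<longleftrightarrow> c = 0"
  by (metis lookup_single_eq lookup_zero single_zero)

lemma polys_emptyE:
  assumes "f \<in> polys {}"
  obtains c where "f = const c"
proof -
  have keys: "Poly_Mapping.keys f \<subseteq> {0}"
    using assms by (force simp: mpoly_ring_def monomials_def)
  have "f = const (Poly_Mapping.lookup f 0)"
    using keys by (intro poly_mapping_eqI) (auto simp: lookup_single when_def in_keys_iff)
  then show ?thesis by (rule that)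
qed

definition monomial_value :: "(nat \<Rightarrow> 'a::comm_ring_1) \<Rightarrow> monomial \<Rightarrow> 'a" where
  "monomial_value \<sigma> m = (\<Prod>i\<in>Poly_Mapping.keys m. \<sigma> i ^ Poly_Mapping.lookup m i)"

lemma monomial_value_superset:
  "finite A \<Longrightarrow> Poly_Mapping.keys m \<subseteq> A \<Longrightarrow>
     monomial_value \<sigma> m = (\<Prod>i\<in>A. \<sigma> i ^ Poly_Mapping.lookup m i)"
  unfolding monomial_value_def by (rule prod.mono_neutral_left) (auto simp: in_keys_iff)

lemma monomial_value_0 [simp]: "monomial_value \<sigma> 0 = 1"
  by (simp add: monomial_value_def)

lemma monomial_value_add: "monomial_value \<sigma> (m + n) = monomial_value \<sigma> m * monomial_value \<sigma> n"
proof -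
  let ?A = "Poly_Mapping.keys m \<union> Poly_Mapping.keys n"
  have "monomial_value \<sigma> (m + n) = (\<Prod>i\<in>?A. \<sigma> i ^ Poly_Mapping.lookup (m + n) i)"
    using Poly_Mapping.keys_add[of m n] by (intro monomial_value_superset) auto
  also have "\<dots> = (\<Prod>i\<in>?A. \<sigma> i ^ Poly_Mapping.lookup m i) * (\<Prod>i\<in>?A. \<sigma> i ^ Poly_Mapping.lookup n i)"
    by (simp add: lookup_add power_add prod.distrib)
  also have "\<dots> = monomial_value \<sigma> m * monomial_value \<sigma> n"
    by (subst (1 2) monomial_value_superset[of ?A]) auto
  finally show ?thesis .
qed

lemma monomial_value_single: "monomial_value \<sigma> (Poly_Mapping.single i n) = \<sigma> i ^ n"
  by (subst monomial_value_superset[of "{i}"]) auto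

lemma poly_mapping_sum_singles:
  "f = (\<Sum>m\<in>Poly_Mapping.keys f. Poly_Mapping.single m (Poly_Mapping.lookup f m))"
proof (rule poly_mapping_eqI)
  fix k
  have "Poly_Mapping.lookup (\<Sum>m\<in>Poly_Mapping.keys f. Poly_Mapping.single m (Poly_Mapping.lookup f m)) k =
        (\<Sum>m\<in>Poly_Mapping.keys f. if k = m then Poly_Mapping.lookup f k else 0)"
    by (auto simp: lookup_sum lookup_single when_def intro!: sum.cong)
  also have "\<dots> = Poly_Mapping.lookup f k"
    by (simp add: in_keys_iff)
  finally show "Poly_Mapping.lookup f k = Poly_Mapping.lookup (\<Sum>m\<in>Poly_Mapping.keys f. Poly_Mapping.single m (Poly_Mapping.lookup f m)) k"
    by simp
qed

definition evaluation :: "('k::field \<Rightarrow> 'a::comm_ring_1) \<Rightarrow> (nat \<Rightarrow> 'a) \<Rightarrow> 'k mpoly \<Rightarrow> 'a" where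
  "evaluation \<phi> \<sigma> f =
     (\<Sum>m\<in>Poly_Mapping.keys f. \<phi> (Poly_Mapping.lookup f m) * monomial_value \<sigma> m)"

locale coefficient_hom =
  fixes \<phi> :: "'k::field \<Rightarrow> 'a::comm_ring_1"
  assumes hom_add: "\<phi> (a + b) = \<phi> a + \<phi> b"
    and hom_mult: "\<phi> (a * b) = \<phi> a * \<phi> b"
    and hom_1: "\<phi> 1 = 1"
begin

lemma hom_0: "\<phi> 0 = 0"
  using hom_add[of 0 0] by simp

lemma evaluation_superset:
  "finite A \<Longrightarrow> Poly_Mapping.keys f \<subseteq> A \<Longrightarrow>
     evaluation \<phi> \<sigma> f = (\<Sum>m\<in>A. \<phi> (Poly_Mapping.lookup f m) * monomial_value \<sigma> m)"
  unfolding evaluation_def by (rule sum.mono_neutral_left) (auto simp: in_keys_iff hom_0)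

lemma evaluation_0 [simp]: "evaluation \<phi> \<sigma> 0 = 0"
  by (simp add: evaluation_def)

lemma evaluation_single:
  "evaluation \<phi> \<sigma> (Poly_Mapping.single m c) = \<phi> c * monomial_value \<sigma> m"
  by (subst evaluation_superset[of "{m}"]) auto

lemma evaluation_1 [simp]: "evaluation \<phi> \<sigma> 1 = 1"
  using evaluation_single[of \<sigma> 0 1] by (simp add: hom_1)

lemma evaluation_var: "evaluation \<phi> \<sigma> (var i) = \<sigma> i"
  by (simp add: var_def evaluation_single monomial_value_single hom_1)

lemma evaluation_const: "evaluation \<phi> \<sigma> (const c) = \<phi> c"
  by (simp add: evaluation_single)

lemma evaluation_add: "evaluation \<phi> \<sigma> (f + g) = evaluation \<phi> \<sigma> f + evaluation \<phi> \<sigma> g"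
proof -
  let ?A = "Poly_Mapping.keys f \<union> Poly_Mapping.keys g"
  have "evaluation \<phi> \<sigma> (f + g) = (\<Sum>m\<in>?A. \<phi> (Poly_Mapping.lookup (f + g) m) * monomial_value \<sigma> m)"
    using Poly_Mapping.keys_add[of f g] by (intro evaluation_superset) auto
  also have "\<dots> = (\<Sum>m\<in>?A. \<phi> (Poly_Mapping.lookup f m) * monomial_value \<sigma> m)
                + (\<Sum>m\<in>?A. \<phi> (Poly_Mapping.lookup g m) * monomial_value \<sigma> m)"
    by (simp add: lookup_add hom_add distrib_right sum.distrib)
  also have "\<dots> = evaluation \<phi> \<sigma> f + evaluation \<phi> \<sigma> g"
    by (subst (1 2) evaluation_superset[of ?A]) auto
  finally show ?thesis .
qed

lemma evaluation_sum: "evaluation \<phi> \<sigma> (sum f A) = (\<Sum>i\<in>A. evaluation \<phi> \<sigma> (f i))"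
  by (induction A rule: infinite_finite_induct) (auto simp: evaluation_add)

lemma evaluation_mult: "evaluation \<phi> \<sigma> (f * g) = evaluation \<phi> \<sigma> f * evaluation \<phi> \<sigma> g"
proof -
  let ?s = "\<lambda>f m. Poly_Mapping.single m (Poly_Mapping.lookup f m)"
  have "f * g = (\<Sum>m\<in>Poly_Mapping.keys f. \<Sum>n\<in>Poly_Mapping.keys g. ?s f m * ?s g n)"
    by (subst poly_mapping_sum_singles[of f], subst poly_mapping_sum_singles[of g])
       (simp add: sum_product)
  also have "evaluation \<phi> \<sigma> \<dots> =
      (\<Sum>m\<in>Poly_Mapping.keys f. \<Sum>n\<in>Poly_Mapping.keys g. evaluation \<phi> \<sigma> (?s f m) * evaluation \<phi> \<sigma> (?s g n))"
    by (simp add: evaluation_sum mult_single evaluation_single hom_mult monomial_value_add mult_ac)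
  also have "\<dots> = evaluation \<phi> \<sigma> f * evaluation \<phi> \<sigma> g"
    by (simp add: evaluation_def[of _ _ f] evaluation_def[of _ _ g] sum_product evaluation_single)
  finally show ?thesis .
qed

lemma evaluation_uminus: "evaluation \<phi> \<sigma> (- f) = - evaluation \<phi> \<sigma> f"
  using evaluation_add[of \<sigma> f "- f"] by (simp add: eq_neg_iff_add_eq_0 add.commute)

lemma evaluation_diff: "evaluation \<phi> \<sigma> (f - g) = evaluation \<phi> \<sigma> f - evaluation \<phi> \<sigma> g"
  using evaluation_add[of \<sigma> f "- g"] by (simp add: evaluation_uminus)

lemma evaluation_power: "evaluation \<phi> \<sigma> (f ^ n) = evaluation \<phi> \<sigma> f ^ n"
  by (induction n) (auto simp: evaluation_mult)

lemmas evaluation_simps = evaluation_var evaluation_const evaluation_add evaluation_sum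
  evaluation_mult evaluation_uminus evaluation_diff evaluation_power

end

lemma single_eq_const_mult: "Poly_Mapping.single m c = const c * monomial_value var m"
proof -
  have *: "monomial_value var m = Poly_Mapping.single m (1::'k::field)" for m
  proof (induction m rule: update_induct)
    case const
    then show ?case by simp
  next
    case (update f a b)
    have "Poly_Mapping.update a b f = f + Poly_Mapping.single a b"
      using update by (intro poly_mapping_eqI)
        (auto simp: lookup_update lookup_add lookup_single when_def in_keys_iff)
    moreover have "var a ^ b = Poly_Mapping.single (Poly_Mapping.single a b) (1::'k)"
      by (induction b) (auto simp: var_def mult_single simp flip: single_add)
    ultimately show ?case
      using update by (simp add: monomial_value_add monomial_value_single mult_single)
  qed
  show ?thesis by (simp add: * mult_single)
qed

text \<open>
  The rule by which two ring homomorphisms, or the coefficients of an expansion, are compared on the variables alone.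
\<close>

lemma polys_induct [consumes 1, case_names const add var]:
  assumes f: "f \<in> polys V"
    and const: "\<And>c. Q (const c)"
    and add: "\<And>f g. f \<in> polys V \<Longrightarrow> g \<in> polys V \<Longrightarrow> Q f \<Longrightarrow> Q g \<Longrightarrow> Q (f + g)"
    and var: "\<And>f i. f \<in> polys V \<Longrightarrow> i \<in> V \<Longrightarrow> Q f \<Longrightarrow> Q (f * var i)"
  shows "Q f"
proof -
  have pow: "Q (f * var i ^ n) \<and> f * var i ^ n \<in> polys V" if "f \<in> polys V" "i \<in> V" "Q f" for f i n
    using that by (induction n) (auto simp: algebra_simps polys_mult intro!: var[of "f * var i ^ n" i for f i n, simplified algebra_simps])
  have mon: "Q (const c * (\<Prod>i\<in>A. var i ^ h i)) \<and> const c * (\<Prod>i\<in>A. var i ^ h i) \<in> polys V"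
    if "finite A" "A \<subseteq> V" for c A h
    using that
  proof (induction A)
    case empty
    show ?case using const by simp
  next
    case (insert x A)
    then show ?case
      using pow[of "const c * (\<Prod>i\<in>A. var i ^ h i)" x "h x"] by (simp add: mult_ac)
  qed
  have "Q (\<Sum>m\<in>A. Poly_Mapping.single m (Poly_Mapping.lookup f m)) \<and>
        (\<Sum>m\<in>A. Poly_Mapping.single m (Poly_Mapping.lookup f m)) \<in> polys V"
    if "finite A" "A \<subseteq> monomials V" for A
    using that
  proof (induction A)
    case empty
    show ?case using const[of 0] by simp
  next
    case (insert m A)
    then have "Q (Poly_Mapping.single m (Poly_Mapping.lookup f m)) \<and>
               Poly_Mapping.single m (Poly_Mapping.lookup f m) \<in> polys V"
      using mon[of "Poly_Mapping.keys m" "Poly_Mapping.lookup f m" "Poly_Mapping.lookup m"]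
      by (auto simp: monomials_def single_eq_const_mult[of m] monomial_value_def)
    with insert show ?case by (auto intro: add)
  qed
  from this[of "Poly_Mapping.keys f"] show ?thesis
    using f poly_mapping_sum_singles[of f] by (auto simp: polys_iff)
qed

subsection \<open>Substitution\<close>

interpretation const_hom: coefficient_hom "const :: 'k::field \<Rightarrow> 'k mpoly"
  by unfold_locales (simp_all add: const_add const_mult)

abbreviation subst :: "(nat \<Rightarrow> 'k::field mpoly) \<Rightarrow> 'k mpoly \<Rightarrow> 'k mpoly" where
  "subst \<equiv> evaluation const"

lemmas subst_simps = const_hom.evaluation_simps

lemma subst_in_polys:
  assumes "f \<in> polys Z" "\<And>i. i \<in> Z \<Longrightarrow> \<sigma> i \<in> polys V"
  shows "subst \<sigma> f \<in> polys V"
  using assms(1) by (induction rule: polys_induct) (auto simp: subst_simps assms(2))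

lemma subst_cong:
  assumes "f \<in> polys Z" "\<And>i. i \<in> Z \<Longrightarrow> \<sigma> i = \<tau> i"
  shows "subst \<sigma> f = subst \<tau> f"
  using assms(1) by (induction rule: polys_induct) (auto simp: subst_simps assms(2))

lemma subst_subst: "subst \<sigma> (subst \<tau> f) = subst (\<lambda>i. subst \<sigma> (\<tau> i)) f"
proof -
  have "f \<in> polys UNIV" by simp
  then show ?thesis by (induction rule: polys_induct) (auto simp: subst_simps)
qed

lemma subst_var [simp]: "subst var f = f"
proof -
  have "f \<in> polys UNIV" by simp
  then show ?thesis by (induction rule: polys_induct) (auto simp: subst_simps)
qed

subsection \<open>Expansion in one variable\<close>

text \<open>Reading a polynomial as a univariate one in \<open>x\<^sub>j\<close> makes degrees, leading coefficients
  and division available from the theory of univariate polynomials.\<close>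

interpretation poly_const_hom: coefficient_hom "\<lambda>c::'k::field. [:const c:]"
  by unfold_locales (simp_all add: const_add const_mult one_pCons)

definition expansion :: "nat \<Rightarrow> 'k::field mpoly \<Rightarrow> 'k mpoly poly" where
  "expansion j = evaluation (\<lambda>c. [:const c:]) (\<lambda>i. if i = j then [:0, 1:] else [:var i:])"

lemma expansion_var: "expansion j (var i) = (if i = j then [:0, 1:] else [:var i:])"
  by (simp add: expansion_def poly_const_hom.evaluation_simps)

lemma expansion_simps [simp]:
  "expansion j (var j) = [:0, 1:]"
  "expansion j (const c) = [:const c:]" "expansion j 0 = 0" "expansion j 1 = 1"
  "expansion j (f + g) = expansion j f + expansion j g"
  "expansion j (f - g) = expansion j f - expansion j g"
  "expansion j (- f) = - expansion j f"
  "expansion j (f * g) = expansion j f * expansion j g"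
  "expansion j (f ^ n) = expansion j f ^ n"
  "expansion j (sum h A) = (\<Sum>i\<in>A. expansion j (h i))"
  by (simp_all add: expansion_def poly_const_hom.evaluation_simps)

lemma poly_expansion [simp]: "poly (expansion j f) (var j) = f"
proof -
  have "f \<in> polys UNIV" by simp
  then show ?thesis by (induction rule: polys_induct) (auto simp: expansion_var)
qed

lemma expansion_inject [simp]: "expansion j f = expansion j g \<longleftrightarrow> f = g"
  by (metis poly_expansion)

lemma expansion_eq_0_iff [simp]: "expansion j f = 0 \<longleftrightarrow> f = 0"
  by (metis expansion_inject expansion_simps(3))

lemma expansion_free:
  assumes "f \<in> polys V" "j \<notin> V"
  shows "expansion j f = [:f:]"
  using assms(1) by (induction rule: polys_induct) (use assms(2) in \<open>auto simp: expansion_var\<close>)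

lemma coeff_expansion_in_polys:
  assumes "f \<in> polys V"
  shows "coeff (expansion j f) k \<in> polys (V - {j})"
  using assms
proof (induction arbitrary: k rule: polys_induct)
  case (const c)
  then show ?case by (auto simp: coeff_pCons split: nat.splits)
next
  case (add f g)
  then show ?case by auto
next
  case (var f i)
  then show ?case by (auto simp: expansion_var coeff_pCons polys_mult split: nat.splits)
qed

lemma poly_in_polys:
  assumes "\<And>k. coeff F k \<in> polys V" "x \<in> polys V"
  shows "poly F x \<in> polys V"
  unfolding poly_altdef using assms by auto

lemma expansion_poly:
  assumes "\<And>k. coeff F k \<in> polys V" "j \<notin> V"
  shows "expansion j (poly F (var j)) = F"
  using assms(1)
proof (induction F)
  case (pCons a F)
  have "expansion j a = [:a:]"
    using pCons.prems[of 0] assms(2) by (simp add: expansion_free)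
  moreover have "expansion j (poly F (var j)) = F"
    using pCons.prems[of "Suc k" for k] by (intro pCons.IH) simp
  ultimately show ?case by simp
qed simp

lemma expansion_single:
  "expansion j (Poly_Mapping.single m c) =
     monom (Poly_Mapping.single (Poly_Mapping.update j 0 m) c) (Poly_Mapping.lookup m j)"
proof -
  let ?m = "Poly_Mapping.update j 0 m"
  have "m = ?m + Poly_Mapping.single j (Poly_Mapping.lookup m j)"
    by (rule poly_mapping_eqI) (auto simp: lookup_update lookup_add lookup_single when_def)
  then have "Poly_Mapping.single m c =
      Poly_Mapping.single ?m c * Poly_Mapping.single (Poly_Mapping.single j (Poly_Mapping.lookup m j)) 1"
    by (simp add: mult_single)
  also have "\<dots> = Poly_Mapping.single ?m c * var j ^ Poly_Mapping.lookup m j"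
    by (simp add: single_eq_const_mult[of "Poly_Mapping.single j _"] monomial_value_single)
  finally have *: "Poly_Mapping.single m c = Poly_Mapping.single ?m c * var j ^ Poly_Mapping.lookup m j" .
  have "Poly_Mapping.single ?m c \<in> polys (UNIV - {j})"
    by (auto simp: polys_iff monomials_def in_keys_iff lookup_update split: if_splits)
  then have "expansion j (Poly_Mapping.single ?m c) = [:Poly_Mapping.single ?m c:]"
    by (rule expansion_free) simp
  then show ?thesis
    by (subst *) (simp add: monom_altdef)
qed

lemma expansion_eq_sum:
  "expansion j f = (\<Sum>m\<in>Poly_Mapping.keys f.
     monom (Poly_Mapping.single (Poly_Mapping.update j 0 m) (Poly_Mapping.lookup f m)) (Poly_Mapping.lookup m j))"
  by (subst poly_mapping_sum_singles[of f]) (simp add: expansion_single)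

lemma coeff_expansion_eq_sum:
  "coeff (expansion j f) k = (\<Sum>m\<in>{m \<in> Poly_Mapping.keys f. Poly_Mapping.lookup m j = k}.
     Poly_Mapping.single (Poly_Mapping.update j 0 m) (Poly_Mapping.lookup f m))"
proof -
  have "coeff (expansion j f) k = (\<Sum>m\<in>Poly_Mapping.keys f. if Poly_Mapping.lookup m j = k then
      Poly_Mapping.single (Poly_Mapping.update j 0 m) (Poly_Mapping.lookup f m) else 0)"
    by (simp add: expansion_eq_sum coeff_sum)
  then show ?thesis
    by (simp add: sum.inter_filter)
qed

lemma lookup_coeff_expansion:
  assumes "Poly_Mapping.lookup n j = 0"
  shows "Poly_Mapping.lookup (coeff (expansion j f) k) n =
           Poly_Mapping.lookup f (n + Poly_Mapping.single j k)"
proof -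
  have iff: "Poly_Mapping.update j 0 m = n \<and> Poly_Mapping.lookup m j = k \<longleftrightarrow> m = n + Poly_Mapping.single j k" for m
    using assms by (auto simp: poly_mapping_eq_iff fun_eq_iff lookup_update lookup_add lookup_single when_def)
  have "Poly_Mapping.lookup (coeff (expansion j f) k) n =
      (\<Sum>m\<in>Poly_Mapping.keys f. if Poly_Mapping.lookup m j = k then
         Poly_Mapping.lookup (Poly_Mapping.single (Poly_Mapping.update j 0 m) (Poly_Mapping.lookup f m)) n else 0)"
    by (simp add: coeff_expansion_eq_sum lookup_sum sum.inter_filter if_distrib[of "\<lambda>p. Poly_Mapping.lookup p n"] cong: if_cong)
  also have "\<dots> = (\<Sum>m\<in>Poly_Mapping.keys f. if m = n + Poly_Mapping.single j k then Poly_Mapping.lookup f m else 0)"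
    using iff by (intro sum.cong) (auto simp: lookup_single when_def)
  also have "\<dots> = Poly_Mapping.lookup f (n + Poly_Mapping.single j k)"
    by (simp add: in_keys_iff)
  finally show ?thesis .
qed

lemma deg_in_eq_degree:
  assumes "f \<noteq> 0"
  shows "deg_in j f = degree (expansion j f)"
proof -
  let ?D = "(\<lambda>m. Poly_Mapping.lookup m j) ` Poly_Mapping.keys f"
  have "finite ?D" "?D \<noteq> {}" using assms by auto
  then have "Max ?D \<in> ?D" by simp
  then obtain m where m: "m \<in> Poly_Mapping.keys f" "Poly_Mapping.lookup m j = Max ?D" by auto
  have "m = Poly_Mapping.update j 0 m + Poly_Mapping.single j (Poly_Mapping.lookup m j)"
    by (rule poly_mapping_eqI) (auto simp: lookup_update lookup_add lookup_single when_def)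
  then have "Poly_Mapping.lookup (coeff (expansion j f) (Max ?D)) (Poly_Mapping.update j 0 m) \<noteq> 0"
    using m by (subst lookup_coeff_expansion) (auto simp: lookup_update in_keys_iff)
  then have "Max ?D \<le> degree (expansion j f)"
    by (intro le_degree) auto
  moreover have "degree (expansion j f) \<le> Max ?D"
  proof (rule degree_le, intro allI impI)
    fix i assume i: "Max ?D < i"
    have "x \<le> Max ?D" if "x \<in> ?D" for x
      using that \<open>finite ?D\<close> by simp
    with i have "i \<notin> ?D" using leD by blast
    then have *: "{m \<in> Poly_Mapping.keys f. Poly_Mapping.lookup m j = i} = {}"
      by blast
    show "coeff (expansion j f) i = 0"
      unfolding coeff_expansion_eq_sum * by simp
  qed
  ultimately show ?thesis by (simp add: deg_in_def)
qed

lemma lead_coeff_in_eq: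
  assumes "f \<noteq> 0"
  shows "lead_coeff_in j f = lead_coeff (expansion j f)"
  by (simp add: lead_coeff_in_def coeff_expansion_eq_sum deg_in_eq_degree[OF assms])

lemma lead_coeff_in_0 [simp]: "lead_coeff_in j 0 = 0"
  by (simp add: lead_coeff_in_def)

section \<open>Ideals and the ascending chain condition\<close>

abbreviation pideal :: "nat set \<Rightarrow> 'k::field mpoly set \<Rightarrow> bool" where
  "pideal V J \<equiv> ideal J (mpoly_ring V)"

abbreviation pprime :: "nat set \<Rightarrow> 'k::field mpoly set \<Rightarrow> bool" where
  "pprime V J \<equiv> primeideal J (mpoly_ring V)"

lemma ring_mpoly_ring: "ring (mpoly_ring V)"
  using cring_mpoly_ring by (rule cring.axioms)

lemma a_inv_mpoly_ring:
  assumes "f \<in> polys V"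
  shows "\<ominus>\<^bsub>mpoly_ring V\<^esub> f = - f"
proof -
  interpret ring "mpoly_ring V :: 'a mpoly ring" by (rule ring_mpoly_ring)
  show ?thesis
    using minus_equality[of "- f" f] assms by auto
qed

lemma pideal_subset: "pideal V J \<Longrightarrow> J \<subseteq> polys V"
  by (simp add: additive_subgroup.a_subset ideal.axioms(1))

lemma pideal_0: "pideal V J \<Longrightarrow> 0 \<in> J"
  using additive_subgroup.zero_closed[OF ideal.axioms(1)] by fastforce

lemma pideal_add: "pideal V J \<Longrightarrow> f \<in> J \<Longrightarrow> g \<in> J \<Longrightarrow> f + g \<in> J"
  using additive_subgroup.a_closed[OF ideal.axioms(1)] by fastforce

lemma pideal_mult: "pideal V J \<Longrightarrow> f \<in> polys V \<Longrightarrow> g \<in> J \<Longrightarrow> f * g \<in> J"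
  using ideal.I_l_closed[of J "mpoly_ring V" g f] by simp

lemma pideal_mult2: "pideal V J \<Longrightarrow> f \<in> polys V \<Longrightarrow> g \<in> J \<Longrightarrow> g * f \<in> J"
  using ideal.I_r_closed[of J "mpoly_ring V" g f] by simp

lemma pideal_uminus: "pideal V J \<Longrightarrow> f \<in> J \<Longrightarrow> - f \<in> J"
  using pideal_mult[of J V "- 1" f] polys_uminus[of 1 V] by auto

lemma pideal_diff: "pideal V J \<Longrightarrow> f \<in> J \<Longrightarrow> g \<in> J \<Longrightarrow> f - g \<in> J"
  using pideal_add[of J V f "- g"] pideal_uminus[of J V g] by auto

lemma pideal_sum: "pideal V J \<Longrightarrow> (\<And>i. i \<in> A \<Longrightarrow> f i \<in> J) \<Longrightarrow> sum f A \<in> J"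
  by (induction A rule: infinite_finite_induct) (auto simp: pideal_0 pideal_add)

lemma pideal_add_cancel: "pideal V J \<Longrightarrow> f - g \<in> J \<Longrightarrow> f \<in> J \<longleftrightarrow> g \<in> J"
  using pideal_add[of J V "f - g" g] pideal_diff[of J V f "f - g"] by auto

lemma pideal_eq_iff: "pideal V J \<Longrightarrow> 1 \<in> J \<Longrightarrow> J = polys V"
  using pideal_mult2[of J V _ 1] pideal_subset[of J V] by auto

lemma pidealI:
  assumes "J \<subseteq> polys V" "0 \<in> J" "\<And>f g. f \<in> J \<Longrightarrow> g \<in> J \<Longrightarrow> f + g \<in> J"
    and mult: "\<And>f g. f \<in> polys V \<Longrightarrow> g \<in> J \<Longrightarrow> f * g \<in> J"
  shows "pideal V J"
proof (rule idealI)
  show "ring (mpoly_ring V :: 'a mpoly ring)" by (rule ring_mpoly_ring)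
  have uminus: "- f \<in> J" if "f \<in> J" for f
    using mult[OF polys_uminus[OF polys_1] that] by simp
  show "subgroup J (add_monoid (mpoly_ring V))"
  proof
    fix x assume x: "x \<in> J"
    have "inv\<^bsub>add_monoid (mpoly_ring V)\<^esub> x = - x"
      using a_inv_mpoly_ring[of x V] x assms(1) by (auto simp: a_inv_def)
    then show "inv\<^bsub>add_monoid (mpoly_ring V)\<^esub> x \<in> J"
      using uminus[OF x] by simp
  qed (use assms in auto)
next
  fix a x :: "'a mpoly" assume ax: "a \<in> J" "x \<in> polys V"
  show "x \<otimes>\<^bsub>mpoly_ring V\<^esub> a \<in> J" using mult[of x a] ax by simp
  show "a \<otimes>\<^bsub>mpoly_ring V\<^esub> x \<in> J" using mult[of x a] ax by (simp add: mult.commute)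
qed

lemma pprime_pideal: "pprime V P \<Longrightarrow> pideal V P"
  by (rule primeideal.axioms)

lemma pprime_mult: "pprime V P \<Longrightarrow> f * g \<in> P \<Longrightarrow> f \<in> polys V \<Longrightarrow> g \<in> polys V \<Longrightarrow> f \<in> P \<or> g \<in> P"
  using primeideal.I_prime[of P "mpoly_ring V" f g] by simp

lemma pprime_1: "pprime V P \<Longrightarrow> 1 \<notin> P"
  using primeideal.I_notcarr[of P "mpoly_ring V"] pideal_eq_iff[of P V] pprime_pideal[of P V] by auto

lemma pprime_power: "pprime V P \<Longrightarrow> f \<in> polys V \<Longrightarrow> f ^ n \<in> P \<Longrightarrow> f \<in> P"
  by (induction n) (auto dest: pprime_mult pprime_1)

lemma pprimeI:
  assumes "pideal V P" "1 \<notin> P"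
    and "\<And>f g. f \<in> polys V \<Longrightarrow> g \<in> polys V \<Longrightarrow> f * g \<in> P \<Longrightarrow> f \<in> P \<or> g \<in> P"
  shows "pprime V P"
proof (rule primeidealI)
  show "polys V \<noteq> P" using assms(2) by auto
qed (use assms cring_mpoly_ring in auto)

lemma pideal_genideal: "S \<subseteq> polys V \<Longrightarrow> pideal V (genideal (mpoly_ring V) S)"
  by (rule ring.genideal_ideal[OF ring_mpoly_ring])

lemma genideal_subset: "S \<subseteq> polys V \<Longrightarrow> S \<subseteq> genideal (mpoly_ring V) S"
  by (rule ring.genideal_self[OF ring_mpoly_ring])

lemma genideal_least: "pideal V J \<Longrightarrow> S \<subseteq> J \<Longrightarrow> genideal (mpoly_ring V) S \<subseteq> J"
  by (rule ring.genideal_minimal[OF ring_mpoly_ring])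

lemma pideal_restrict:
  assumes "pideal V J" "W \<subseteq> V"
  shows "pideal W (J \<inter> polys W)"
  using assms polys_mono[of W V]
  by (intro pidealI) (auto simp: pideal_0 pideal_add intro: pideal_mult)

lemma pprime_restrict:
  assumes "pprime V P" "W \<subseteq> V"
  shows "pprime W (P \<inter> polys W)"
proof (rule pprimeI)
  show "pideal W (P \<inter> polys W)"
    using assms pprime_pideal by (blast intro: pideal_restrict)
  show "1 \<notin> P \<inter> polys W" using pprime_1[OF assms(1)] by simp
next
  fix f g :: "'a mpoly"
  assume "f \<in> polys W" "g \<in> polys W" "f * g \<in> P \<inter> polys W"
  then show "f \<in> P \<inter> polys W \<or> g \<in> P \<inter> polys W"
    using pprime_mult[OF assms(1), of f g] polys_mono[OF assms(2)] by blast
qed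

subsection \<open>Ideals of leading coefficients\<close>

text \<open>
  Allowing \<open>f\<close> of degree below \<open>k\<close>, whose coefficient at \<open>k\<close> is \<open>0\<close>, is what makes these sets ideals.
\<close>

definition coeff_ideal :: "nat \<Rightarrow> nat \<Rightarrow> 'k::field mpoly set \<Rightarrow> 'k mpoly set" where
  "coeff_ideal j k I = {coeff (expansion j f) k | f. f \<in> I \<and> degree (expansion j f) \<le> k}"

lemma coeff_idealI: "f \<in> I \<Longrightarrow> degree (expansion j f) \<le> k \<Longrightarrow> coeff (expansion j f) k \<in> coeff_ideal j k I"
  by (auto simp: coeff_ideal_def)

lemma lead_coeff_in_coeff_ideal:
  "f \<in> I \<Longrightarrow> degree (expansion j f) = k \<Longrightarrow> lead_coeff (expansion j f) \<in> coeff_ideal j k I"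
  using coeff_idealI[of f I j k] by simp

lemma coeff_ideal_mono: "I \<subseteq> J \<Longrightarrow> coeff_ideal j k I \<subseteq> coeff_ideal j k J"
  by (auto simp: coeff_ideal_def)

lemma coeff_ideal_Suc:
  assumes "pideal V I" "j \<in> V"
  shows "coeff_ideal j k I \<subseteq> coeff_ideal j (Suc k) I"
proof
  fix a assume "a \<in> coeff_ideal j k I"
  then obtain f where f: "f \<in> I" "degree (expansion j f) \<le> k" "a = coeff (expansion j f) k"
    by (auto simp: coeff_ideal_def)
  then have "var j * f \<in> I" "a = coeff (expansion j (var j * f)) (Suc k)"
    "degree (expansion j (var j * f)) \<le> Suc k"
    using assms by (auto intro!: pideal_mult simp: degree_pCons_eq_if)
  then show "a \<in> coeff_ideal j (Suc k) I" using coeff_idealI by blast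
qed

lemma coeff_ideal_le:
  assumes "pideal V I" "j \<in> V" "k \<le> l"
  shows "coeff_ideal j k I \<subseteq> coeff_ideal j l I"
  using assms(3) by (induction rule: dec_induct) (use coeff_ideal_Suc[OF assms(1,2)] in blast)+

lemma pideal_coeff_ideal:
  assumes "pideal V I"
  shows "pideal (V - {j}) (coeff_ideal j k I)"
proof (rule pidealI)
  show "coeff_ideal j k I \<subseteq> polys (V - {j})"
    using pideal_subset[OF assms] coeff_expansion_in_polys[of _ V j k] by (auto simp: coeff_ideal_def)
  show "0 \<in> coeff_ideal j k I"
    using pideal_0[OF assms] by (force simp: coeff_ideal_def)
next
  fix a b assume "a \<in> coeff_ideal j k I" "b \<in> coeff_ideal j k I"
  then obtain f g where "f \<in> I" "degree (expansion j f) \<le> k" "a = coeff (expansion j f) k"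
     "g \<in> I" "degree (expansion j g) \<le> k" "b = coeff (expansion j g) k"
    by (auto simp: coeff_ideal_def)
  then have "f + g \<in> I" "degree (expansion j (f + g)) \<le> k" "a + b = coeff (expansion j (f + g)) k"
    using pideal_add[OF assms] by (auto intro: degree_add_le)
  then show "a + b \<in> coeff_ideal j k I" unfolding coeff_ideal_def by blast
next
  fix a b :: "'a mpoly" assume a: "a \<in> polys (V - {j})" and "b \<in> coeff_ideal j k I"
  then obtain g where g: "g \<in> I" "degree (expansion j g) \<le> k" "b = coeff (expansion j g) k"
    by (auto simp: coeff_ideal_def)
  have *: "expansion j (a * g) = smult a (expansion j g)"
    using expansion_free[OF a, of j] by simp
  have "a * g \<in> I"
    using a g(1) polys_mono[of "V - {j}" V] by (intro pideal_mult[OF assms]) auto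
  moreover have "degree (expansion j (a * g)) \<le> k" "a * b = coeff (expansion j (a * g)) k"
    unfolding * using g(2,3) by (auto intro: order.trans[OF degree_smult_le])
  ultimately show "a * b \<in> coeff_ideal j k I" unfolding coeff_ideal_def by blast
qed

lemma degree_less_if_coeff_0:
  assumes "degree F \<le> k" "coeff F k = 0" "F \<noteq> 0"
  shows "degree F < k"
  using assms by (metis leading_coeff_0_iff nat_less_le)

text \<open>
  Subtracting from \<open>f \<in> J\<close> an element of \<open>I\<close> with the same leading coefficient lowers the degree.
\<close>

lemma pideal_subset_if_coeff_ideals:
  assumes I: "pideal V I" and J: "pideal V J" and sub: "I \<subseteq> J"
    and le: "\<And>k. coeff_ideal j k J \<subseteq> coeff_ideal j k I"
  shows "J \<subseteq> I"
proof -
  have "f \<in> I" if "f \<in> J" for f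
    using that
  proof (induction "degree (expansion j f)" arbitrary: f rule: less_induct)
    case less
    let ?k = "degree (expansion j f)"
    have "coeff (expansion j f) ?k \<in> coeff_ideal j ?k I"
      using le coeff_idealI[OF less.prems order.refl] by blast
    then obtain g where g: "g \<in> I" "degree (expansion j g) \<le> ?k"
      "coeff (expansion j f) ?k = coeff (expansion j g) ?k"
      by (auto simp: coeff_ideal_def)
    have fg: "f - g \<in> J" using less.prems g(1) sub pideal_diff[OF J] by blast
    have "f - g \<in> I"
    proof (cases "f - g = 0")
      case False
      have "degree (expansion j (f - g)) < ?k"
        using g(2,3) False by (intro degree_less_if_coeff_0) (auto intro: degree_diff_le)
      then show ?thesis using less.hyps fg by blast
    qed (simp add: pideal_0[OF I])
    then show ?case using pideal_add[OF I _ g(1)] by fastforce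
  qed
  then show ?thesis by blast
qed

subsection \<open>Ascending chain condition\<close>

text \<open>
  Hilbert's basis theorem, by induction on the number of variables. The coefficient ideals of degree \<open>k\<close> of the
  \<open>n\<close>-th ideal increase in both \<open>k\<close> and \<open>n\<close>. Once their diagonal is constant, only the finitely many
  rows of smaller degree remain to be stabilized.
\<close>

theorem pideal_chain_stabilizes:
  fixes J :: "nat \<Rightarrow> 'k::field mpoly set"
  assumes "finite V" "\<And>n. pideal V (J n)" "\<And>n. J n \<subseteq> J (Suc n)"
  shows "\<exists>N. \<forall>n\<ge>N. J n = J N"
  using assms
proof (induction V arbitrary: J rule: finite_induct)
  case empty
  have dich: "I = {0} \<or> I = polys {}" if I: "pideal {} I" for I :: "'k mpoly set"
  proof (cases "I = {0}")
    case False
    then obtain f where f: "f \<in> I" "f \<noteq> 0" using pideal_0[OF I] by blast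
    then obtain c where "f = const c" using pideal_subset[OF I] polys_emptyE by blast
    with f(2) have "f = const c" "c \<noteq> 0" by auto
    with f(1) have "1 \<in> I" using pideal_mult[OF I, of "const (inverse c)" f]
      by (simp flip: const_mult)
    then show ?thesis using pideal_eq_iff[OF I] by blast
  qed simp
  have mono: "J m \<subseteq> J n" if "m \<le> n" for m n
    using lift_Suc_mono_le[of J m n] empty(2) that by blast
  show ?case
  proof (cases "\<exists>N. J N = polys {}")
    case True
    then obtain N where "J N = polys {}" by blast
    then have "J n = J N" if "n \<ge> N" for n
      using mono[OF that] pideal_subset[OF empty(1)[of n]] by blast
    then show ?thesis by blast
  next
    case False
    then have "J n = {0}" for n using dich[OF empty(1)[of n]] by blast
    then show ?thesis by blast
  qed
next
  case (insert j V)
  let ?L = "\<lambda>k n. coeff_ideal j k (J n)"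
  have V: "insert j V - {j} = V" using insert.hyps by auto
  have ideal: "pideal V (?L k n)" for k n
    using pideal_coeff_ideal[OF insert.prems(1)[of n], of j k] V by simp
  have J_mono: "J m \<subseteq> J n" if "m \<le> n" for m n
    using lift_Suc_mono_le[of J m n] insert.prems(2) that by blast
  have L_mono: "?L k m \<subseteq> ?L l n" if "k \<le> l" "m \<le> n" for k l m n
    using coeff_ideal_le[OF insert.prems(1)[of m], of j k l] that(1)
      coeff_ideal_mono[OF J_mono[OF that(2)], of j l] by auto
  obtain N where N: "?L n n = ?L N N" if "n \<ge> N" for n
    using insert.IH[of "\<lambda>n. ?L n n"] ideal L_mono by (metis le_SucI order.refl)
  have "\<exists>M. \<forall>n\<ge>M. ?L k n = ?L k M" for k
    by (rule insert.IH) (use ideal L_mono in auto)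
  then obtain M where M: "\<And>k n. n \<ge> M k \<Longrightarrow> ?L k n = ?L k (M k)" by metis
  define B where "B = N + (\<Sum>k\<le>N. M k)"
  have eq: "?L k n = ?L k B" if "n \<ge> B" for k n
  proof (cases "k \<le> N")
    case True
    then have "M k \<le> B" unfolding B_def by (intro trans_le_add2 member_le_sum) auto
    then show ?thesis using M[of k n] M[of k B] that by simp
  next
    case False
    \<comment> \<open>beyond the diagonal index \<open>N\<close> all coefficient ideals are caught between \<open>?L N N\<close> and a later diagonal term\<close>
    have *: "?L k m = ?L N N" if "m \<ge> N" for m
      using L_mono[of N k N m] L_mono[of k "max k m" m "max k m"] N[of "max k m"] False that by auto
    show ?thesis using *[of n] *[of B] that by (simp add: B_def)
  qed
  have "J n = J B" if "n \<ge> B" for n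
  proof
    show "J n \<subseteq> J B"
      by (rule pideal_subset_if_coeff_ideals[OF insert.prems(1) insert.prems(1) J_mono[OF that]])
         (use eq[OF that] in blast)
  qed (rule J_mono[OF that])
  then show ?case by blast
qed

corollary maximal_pideal_exists:
  fixes F :: "'k::field mpoly set set"
  assumes "finite V" "\<And>J. J \<in> F \<Longrightarrow> pideal V J" "F \<noteq> {}"
  shows "\<exists>M\<in>F. \<forall>J\<in>F. M \<subseteq> J \<longrightarrow> J = M"
proof (rule ccontr)
  assume contra: "\<not> ?thesis"
  obtain J0 where "J0 \<in> F" using assms(3) by blast
  have "\<exists>J. \<forall>n. J n \<in> F \<and> J n \<subset> J (Suc n)"
    by (rule dependent_nat_choice[where P = "\<lambda>_ J. J \<in> F" and Q = "\<lambda>_ J J'. J \<subset> J'"])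
       (use contra \<open>J0 \<in> F\<close> in \<open>auto simp: psubset_eq\<close>)
  then obtain J where J: "\<And>n. J n \<in> F" "\<And>n. J n \<subset> J (Suc n)" by blast
  then obtain N where "\<forall>n\<ge>N. J n = J N"
    using pideal_chain_stabilizes[OF assms(1), of J] assms(2) by (metis psubset_imp_subset)
  then show False using J(2)[of N] by (metis le_SucI order.refl psubset_eq)
qed

subsection \<open>Associated primes\<close>

lemma associated_prime_pprime: "P \<in> associated_primes V I \<Longrightarrow> pprime V P"
  by (simp add: associated_primes_def)

lemma associated_prime_contains:
  assumes "P \<in> associated_primes V I" "pideal V I"
  shows "I \<subseteq> P"
  using assms pideal_mult2[OF assms(2)] pideal_subset[OF assms(2)]
  by (auto simp: associated_primes_def)

text \<open>
  An annihilator \<open>(I : f)\<close> that is maximal among those of elements \<open>f\<close> that do not die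
  when \<open>M\<close> is inverted is an associated prime.
\<close>

theorem associated_prime_avoiding:
  assumes fin: "finite V" and I: "pideal V I" and M: "M \<subseteq> polys V" "1 \<in> M"
    and mult: "\<And>s t. s \<in> M \<Longrightarrow> t \<in> M \<Longrightarrow> s * t \<in> M" and disj: "M \<inter> I = {}"
  shows "\<exists>P\<in>associated_primes V I. P \<inter> M = {}"
proof -
  define ann where "ann f = {r \<in> polys V. r * f \<in> I}" for f
  define A where "A = {f \<in> polys V. \<forall>s\<in>M. s * f \<notin> I}"
  have ann: "pideal V (ann f)" for f
    using I unfolding ann_def
    by (intro pidealI) (auto simp: pideal_0 pideal_add distrib_right mult.assoc pideal_mult)
  have "1 \<in> A" using disj by (auto simp: A_def)
  then obtain f where f: "f \<in> A" and max: "\<And>g. g \<in> A \<Longrightarrow> ann f \<subseteq> ann g \<Longrightarrow> ann g = ann f"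
  proof -
    have "ann ` A \<noteq> {}" using \<open>1 \<in> A\<close> by auto
    then have "\<exists>M\<in>ann ` A. \<forall>J\<in>ann ` A. M \<subseteq> J \<longrightarrow> J = M"
      using ann by (intro maximal_pideal_exists[OF fin]) auto
    then show ?thesis using that by auto
  qed
  have fV: "f \<in> polys V" using f by (simp add: A_def)
  have "pprime V (ann f)"
  proof (rule pprimeI[OF ann])
    show "1 \<notin> ann f" using f M(2) by (auto simp: ann_def A_def)
  next
    fix a b assume ab: "a \<in> polys V" "b \<in> polys V" "a * b \<in> ann f"
    have scale: "ann g \<subseteq> ann (h * g)" if "h \<in> polys V" for g h
      using that pideal_mult[OF I, of h] by (auto simp: ann_def mult.left_commute[of _ h])
    show "a \<in> ann f \<or> b \<in> ann f"
    proof (cases "b * f \<in> A")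
      case True
      then have "ann (b * f) = ann f" using max scale ab by blast
      then show ?thesis using ab by (auto simp: ann_def mult.assoc)
    next
      case False
      then obtain s where s: "s \<in> M" "s * (b * f) \<in> I" using ab fV by (auto simp: A_def)
      have "s * f \<in> A"
        unfolding A_def
      proof (intro CollectI conjI ballI)
        show "s * f \<in> polys V" using s(1) M(1) fV by blast
        show "t * (s * f) \<notin> I" if "t \<in> M" for t
          using f mult[OF that s(1)] by (auto simp: A_def simp flip: mult.assoc)
      qed
      then have "ann (s * f) = ann f" using max scale s M by blast
      then show ?thesis using s ab by (auto simp: ann_def mult.left_commute)
    qed
  qed
  moreover have "ann f \<inter> M = {}" using f by (auto simp: ann_def A_def)
  ultimately show ?thesis using fV unfolding associated_primes_def ann_def by blast
qed

corollary prime_avoiding: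
  assumes "finite V" "pideal V I" "M \<subseteq> polys V" "1 \<in> M"
    "\<And>s t. s \<in> M \<Longrightarrow> t \<in> M \<Longrightarrow> s * t \<in> M" "M \<inter> I = {}"
  obtains P where "pprime V P" "I \<subseteq> P" "P \<inter> M = {}"
  using associated_prime_avoiding[OF assms] associated_prime_pprime associated_prime_contains[OF _ assms(2)]
  by blast



section \<open>Modules generated by finitely many elements up to a denominator\<close>

definition ring_closed :: "'a::comm_ring_1 set \<Rightarrow> bool" where
  "ring_closed S \<longleftrightarrow> 0 \<in> S \<and> 1 \<in> S \<and> (\<forall>a\<in>S. \<forall>b\<in>S. a + b \<in> S \<and> a * b \<in> S) \<and> (\<forall>a\<in>S. - a \<in> S)"

lemma ring_closedD:
  assumes "ring_closed S"
  shows "0 \<in> S" "1 \<in> S" "a \<in> S \<Longrightarrow> b \<in> S \<Longrightarrow> a + b \<in> S" "a \<in> S \<Longrightarrow> b \<in> S \<Longrightarrow> a * b \<in> S"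
    "a \<in> S \<Longrightarrow> - a \<in> S"
  using assms by (auto simp: ring_closed_def)

lemma ring_closed_diff: "ring_closed S \<Longrightarrow> a \<in> S \<Longrightarrow> b \<in> S \<Longrightarrow> a - b \<in> S"
  using ring_closedD(3)[of S a "- b"] ring_closedD(5)[of S b] by simp

lemma ring_closed_sum: "ring_closed S \<Longrightarrow> (\<And>i. i \<in> A \<Longrightarrow> f i \<in> S) \<Longrightarrow> sum f A \<in> S"
  by (induction A rule: infinite_finite_induct) (auto simp: ring_closedD)

lemma ring_closed_power: "ring_closed S \<Longrightarrow> a \<in> S \<Longrightarrow> a ^ n \<in> S"
  by (induction n) (auto simp: ring_closedD)

lemma ring_closed_polys: "ring_closed (polys V)"
  by (auto simp: ring_closed_def)

definition lin_comb :: "'a::comm_ring_1 set \<Rightarrow> 'a set \<Rightarrow> 'a set" where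
  "lin_comb S E = {(\<Sum>e\<in>E. s e * e) | s. \<forall>e\<in>E. s e \<in> S}"

lemma lin_combI: "(\<And>e. e \<in> E \<Longrightarrow> s e \<in> S) \<Longrightarrow> (\<Sum>e\<in>E. s e * e) \<in> lin_comb S E"
  by (auto simp: lin_comb_def)

lemma lin_comb_add:
  assumes "ring_closed S" "g \<in> lin_comb S E" "h \<in> lin_comb S E"
  shows "g + h \<in> lin_comb S E"
proof -
  obtain s t where "\<forall>e\<in>E. s e \<in> S" "g = (\<Sum>e\<in>E. s e * e)" "\<forall>e\<in>E. t e \<in> S" "h = (\<Sum>e\<in>E. t e * e)"
    using assms(2,3) by (auto simp: lin_comb_def)
  then show ?thesis
    using lin_combI[of E "\<lambda>e. s e + t e" S] assms(1) by (simp add: sum.distrib distrib_right ring_closedD)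
qed

lemma lin_comb_mult:
  assumes "ring_closed S" "a \<in> S" "h \<in> lin_comb S E"
  shows "a * h \<in> lin_comb S E"
proof -
  obtain t where "\<forall>e\<in>E. t e \<in> S" "h = (\<Sum>e\<in>E. t e * e)"
    using assms(3) by (auto simp: lin_comb_def)
  then show ?thesis
    using lin_combI[of E "\<lambda>e. a * t e" S] assms(1,2) by (simp add: sum_distrib_left ring_closedD mult.assoc)
qed

lemma lin_comb_0: "ring_closed S \<Longrightarrow> 0 \<in> lin_comb S E"
  using lin_combI[of E "\<lambda>_. 0" S] by (simp add: ring_closedD)

lemma lin_comb_sum:
  "ring_closed S \<Longrightarrow> (\<And>i. i \<in> A \<Longrightarrow> f i \<in> lin_comb S E) \<Longrightarrow> sum f A \<in> lin_comb S E"
  by (induction A rule: infinite_finite_induct) (auto simp: lin_comb_0 lin_comb_add)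

lemma lin_comb_base:
  assumes "ring_closed S" "finite E" "e \<in> E" "a \<in> S"
  shows "a * e \<in> lin_comb S E"
proof -
  have "(\<Sum>e'\<in>E. (if e' = e then a else 0) * e') = a * e"
    using assms(2,3) by (simp add: if_distrib[of "\<lambda>x. x * _"] cong: if_cong)
  then show ?thesis
    using lin_combI[of E "\<lambda>e'. if e' = e then a else 0" S] assms(1,4) by (auto simp: ring_closedD)
qed

text \<open>
  Modulo \<open>P\<close> and after inverting \<open>a\<close>, the \<open>S\<close>-module \<open>X\<close> is generated by \<open>E\<close>.
  With \<open>a = 1\<close> this is finiteness of \<open>X/P\<close> over \<open>S\<close>.
\<close>

definition generates_up_to :: "'a::comm_ring_1 set \<Rightarrow> 'a set \<Rightarrow> 'a set \<Rightarrow> 'a \<Rightarrow> 'a set \<Rightarrow> bool" where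
  "generates_up_to S E P a X \<longleftrightarrow>
     finite E \<and> E \<subseteq> X \<and> (\<forall>f\<in>X. \<exists>N. \<exists>h\<in>lin_comb S E. a ^ N * f - h \<in> P)"

lemma generates_up_to_refl:
  assumes "ring_closed S" "0 \<in> P" "1 \<in> S"
  shows "generates_up_to S {1} P a S"
  unfolding generates_up_to_def
proof (intro conjI ballI)
  fix f assume "f \<in> S"
  then have "f \<in> lin_comb S {1}" using lin_comb_base[OF assms(1), of "{1}" 1 f] by simp
  then show "\<exists>N. \<exists>h\<in>lin_comb S {1}. a ^ N * f - h \<in> P"
    using assms(2) by (intro exI[of _ 0] bexI[of _ f]) auto
qed (use assms in auto)

text \<open>
  Products of generators generate; the factor \<open>a\<^sup>K\<close> clears the denominators of all coefficients at once.
\<close>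

lemma generates_up_to_trans:
  assumes S: "ring_closed S" and T: "S \<subseteq> T" and X: "ring_closed X" "T \<subseteq> X" "X \<subseteq> polys V"
    and P: "pideal V P" and a: "a \<in> S" and b: "b \<in> S"
    and 1: "generates_up_to S E P a T" and 2: "generates_up_to T F P b X"
  shows "generates_up_to S ((\<lambda>(e, f). e * f) ` (E \<times> F)) P (a * b) X"
proof -
  let ?G = "(\<lambda>(e, f). e * f) ` (E \<times> F)"
  have fin: "finite E" "finite F" using 1 2 by (auto simp: generates_up_to_def)
  have EX: "E \<subseteq> X" "F \<subseteq> X" using 1 2 X by (auto simp: generates_up_to_def)
  have aV: "a ^ n \<in> polys V" "b ^ n \<in> polys V" for n using a b T X by blast+
  have "\<exists>N. \<exists>h\<in>lin_comb S ?G. (a * b) ^ N * x - h \<in> P" if x: "x \<in> X" for x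
  proof -
    obtain N h where h: "h \<in> lin_comb T F" and N: "b ^ N * x - h \<in> P"
      using 2 x unfolding generates_up_to_def by blast
    obtain t where t: "\<And>f. f \<in> F \<Longrightarrow> t f \<in> T" "h = (\<Sum>f\<in>F. t f * f)"
      using h by (auto simp: lin_comb_def)
    have "\<forall>f\<in>F. \<exists>M. \<exists>u\<in>lin_comb S E. a ^ M * t f - u \<in> P"
      using 1 t(1) unfolding generates_up_to_def by blast
    then obtain M u where M: "\<And>f. f \<in> F \<Longrightarrow> u f \<in> lin_comb S E"
      "\<And>f. f \<in> F \<Longrightarrow> a ^ M f * t f - u f \<in> P" by metis
    define K where "K = (\<Sum>f\<in>F. M f)"
    have K: "M f \<le> K" if "f \<in> F" for f
      using that fin unfolding K_def by (intro member_le_sum) auto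
    define v where "v f = a ^ (K - M f) * u f" for f
    have v: "v f \<in> lin_comb S E" "a ^ K * t f - v f \<in> P" if "f \<in> F" for f
    proof -
      show "v f \<in> lin_comb S E"
        unfolding v_def using M(1)[OF that] a S by (intro lin_comb_mult ring_closed_power)
      have "a ^ K = a ^ (K - M f) * a ^ M f" using K[OF that] by (simp flip: power_add)
      then have "a ^ K * t f - v f = a ^ (K - M f) * (a ^ M f * t f - u f)"
        by (simp add: v_def algebra_simps)
      then show "a ^ K * t f - v f \<in> P" using pideal_mult[OF P aV(1) M(2)[OF that]] by simp
    qed
    define w where "w = (\<Sum>f\<in>F. v f * f)"
    have "v f * f \<in> lin_comb S ?G" if f: "f \<in> F" for f
    proof -
      obtain c where c: "\<And>e. e \<in> E \<Longrightarrow> c e \<in> S" "v f = (\<Sum>e\<in>E. c e * e)"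
        using v(1)[OF f] by (auto simp: lin_comb_def)
      have "v f * f = (\<Sum>e\<in>E. c e * (e * f))" by (simp add: c(2) sum_distrib_right mult.assoc)
      also have "\<dots> \<in> lin_comb S ?G"
        using c(1) f fin by (intro lin_comb_sum[OF S] lin_comb_base[OF S]) auto
      finally show ?thesis .
    qed
    then have w: "w \<in> lin_comb S ?G" unfolding w_def by (rule lin_comb_sum[OF S])
    have "a ^ K * h - w = (\<Sum>f\<in>F. f * (a ^ K * t f - v f))"
      by (simp add: t(2) w_def sum_distrib_left algebra_simps flip: sum_subtractf)
    also have "\<dots> \<in> P"
      using EX X v(2) by (intro pideal_sum[OF P] pideal_mult[OF P]) auto
    finally have "a ^ K * h - w \<in> P" .
    moreover have "a ^ K * (b ^ N * x - h) \<in> P" using pideal_mult[OF P aV(1) N] .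
    ultimately have "a ^ K * b ^ N * x - w \<in> P"
      using pideal_add[OF P] by (fastforce simp: algebra_simps)
    then have "(a ^ N * b ^ K) * (a ^ K * b ^ N * x - w) \<in> P"
      using aV by (intro pideal_mult[OF P]) auto
    then have "(a * b) ^ (N + K) * x - (a ^ N * b ^ K) * w \<in> P"
      by (simp add: algebra_simps power_add power_mult_distrib)
    moreover have "(a ^ N * b ^ K) * w \<in> lin_comb S ?G"
      using a b S w by (intro lin_comb_mult ring_closedD(4)[OF S] ring_closed_power)
    ultimately show ?thesis by blast
  qed
  moreover have "?G \<subseteq> X" using EX ring_closedD(4)[OF X(1)] by auto
  ultimately show ?thesis using fin unfolding generates_up_to_def by blast
qed

text \<open>Pseudo-division by the relation \<open>F\<close>, of which only the leading coefficient gets inverted.\<close>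

lemma generates_up_to_adjoin:
  assumes S: "ring_closed S" "S \<subseteq> polys V" and x: "x \<in> polys V" and P: "pideal V P"
    and F: "\<And>i. coeff F i \<in> S" "poly F x \<in> P"
  shows "generates_up_to S ((\<lambda>i. x ^ i) ` {..<degree F}) P (lead_coeff F) {poly G x | G. \<forall>i. coeff G i \<in> S}"
proof -
  let ?b = "lead_coeff F" and ?E = "(\<lambda>i. x ^ i) ` {..<degree F}"
  have inP: "\<exists>N. \<exists>h\<in>lin_comb S ?E. ?b ^ N * poly G x - h \<in> P" if "\<And>i. coeff G i \<in> S" for G
    using that
  proof (induction "degree G" arbitrary: G rule: less_induct)
    case less
    consider "G = 0" | "G \<noteq> 0" "degree G < degree F" | "G \<noteq> 0" "degree G \<ge> degree F" by fastforce
    then show ?case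
    proof cases
      case 1
      then show ?thesis using lin_comb_0[OF S(1)] pideal_0[OF P] by (intro exI[of _ 0] bexI[of _ 0]) auto
    next
      case 2
      have "poly G x = (\<Sum>i<degree F. coeff G i * x ^ i)"
        unfolding poly_altdef using 2(2) by (intro sum.mono_neutral_left) (auto intro: coeff_eq_0)
      also have "\<dots> \<in> lin_comb S ?E"
        using less.prems by (intro lin_comb_sum[OF S(1)] lin_comb_base[OF S(1)]) auto
      finally show ?thesis using pideal_0[OF P] by (intro exI[of _ 0] bexI[of _ "poly G x"]) auto
    next
      case 3
      define m where "m = degree G - degree F"
      define c where "c = lead_coeff G"
      define H where "H = smult ?b G - monom c m * F"
      have cS: "c \<in> S" "?b \<in> S" using less.prems F by (auto simp: c_def)
      have coeffs: "coeff H i \<in> S" for i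
        unfolding H_def using less.prems F cS S(1)
        by (auto simp: coeff_monom_mult intro!: ring_closed_diff ring_closedD(4)[OF S(1)] ring_closedD(1)[OF S(1)])
      have eq: "?b * poly G x = poly H x + c * x ^ m * poly F x"
        by (simp add: H_def poly_monom)
      have cx: "c * x ^ m * poly F x \<in> P"
        using cS S(2) x F(2) by (intro pideal_mult[OF P]) auto
      show ?thesis
      proof (cases "H = 0")
        case True
        then show ?thesis using eq cx lin_comb_0[OF S(1)]
          by (intro exI[of _ 1] bexI[of _ 0]) auto
      next
        case False
        have "degree H \<le> degree G"
          unfolding H_def m_def using 3(2)
          by (intro degree_diff_le order.trans[OF degree_smult_le] order.trans[OF degree_mult_le])
             (auto intro: order.trans[OF add_right_mono[OF degree_monom_le]])
        moreover have "coeff H (degree G) = 0"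
          using 3(2) by (simp add: H_def coeff_monom_mult m_def c_def)
        ultimately have "degree H < degree G" using False by (rule degree_less_if_coeff_0)
        then obtain N h where N: "h \<in> lin_comb S ?E" "?b ^ N * poly H x - h \<in> P"
          using less.hyps[of H] coeffs by blast
        have "?b ^ N * (c * x ^ m * poly F x) \<in> P"
          using cS S(2) by (intro pideal_mult[OF P _ cx]) auto
        then have "?b ^ N * poly H x - h + ?b ^ N * (c * x ^ m * poly F x) \<in> P"
          using N(2) by (intro pideal_add[OF P])
        also have "?b ^ N * poly H x - h + ?b ^ N * (c * x ^ m * poly F x) = ?b ^ N * (?b * poly G x) - h"
          unfolding eq by (simp add: algebra_simps)
        finally have "?b ^ Suc N * poly G x - h \<in> P" by (simp add: mult_ac)
        then show ?thesis using N(1) by blast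
      qed
    qed
  qed
  have "x ^ i \<in> {poly G x | G. \<forall>i. coeff G i \<in> S}" for i
    using S(1) by (intro CollectI exI[of _ "monom 1 i"]) (auto simp: poly_monom ring_closedD)
  then show ?thesis using inP unfolding generates_up_to_def by auto
qed

lemma polys_insert_eq:
  assumes "x \<notin> V"
  shows "polys (insert x V) = {poly G (var x) | G. \<forall>i. coeff G i \<in> polys V}"
proof -
  have "insert x V - {x} = V" using assms by auto
  then have "f \<in> polys (insert x V) \<Longrightarrow> \<forall>i. coeff (expansion x f) i \<in> polys V" for f
    using coeff_expansion_in_polys[of f "insert x V" x] by auto
  moreover have "poly G (var x) \<in> polys (insert x V)" if "\<forall>i. coeff G i \<in> polys V" for G
    using that polys_mono[of V "insert x V"] by (intro poly_in_polys) auto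
  ultimately show ?thesis
    by (auto intro!: exI[of _ "expansion x _"])
qed

subsection \<open>Linear dependence modulo a prime\<close>

text \<open>Fraction-free elimination.\<close>

lemma exists_dependence:
  assumes P: "pprime V P" and S: "ring_closed S" "S \<subseteq> polys V"
    and "finite E" "finite I" "card E < card I" "\<And>i e. i \<in> I \<Longrightarrow> e \<in> E \<Longrightarrow> c i e \<in> S"
  shows "\<exists>b. (\<forall>i\<in>I. b i \<in> S) \<and> (\<exists>i\<in>I. b i \<notin> P) \<and> (\<forall>e\<in>E. (\<Sum>i\<in>I. b i * c i e) \<in> P)"
  using assms(4-)
proof (induction E arbitrary: I c rule: finite_induct)
  case empty
  then have "I \<noteq> {}" by auto
  then show ?case using ring_closedD(2)[OF S(1)] pprime_1[OF P] by (intro exI[of _ "\<lambda>_. 1"]) auto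
next
  case (insert e0 E)
  note ideal = pprime_pideal[OF P]
  show ?case
  proof (cases "\<forall>i\<in>I. c i e0 \<in> P")
    case True
    obtain b where b: "\<forall>i\<in>I. b i \<in> S" "\<exists>i\<in>I. b i \<notin> P" "\<forall>e\<in>E. (\<Sum>i\<in>I. b i * c i e) \<in> P"
      using insert.IH[of I c] insert.prems insert.hyps by auto
    have "(\<Sum>i\<in>I. b i * c i e0) \<in> P"
      using True b(1) S(2) by (intro pideal_sum[OF ideal] pideal_mult[OF ideal]) auto
    then show ?thesis using b by auto
  next
    case False
    then obtain i0 where i0: "i0 \<in> I" "c i0 e0 \<notin> P" by blast
    define d where "d i e = c i0 e0 * c i e - c i e0 * c i0 e" for i e
    have d: "d i e \<in> S" if "i \<in> I - {i0}" "e \<in> E" for i e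
      unfolding d_def using that i0 insert.prems(3)
      by (intro ring_closed_diff[OF S(1)] ring_closedD(4)[OF S(1)]) auto
    have "card E < card (I - {i0})" using insert.prems insert.hyps i0 by simp
    then obtain b where b: "\<forall>i\<in>I - {i0}. b i \<in> S" "\<exists>i\<in>I - {i0}. b i \<notin> P"
      "\<And>e. e \<in> E \<Longrightarrow> (\<Sum>i\<in>I - {i0}. b i * d i e) \<in> P"
    proof -
      have "\<exists>b. (\<forall>i\<in>I - {i0}. b i \<in> S) \<and> (\<exists>i\<in>I - {i0}. b i \<notin> P) \<and>
          (\<forall>e\<in>E. (\<Sum>i\<in>I - {i0}. b i * d i e) \<in> P)"
        by (rule insert.IH) (use insert.prems(1) d \<open>card E < card (I - {i0})\<close> in auto)
      then show ?thesis using that by blast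
    qed
    define b' where "b' i = (if i = i0 then - (\<Sum>i\<in>I - {i0}. b i * c i e0) else c i0 e0 * b i)" for i
    have sum: "(\<Sum>i\<in>I. b' i * c i e) = (\<Sum>i\<in>I - {i0}. b i * d i e)" for e
    proof -
      have "(\<Sum>i\<in>I. b' i * c i e) = b' i0 * c i0 e + (\<Sum>i\<in>I - {i0}. b' i * c i e)"
        using insert.prems i0 by (simp add: sum.remove)
      also have "(\<Sum>i\<in>I - {i0}. b' i * c i e) = (\<Sum>i\<in>I - {i0}. c i0 e0 * b i * c i e)"
        by (intro sum.cong) (auto simp: b'_def)
      also have "b' i0 * c i0 e = - (\<Sum>i\<in>I - {i0}. b i * c i e0 * c i0 e)"
        by (simp add: b'_def sum_distrib_right)
      finally show ?thesis by (simp add: d_def algebra_simps sum_subtractf)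
    qed
    have "(\<Sum>i\<in>I. b' i * c i e0) = 0"
      unfolding sum by (simp add: d_def mult.commute)
    then have "\<forall>e\<in>insert e0 E. (\<Sum>i\<in>I. b' i * c i e) \<in> P"
      using b(3) sum pideal_0[OF ideal] by auto
    moreover have "\<forall>i\<in>I. b' i \<in> S"
      using b(1) insert.prems i0 unfolding b'_def
      by (auto intro!: ring_closedD(4,5)[OF S(1)] ring_closed_sum[OF S(1)])
    moreover obtain i where i: "i \<in> I" "i \<noteq> i0" "b i \<notin> P" using b(2) by auto
    have "b' i \<notin> P"
      using i i0 b(1) insert.prems(3)[of i0 e0] S(2) pprime_mult[OF P, of "c i0 e0" "b i"]
      by (auto simp: b'_def)
    ultimately show ?thesis using i(1) by blast
  qed
qed

lemma dependence_of_generated: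
  assumes P: "pprime V P" and S: "ring_closed S" "S \<subseteq> polys V" and a: "a \<in> S" "a \<notin> P"
    and X: "X \<subseteq> polys V" and gen: "generates_up_to S E P a X"
    and g: "\<And>i. i \<le> card E \<Longrightarrow> g i \<in> X"
  shows "\<exists>b. (\<forall>i\<le>card E. b i \<in> S) \<and> (\<exists>i\<le>card E. b i \<notin> P) \<and> (\<Sum>i\<le>card E. b i * g i) \<in> P"
proof -
  note ideal = pprime_pideal[OF P]
  have fin: "finite E" and E: "E \<subseteq> X" using gen by (auto simp: generates_up_to_def)
  have "\<forall>i\<in>{..card E}. \<exists>N. \<exists>h\<in>lin_comb S E. a ^ N * g i - h \<in> P"
    using gen g unfolding generates_up_to_def by auto
  then obtain N h where N: "\<And>i. i \<le> card E \<Longrightarrow> h i \<in> lin_comb S E"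
    "\<And>i. i \<le> card E \<Longrightarrow> a ^ N i * g i - h i \<in> P" by (metis atMost_iff)
  have "\<exists>s. (\<forall>e\<in>E. s e \<in> S) \<and> h i = (\<Sum>e\<in>E. s e * e)" if "i \<le> card E" for i
    using N(1)[OF that] by (auto simp: lin_comb_def)
  then have "\<exists>c. \<forall>i. i \<le> card E \<longrightarrow> (\<forall>e\<in>E. c i e \<in> S) \<and> h i = (\<Sum>e\<in>E. c i e * e)"
    by (intro choice) blast
  then obtain c where c: "\<And>i e. i \<le> card E \<Longrightarrow> e \<in> E \<Longrightarrow> c i e \<in> S"
    "\<And>i. i \<le> card E \<Longrightarrow> h i = (\<Sum>e\<in>E. c i e * e)" by blast
  obtain b where b: "\<forall>i\<in>{..card E}. b i \<in> S" "\<exists>i\<in>{..card E}. b i \<notin> P"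
    "\<And>e. e \<in> E \<Longrightarrow> (\<Sum>i\<le>card E. b i * c i e) \<in> P"
  proof -
    have "\<exists>b. (\<forall>i\<in>{..card E}. b i \<in> S) \<and> (\<exists>i\<in>{..card E}. b i \<notin> P) \<and>
        (\<forall>e\<in>E. (\<Sum>i\<in>{..card E}. b i * c i e) \<in> P)"
      by (rule exists_dependence[OF P S fin]) (use c(1) in auto)
    then show ?thesis using that by blast
  qed
  have "(\<Sum>i\<le>card E. b i * h i) = (\<Sum>i\<le>card E. \<Sum>e\<in>E. b i * c i e * e)"
    by (intro sum.cong) (auto simp: c(2) sum_distrib_left mult.assoc)
  also have "\<dots> = (\<Sum>e\<in>E. e * (\<Sum>i\<le>card E. b i * c i e))"
    by (subst sum.swap) (simp add: sum_distrib_left mult_ac)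
  also have "\<dots> \<in> P"
  proof (rule pideal_sum[OF ideal])
    fix e assume "e \<in> E"
    then show "e * (\<Sum>i\<le>card E. b i * c i e) \<in> P" using b(3) E X by (blast intro: pideal_mult[OF ideal])
  qed
  finally have "(\<Sum>i\<le>card E. b i * h i) \<in> P" .
  moreover have "(\<Sum>i\<le>card E. b i * (a ^ N i * g i - h i)) \<in> P"
    using b(1) N(2) S(2) by (intro pideal_sum[OF ideal] pideal_mult[OF ideal]) auto
  ultimately have "(\<Sum>i\<le>card E. b i * h i) + (\<Sum>i\<le>card E. b i * (a ^ N i * g i - h i)) \<in> P"
    by (rule pideal_add[OF ideal])
  then have "(\<Sum>i\<le>card E. (b i * a ^ N i) * g i) \<in> P"
    by (simp add: algebra_simps flip: sum.distrib)
  moreover have "\<forall>i\<le>card E. b i * a ^ N i \<in> S"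
    using b(1) a(1) by (auto intro!: ring_closedD(4)[OF S(1)] ring_closed_power[OF S(1)])
  moreover obtain i where i: "i \<le> card E" "b i \<notin> P" using b(2) by auto
  have "b i * a ^ N i \<notin> P"
    using i b(1) a S(2) pprime_mult[OF P, of "b i" "a ^ N i"] pprime_power[OF P, of a "N i"] by auto
  ultimately show ?thesis using i(1) by (intro exI[of _ "\<lambda>i. b i * a ^ N i"]) auto
qed

text \<open>
  As \<open>f \<notin> P\<close>, the largest power of \<open>f\<close> common to the terms with \<open>b i \<notin> P\<close> can be cancelled.
\<close>

lemma relation_with_constant_term:
  assumes P: "pprime V P" and f: "f \<in> polys V" "f \<notin> P"
    and b: "\<And>i. i \<le> n \<Longrightarrow> b i \<in> polys V" "\<exists>i\<le>n. b i \<notin> P" "(\<Sum>i\<le>n. b i * f ^ i) \<in> P"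
  shows "\<exists>i\<le>n. \<exists>g\<in>polys V. b i \<notin> P \<and> b i + f * g \<in> P"
proof -
  note ideal = pprime_pideal[OF P]
  define k where "k = (LEAST i. b i \<notin> P)"
  have k: "b k \<notin> P" "k \<le> n" "\<And>i. i < k \<Longrightarrow> b i \<in> P"
  proof -
    obtain i where i: "i \<le> n" "b i \<notin> P" using b(2) by blast
    show "b k \<notin> P" unfolding k_def using i(2) by (rule LeastI)
    show "k \<le> n" unfolding k_def using Least_le[of "\<lambda>i. b i \<notin> P", OF i(2)] i(1) by simp
    show "b i \<in> P" if "i < k" for i using not_less_Least[of i "\<lambda>i. b i \<notin> P"] that unfolding k_def by blast
  qed
  have split: "(\<Sum>i\<le>n. b i * f ^ i) = (\<Sum>i<k. b i * f ^ i) + (\<Sum>i=k..n. b i * f ^ i)"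
    using k(2) by (subst sum.union_disjoint[symmetric]) (auto intro: sum.cong)
  have "(\<Sum>i<k. b i * f ^ i) \<in> P"
    using k(3) f(1) by (intro pideal_sum[OF ideal] pideal_mult2[OF ideal]) auto
  then have "(\<Sum>i=k..n. b i * f ^ i) \<in> P"
    using b(3) split pideal_diff[OF ideal, of "\<Sum>i\<le>n. b i * f ^ i" "\<Sum>i<k. b i * f ^ i"] by simp
  also have "(\<Sum>i=k..n. b i * f ^ i) = f ^ k * (\<Sum>i=k..n. b i * f ^ (i - k))"
    unfolding sum_distrib_left by (intro sum.cong) (auto simp: mult.left_commute simp flip: power_add)
  finally have *: "f ^ k * (\<Sum>i=k..n. b i * f ^ (i - k)) \<in> P" .
  have "(\<Sum>i=k..n. b i * f ^ (i - k)) \<in> P"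
  proof -
    have "f ^ k \<notin> P" using pprime_power[OF P f(1)] f(2) by blast
    moreover have "(\<Sum>i=k..n. b i * f ^ (i - k)) \<in> polys V"
      using b(1) f(1) by (intro polys_sum) auto
    ultimately show ?thesis using pprime_mult[OF P *] f(1) by blast
  qed
  also have "(\<Sum>i=k..n. b i * f ^ (i - k)) = b k + (\<Sum>i=Suc k..n. b i * f ^ (i - k))"
    using k(2) by (simp add: sum.atLeast_Suc_atMost)
  also have "(\<Sum>i=Suc k..n. b i * f ^ (i - k)) = f * (\<Sum>i=Suc k..n. b i * f ^ (i - Suc k))"
    unfolding sum_distrib_left
  proof (intro sum.cong refl)
    fix i assume "i \<in> {Suc k..n}"
    then have "i - k = Suc (i - Suc k)" by auto
    then show "b i * f ^ (i - k) = f * (b i * f ^ (i - Suc k))" by (simp add: mult.left_commute)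
  qed
  finally have "b k + f * (\<Sum>i=Suc k..n. b i * f ^ (i - Suc k)) \<in> P" .
  moreover have "(\<Sum>i=Suc k..n. b i * f ^ (i - Suc k)) \<in> polys V"
    using b(1) f(1) by (intro polys_sum) auto
  ultimately show ?thesis using k by blast
qed

text \<open>
  The determinant trick: \<open>s\<close> acts on the module generated by \<open>E\<close> as \<open>f\<close> times a matrix over \<open>S\<close>, so the
  determinant of the difference kills \<open>E\<close>, and modulo \<open>f\<close> it is a power of \<open>s\<close>. Eliminating one generator after
  the other takes the place of the determinant.
\<close>

lemma nakayama_trick:
  assumes S: "ring_closed S" "S \<subseteq> polys V" and f: "f \<in> S" and P: "pideal V P"
    and "finite E" "E \<subseteq> polys V" "s \<in> S" "\<And>e. e \<in> E \<Longrightarrow> \<exists>h\<in>lin_comb S E. s * e - f * h \<in> P"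
  shows "\<exists>K. \<exists>c\<in>S. \<forall>e\<in>E. (s ^ K + f * c) * e \<in> P"
  using assms(5-)
proof (induction E arbitrary: s rule: finite_induct)
  case empty
  show ?case using ring_closedD(1)[OF S(1)] by (intro exI[of _ 0] bexI[of _ 0]) auto
next
  case (insert e0 E)
  note SV = subsetD[OF S(2)]
  have pow: "\<exists>c\<in>S. (s - f * B) ^ n = s ^ n + f * c" if "B \<in> S" for B n
  proof (induction n)
    case 0
    show ?case using ring_closedD(1)[OF S(1)] by (intro bexI[of _ 0]) auto
  next
    case (Suc n)
    then obtain c where c: "c \<in> S" "(s - f * B) ^ n = s ^ n + f * c" by blast
    have "(s - f * B) ^ Suc n = s ^ Suc n + f * (s * c - B * s ^ n - f * B * c)"
      unfolding power_Suc c(2) by (simp add: algebra_simps)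
    moreover have "s * c - B * s ^ n - f * B * c \<in> S"
      using c(1) that f insert.prems(2) S(1)
      by (intro ring_closed_diff ring_closedD(4)[OF S(1)] ring_closed_power)
    ultimately show ?case by blast
  qed
  have "\<exists>B. (\<forall>e'\<in>insert e0 E. B e' \<in> S) \<and> s * e - f * (\<Sum>e'\<in>insert e0 E. B e' * e') \<in> P"
    if "e \<in> insert e0 E" for e
    using insert.prems(3)[OF that] unfolding lin_comb_def by blast
  then have "\<exists>B. \<forall>e. e \<in> insert e0 E \<longrightarrow> (\<forall>e'\<in>insert e0 E. B e e' \<in> S) \<and>
      s * e - f * (\<Sum>e'\<in>insert e0 E. B e e' * e') \<in> P"
    by (intro choice) blast
  then obtain B where B: "\<And>e e'. e \<in> insert e0 E \<Longrightarrow> e' \<in> insert e0 E \<Longrightarrow> B e e' \<in> S"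
    "\<And>e. e \<in> insert e0 E \<Longrightarrow> s * e - f * (\<Sum>e'\<in>insert e0 E. B e e' * e') \<in> P" by fast
  define d where "d = s - f * B e0 e0"
  have dS: "d \<in> S" unfolding d_def using insert.prems(2) f B(1) S(1)
    by (intro ring_closed_diff ring_closedD(4)[OF S(1)]) auto
  define r where "r e = (\<Sum>e'\<in>E. B e e' * e')" for e
  have r: "r e \<in> lin_comb S E" if "e \<in> insert e0 E" for e
    unfolding r_def using that B(1) by (intro lin_combI) auto
  have e0: "d * e0 - f * r e0 \<in> P"
    using B(2)[of e0] insert.hyps by (simp add: d_def r_def algebra_simps)
  have e: "s * e - f * B e e0 * e0 - f * r e \<in> P" if "e \<in> E" for e
    using B(2)[of e] insert.hyps that by (simp add: r_def algebra_simps)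
  have *: "\<exists>h\<in>lin_comb S E. (d * s) * e - f * h \<in> P" if that: "e \<in> E" for e
  proof
    show "d * r e + f * B e e0 * r e0 \<in> lin_comb S E"
      using that dS f B(1) r by (intro lin_comb_add[OF S(1)] lin_comb_mult[OF S(1)] ring_closedD(4)[OF S(1)]) auto
    have "d * (s * e - f * B e e0 * e0 - f * r e) + f * B e e0 * (d * e0 - f * r e0) \<in> P"
      using dS f B(1)[of e e0] that SV e e0
      by (intro pideal_add[OF P] pideal_mult[OF P] polys_mult) auto
    then show "(d * s) * e - f * (d * r e + f * B e e0 * r e0) \<in> P"
      by (simp add: algebra_simps)
  qed
  obtain K c where c: "c \<in> S" "\<And>e. e \<in> E \<Longrightarrow> ((d * s) ^ K + f * c) * e \<in> P"
  proof -
    have "\<exists>K. \<exists>c\<in>S. \<forall>e\<in>E. ((d * s) ^ K + f * c) * e \<in> P"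
      by (rule insert.IH) (use * insert.prems(1,2) dS ring_closedD(4)[OF S(1)] in auto)
    then show ?thesis using that by blast
  qed
  let ?u = "(d * s) ^ K + f * c"
  have uV: "?u \<in> polys V"
    using dS f c(1) insert.prems(2) SV by (intro polys_add polys_power polys_mult) auto
  have kill: "(d * ?u) * e \<in> P" if "e \<in> insert e0 E" for e
  proof (cases "e = e0")
    case True
    have "?u * r e0 = (\<Sum>e\<in>E. B e0 e * (?u * e))"
      unfolding r_def sum_distrib_left by (intro sum.cong) (auto simp: mult_ac)
    also have "\<dots> \<in> P"
    proof (rule pideal_sum[OF P])
      fix e assume "e \<in> E"
      then show "B e0 e * (?u * e) \<in> P" using B(1) SV c(2) by (blast intro: pideal_mult[OF P])
    qed
    finally have "f * (?u * r e0) \<in> P" using f SV by (blast intro: pideal_mult[OF P])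
    moreover have "?u * (d * e0 - f * r e0) \<in> P" using uV e0 by (intro pideal_mult[OF P])
    ultimately have "f * (?u * r e0) + ?u * (d * e0 - f * r e0) \<in> P" by (rule pideal_add[OF P])
    then show ?thesis using True by (simp add: algebra_simps)
  next
    case False
    then have "d * (?u * e) \<in> P" using that c(2) dS SV by (blast intro: pideal_mult[OF P])
    then show ?thesis by (simp add: mult.assoc)
  qed
  obtain c1 where c1: "c1 \<in> S" "d ^ Suc K = s ^ Suc K + f * c1"
    using pow[of "B e0 e0" "Suc K"] B(1) unfolding d_def by blast
  have "d * ?u = d ^ Suc K * s ^ K + f * (d * c)"
    by (simp add: power_mult_distrib algebra_simps)
  also have "\<dots> = s ^ (Suc K + K) + f * (s ^ K * c1 + d * c)"
    unfolding c1(2) by (simp add: algebra_simps power_add)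
  finally have "d * ?u = s ^ (Suc K + K) + f * (s ^ K * c1 + d * c)" .
  moreover have "s ^ K * c1 + d * c \<in> S"
    using c(1) c1(1) dS insert.prems(2) S(1) by (intro ring_closedD(3,4)[OF S(1)] ring_closed_power)
  ultimately show ?case using kill by metis
qed



section \<open>Krull dimension and independent sets of variables\<close>

abbreviation indep_mod :: "'k::field mpoly set \<Rightarrow> nat set \<Rightarrow> bool" where
  "indep_mod J W \<equiv> J \<inter> polys W \<subseteq> {0}"

text \<open>The unit ideal gets dimension \<open>0\<close>, in accordance with the convention for \<open>krull_dim\<close>.\<close>

definition idim :: "nat set \<Rightarrow> 'k::field mpoly set \<Rightarrow> nat" where
  "idim V J = Max (insert 0 {card W | W. W \<subseteq> V \<and> indep_mod J W})"

lemma finite_indep_cards: "finite V \<Longrightarrow> finite {card W | W. W \<subseteq> V \<and> indep_mod J W}"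
  by (rule finite_subset[of _ "card ` Pow V"]) auto

lemma card_le_idim:
  assumes "finite V" "W \<subseteq> V" "indep_mod J W"
  shows "card W \<le> idim V J"
  unfolding idim_def using finite_indep_cards[OF assms(1), of J] assms by (intro Max_ge) auto

lemma idim_le:
  assumes "finite V" "\<And>W. W \<subseteq> V \<Longrightarrow> indep_mod J W \<Longrightarrow> card W \<le> n"
  shows "idim V J \<le> n"
  unfolding idim_def using finite_indep_cards[OF assms(1), of J] assms(2) by (subst Max_le_iff) auto

lemma indep_mod_empty:
  assumes "pideal V J" "1 \<notin> J"
  shows "indep_mod J {}"
proof
  fix f assume f: "f \<in> J \<inter> polys {}"
  then obtain c where c: "f = const c" using polys_emptyE by blast
  have "c = 0"
  proof (rule ccontr)
    assume "c \<noteq> 0"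
    then have "const (inverse c) * f = 1" using const_inverse[of c] c by (simp add: mult.commute)
    then show False using pideal_mult[OF assms(1), of "const (inverse c)" f] f assms(2) by auto
  qed
  then show "f \<in> {0}" using c by simp
qed

lemma idim_attained:
  assumes "finite V" "pideal V J" "1 \<notin> J"
  obtains W where "W \<subseteq> V" "indep_mod J W" "card W = idim V J"
proof -
  let ?A = "{card W | W. W \<subseteq> V \<and> indep_mod J W}"
  have fin: "finite ?A" by (rule finite_indep_cards[OF assms(1)])
  have "0 \<in> ?A" using indep_mod_empty[OF assms(2,3)] by (auto intro!: exI[of _ "{}"])
  then have "idim V J = Max ?A" unfolding idim_def by (simp add: insert_absorb)
  also have "\<dots> \<in> ?A" using fin \<open>0 \<in> ?A\<close> by (intro Max_in) auto
  finally show ?thesis using that by auto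
qed

lemma idim_antimono:
  assumes "finite V" "I \<subseteq> J"
  shows "idim V J \<le> idim V I"
  using assms by (intro idim_le) (auto intro!: card_le_idim)

text \<open>
  By maximality, each further variable satisfies a nontrivial relation over \<open>polys W\<close>; the product of the leading
  coefficients of these relations serves as \<open>a\<close>.
\<close>

lemma maximal_indep_generates:
  assumes fin: "finite V" and P: "pprime V P" and W: "W \<subseteq> V" "indep_mod P W"
    and max: "\<forall>x\<in>V - W. \<not> indep_mod P (insert x W)"
  obtains E a where "a \<in> polys W" "a \<noteq> 0" "generates_up_to (polys W) E P a (polys V)"
proof -
  note ideal = pprime_pideal[OF P]
  have "\<exists>E a. a \<in> polys W \<and> a \<noteq> 0 \<and> generates_up_to (polys W) E P a (polys (W \<union> U))"
    if "U \<subseteq> V - W" for U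
  proof -
    have "finite U" using that fin by (meson finite_Diff finite_subset)
    then show ?thesis using that
    proof (induction U)
      case empty
      have "generates_up_to (polys W) {1} P 1 (polys W)"
        by (rule generates_up_to_refl) (auto simp: ring_closed_polys pideal_0[OF ideal])
      then show ?case by (metis sup_bot_right polys_1 one_neq_zero)
    next
      case (insert x U)
      then obtain E a where Ea: "a \<in> polys W" "a \<noteq> 0" "generates_up_to (polys W) E P a (polys (W \<union> U))"
        by auto
      obtain f where f: "f \<in> P" "f \<in> polys (insert x W)" "f \<noteq> 0"
        using max insert.prems by auto
      let ?F = "expansion x f"
      have co: "coeff ?F i \<in> polys W" for i
        using coeff_expansion_in_polys[OF f(2), of x i] insert.prems by simp
      have WU: "polys W \<subseteq> polys (W \<union> U)" "polys (W \<union> U) \<subseteq> polys (insert x (W \<union> U))" 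
        "polys (W \<union> U) \<subseteq> polys V" "polys (insert x (W \<union> U)) \<subseteq> polys V"
        using W(1) insert.prems by (auto intro!: polys_mono)
      have "generates_up_to (polys (W \<union> U)) ((\<lambda>i. var x ^ i) ` {..<degree ?F}) P (lead_coeff ?F)
          {poly G (var x) | G. \<forall>i. coeff G i \<in> polys (W \<union> U)}"
        using insert.prems W(1) co WU f(1)
        by (intro generates_up_to_adjoin[where V = V] ring_closed_polys ideal) auto
      then have "generates_up_to (polys (W \<union> U)) ((\<lambda>i. var x ^ i) ` {..<degree ?F}) P (lead_coeff ?F)
          (polys (insert x (W \<union> U)))"
        using insert.hyps insert.prems by (subst polys_insert_eq) auto
      then have "generates_up_to (polys W) ((\<lambda>(e, f). e * f) ` (E \<times> (\<lambda>i. var x ^ i) ` {..<degree ?F}))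
          P (a * lead_coeff ?F) (polys (insert x (W \<union> U)))"
        using Ea co WU by (intro generates_up_to_trans[where V = V] ring_closed_polys ideal) auto
      moreover have "a * lead_coeff ?F \<in> polys W" "a * lead_coeff ?F \<noteq> 0"
        using Ea co f(3) by auto
      ultimately show ?case by (metis Un_insert_right)
    qed
  qed
  from this[of "V - W"] show ?thesis using that W(1) by (auto simp: Un_absorb1)
qed

lemma extend_to_maximal_indep:
  assumes "finite V" "W \<subseteq> V" "indep_mod P W"
  obtains T where "W \<subseteq> T" "T \<subseteq> V" "indep_mod P T" "\<forall>x\<in>V - T. \<not> indep_mod P (insert x T)"
proof -
  let ?A = "{T. W \<subseteq> T \<and> T \<subseteq> V \<and> indep_mod P T}"
  have "finite ?A" using assms(1) by (intro finite_subset[of ?A "Pow V"]) auto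
  moreover have "W \<in> ?A" using assms by auto
  ultimately obtain T where T: "T \<in> ?A" "\<And>U. U \<in> ?A \<Longrightarrow> T \<subseteq> U \<Longrightarrow> T = U"
    using finite_has_maximal[of ?A] by (metis (no_types, lifting) empty_iff)
  have "\<not> indep_mod P (insert x T)" if x: "x \<in> V - T" for x
  proof
    assume "indep_mod P (insert x T)"
    then have "insert x T \<in> ?A" using T(1) x by blast
    then have "T = insert x T" using T(2) by blast
    then show False using x by blast
  qed
  then show ?thesis using that T(1) by blast
qed

subsection \<open>Chains of primes are bounded\<close>

text \<open>
  If \<open>S\<close>-coefficients suffice to express everything algebraically modulo \<open>P\<close>, then a bigger
  prime \<open>Q\<close> contains more of \<open>S\<close>: the constant term of a relation for an element of \<open>Q - P\<close>.
\<close>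

lemma prime_increase_detected:
  assumes P: "pprime V P" and Q: "pprime V Q" "P \<subset> Q" and S: "ring_closed S" "S \<subseteq> polys V"
    and a: "a \<in> S" "a \<notin> P" and gen: "generates_up_to S E P a (polys V)"
  shows "\<exists>b\<in>S. b \<in> Q \<and> b \<notin> P"
proof -
  obtain f where f: "f \<in> Q" "f \<notin> P" using Q(2) by blast
  have fV: "f \<in> polys V" using f pideal_subset[OF pprime_pideal[OF Q(1)]] by blast
  obtain b where b: "\<forall>i\<le>card E. b i \<in> S" "\<exists>i\<le>card E. b i \<notin> P" "(\<Sum>i\<le>card E. b i * f ^ i) \<in> P"
    using dependence_of_generated[OF P S a order.refl gen, of "\<lambda>i. f ^ i"] fV by blast
  obtain i g where i: "i \<le> card E" "g \<in> polys V" "b i \<notin> P" "b i + f * g \<in> P"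
  proof -
    have "\<exists>i\<le>card E. \<exists>g\<in>polys V. b i \<notin> P \<and> b i + f * g \<in> P"
      by (rule relation_with_constant_term[OF P fV f(2)]) (use b S(2) in auto)
    then show ?thesis using that by blast
  qed
  have "f * g \<in> Q" using pideal_mult2[OF pprime_pideal[OF Q(1)] i(2) f(1)] .
  then have "b i \<in> Q"
    using pideal_diff[OF pprime_pideal[OF Q(1)], of "b i + f * g" "f * g"] i(4) Q(2) by auto
  then show ?thesis using i b(1) by blast
qed

text \<open>
  A set \<open>W\<close> independent modulo \<open>Q\<close> is not maximal modulo \<open>P\<close>: otherwise an element of \<open>Q - P\<close> would be
  algebraic over \<open>polys W\<close> and yield a nonzero element of \<open>Q\<close> in \<open>polys W\<close>.
\<close>

lemma idim_strict_antimono: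
  assumes fin: "finite V" and P: "pprime V P" and Q: "pprime V Q" and PQ: "P \<subset> Q"
  shows "idim V Q < idim V P"
proof -
  obtain W where W: "W \<subseteq> V" "indep_mod Q W" "card W = idim V Q"
    using idim_attained[OF fin pprime_pideal[OF Q] pprime_1[OF Q]] by blast
  have indP: "indep_mod P W" using W(2) PQ by blast
  show ?thesis
  proof (cases "\<exists>x\<in>V - W. indep_mod P (insert x W)")
    case True
    then obtain x where "x \<in> V - W" "indep_mod P (insert x W)" by blast
    then show ?thesis
      using card_le_idim[OF fin, of "insert x W" P] W finite_subset[OF W(1) fin] by auto
  next
    case False
    obtain E a where E: "a \<in> polys W" "a \<noteq> 0" "generates_up_to (polys W) E P a (polys V)"
      by (rule maximal_indep_generates[OF fin P W(1) indP]) (use False in auto)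
    have "a \<notin> P" using indP E(1,2) by blast
    then have "\<exists>b\<in>polys W. b \<in> Q \<and> b \<notin> P"
      by (rule prime_increase_detected[OF P Q PQ ring_closed_polys polys_mono[OF W(1)] E(1) _ E(3)])
    then show ?thesis using W(2) pideal_0[OF pprime_pideal[OF P]] by auto
  qed
qed

subsection \<open>Long chains of primes exist\<close>

lemma exists_nonroot:
  fixes F :: "'k::field_char_0 mpoly poly"
  assumes "F \<noteq> 0"
  shows "\<exists>c. poly F (const c) \<noteq> 0"
proof (rule ccontr)
  assume "\<not> ?thesis"
  then have "range const \<subseteq> {x. poly F x = 0}" by auto
  then have "finite (range (const :: 'k \<Rightarrow> 'k mpoly))"
    using poly_roots_finite[OF assms] by (rule finite_subset)
  moreover have "inj (const :: 'k \<Rightarrow> 'k mpoly)"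
    by (rule injI) (metis lookup_single_eq)
  ultimately have "finite (UNIV :: 'k set)" by (rule finite_imageD)
  then show False using infinite_UNIV_char_0 by blast
qed

text \<open>
  The next prime is found above \<open>P + \<langle>f\<rangle>\<close> with \<open>f = x\<^sub>w - c\<close>, where \<open>c\<close> is no root of the denominator \<open>a\<close>
  over which everything is finite over \<open>polys T\<close>. A polynomial \<open>s\<close> without \<open>x\<^sub>w\<close> in this ideal would multiply
  the module into \<open>f\<close> times itself; then \<open>f\<close> divides a power of \<open>a\<^sup>K s\<close>, which does not vanish at \<open>x\<^sub>w = c\<close>.
\<close>

lemma next_prime:
  fixes P :: "'k::field_char_0 mpoly set"
  assumes fin: "finite V" and P: "pprime V P" and W: "W \<subseteq> V" "indep_mod P W" and w: "w \<in> W"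
  obtains Q where "pprime V Q" "P \<subset> Q" "indep_mod Q (W - {w})"
proof -
  note ideal = pprime_pideal[OF P]
  obtain T where T: "W \<subseteq> T" "T \<subseteq> V" "indep_mod P T" "\<forall>x\<in>V - T. \<not> indep_mod P (insert x T)"
    by (rule extend_to_maximal_indep[OF fin W])
  obtain E a where E: "a \<in> polys T" "a \<noteq> 0" "generates_up_to (polys T) E P a (polys V)"
    by (rule maximal_indep_generates[OF fin P T(2,3) T(4)])
  have finE: "finite E" "E \<subseteq> polys V" using E(3) by (auto simp: generates_up_to_def)
  obtain c where c: "poly (expansion w a) (const c) \<noteq> 0"
    using exists_nonroot[of "expansion w a"] E(2) by auto
  define f where "f = var w - const c"
  define ev where "ev g = poly (expansion w g) (const c)" for g
  have ev_simps: "ev (g + h) = ev g + ev h" "ev (g * h) = ev g * ev h" "ev (g ^ n) = ev g ^ n" for g h n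
    by (simp_all add: ev_def poly_power)
  have evf: "ev f = 0" by (simp add: ev_def f_def)
  have fT: "f \<in> polys T" using w T(1) by (auto simp: f_def)
  have TV: "polys T \<subseteq> polys V" using T(2) by (rule polys_mono)
  have f0: "f \<noteq> 0"
  proof
    assume "f = 0"
    then have "expansion w f = 0" by simp
    then show False by (simp add: f_def)
  qed
  define J where "J = {p + f * g | p g. p \<in> P \<and> g \<in> polys V}"
  define M where "M = polys (W - {w}) - {0 :: 'k mpoly}"
  have J: "pideal V J"
  proof (rule pidealI)
    show "J \<subseteq> polys V" unfolding J_def using pideal_subset[OF ideal] fT TV by auto
    show "0 \<in> J" unfolding J_def using pideal_0[OF ideal] by (force intro!: exI[of _ 0])
  next
    fix g h assume "g \<in> J" "h \<in> J"
    then obtain p q g' h' where *: "g = p + f * g'" "h = q + f * h'" "p \<in> P" "q \<in> P" "g' \<in> polys V" "h' \<in> polys V"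
      unfolding J_def by blast
    then have "g + h = (p + q) + f * (g' + h')" by (simp add: algebra_simps)
    then show "g + h \<in> J" unfolding J_def using * pideal_add[OF ideal] by blast
  next
    fix g h :: "'k mpoly" assume g: "g \<in> polys V" and "h \<in> J"
    then obtain q h' where *: "h = q + f * h'" "q \<in> P" "h' \<in> polys V"
      unfolding J_def by blast
    then have "g * h = g * q + f * (g * h')" by (simp add: algebra_simps)
    then show "g * h \<in> J" unfolding J_def using * g pideal_mult[OF ideal g *(2)] by blast
  qed
  have disj: "M \<inter> J = {}"
  proof (rule ccontr)
    assume "M \<inter> J \<noteq> {}"
    then obtain s p g where s: "s \<in> polys (W - {w})" "s \<noteq> 0" "s = p + f * g" "p \<in> P" "g \<in> polys V"
      unfolding M_def J_def by blast
    have sT: "s \<in> polys T" using s(1) polys_mono[of "W - {w}" T] T(1) by blast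
    have "\<forall>e\<in>E. \<exists>N. \<exists>h\<in>lin_comb (polys T) E. a ^ N * (g * e) - h \<in> P"
      using E(3) finE(2) s(5) unfolding generates_up_to_def by blast
    then obtain N h where N: "\<And>e. e \<in> E \<Longrightarrow> h e \<in> lin_comb (polys T) E"
      "\<And>e. e \<in> E \<Longrightarrow> a ^ N e * (g * e) - h e \<in> P" by metis
    define K where "K = (\<Sum>e\<in>E. N e)"
    have "\<exists>h\<in>lin_comb (polys T) E. (a ^ K * s) * e - f * h \<in> P" if e: "e \<in> E" for e
    proof
      have "N e \<le> K" using e finE unfolding K_def by (intro member_le_sum) auto
      then have aK: "a ^ K = a ^ (K - N e) * a ^ N e" by (simp flip: power_add)
      show "a ^ (K - N e) * h e \<in> lin_comb (polys T) E"
        using N(1)[OF e] E(1) by (intro lin_comb_mult ring_closed_polys) auto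
      have eV: "e \<in> polys V" using e finE by blast
      have aV: "a ^ n \<in> polys V" for n using E(1) TV by blast
      have "(a ^ K * e) * p + (f * a ^ (K - N e)) * (a ^ N e * (g * e) - h e) \<in> P"
        using eV aV fT TV N(2)[OF e] s(4)
        by (intro pideal_add[OF ideal] pideal_mult[OF ideal] polys_mult) auto
      then show "(a ^ K * s) * e - f * (a ^ (K - N e) * h e) \<in> P"
        by (simp add: s(3) aK algebra_simps)
    qed
    then obtain L d where d: "d \<in> polys T" "\<And>e. e \<in> E \<Longrightarrow> ((a ^ K * s) ^ L + f * d) * e \<in> P"
      using nakayama_trick[OF ring_closed_polys TV fT ideal finE, of "a ^ K * s"] E(1) sT by blast
    let ?u = "(a ^ K * s) ^ L + f * d"
    obtain N1 h1 where h1: "h1 \<in> lin_comb (polys T) E" "a ^ N1 * 1 - h1 \<in> P"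
      using E(3) unfolding generates_up_to_def by (meson polys_1)
    obtain t where t: "\<And>e. e \<in> E \<Longrightarrow> t e \<in> polys T" "h1 = (\<Sum>e\<in>E. t e * e)"
      using h1(1) by (auto simp: lin_comb_def)
    have "?u * h1 = (\<Sum>e\<in>E. t e * (?u * e))"
      unfolding t(2) sum_distrib_left by (intro sum.cong) (auto simp: mult_ac)
    also have "\<dots> \<in> P"
    proof (rule pideal_sum[OF ideal])
      fix e assume "e \<in> E"
      then show "t e * (?u * e) \<in> P" using t(1) TV d(2) by (blast intro: pideal_mult[OF ideal])
    qed
    finally have "?u * h1 \<in> P" .
    moreover have uT: "?u \<in> polys T" using E(1) sT fT d(1) by blast
    then have "?u * (a ^ N1 * 1 - h1) \<in> P" using h1(2) TV by (blast intro: pideal_mult[OF ideal])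
    ultimately have "?u * h1 + ?u * (a ^ N1 * 1 - h1) \<in> P" by (rule pideal_add[OF ideal])
    then have "?u * a ^ N1 \<in> P" by (simp add: algebra_simps)
    moreover have "?u * a ^ N1 \<in> polys T" using uT E(1) by blast
    ultimately have "?u * a ^ N1 = 0" using T(3) by blast
    then have "?u = 0" using E(2) by simp
    then have "ev ?u = 0" by (simp add: ev_def)
    then have "(ev a ^ K * ev s) ^ L = 0" by (simp add: ev_simps evf)
    moreover have "ev s = s" unfolding ev_def using s(1) by (subst expansion_free[of s "W - {w}"]) auto
    ultimately show False using c s(2) by (simp add: ev_def)
  qed
  obtain Q where Q: "pprime V Q" "J \<subseteq> Q" "Q \<inter> M = {}"
  proof (rule prime_avoiding[OF fin J _ _ _ disj])
    show "M \<subseteq> polys V" unfolding M_def using W(1) polys_mono[of "W - {w}" V] by blast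
    show "1 \<in> M" unfolding M_def by auto
    show "s * t \<in> M" if "s \<in> M" "t \<in> M" for s t using that unfolding M_def by auto
  qed blast
  have "P \<subseteq> J" unfolding J_def by (force intro: exI[of _ 0])
  moreover have "f \<in> J" unfolding J_def using pideal_0[OF ideal] by (force intro: exI[of _ 1])
  moreover have "f \<notin> P" using T(3) fT f0 by blast
  ultimately have "P \<subset> Q" using Q(2) by blast
  moreover have "indep_mod Q (W - {w})" using Q(3) unfolding M_def by blast
  ultimately show ?thesis using that Q(1) by blast
qed

lemma prime_containing_indep:
  assumes fin: "finite V" and J: "pideal V J" and W: "W \<subseteq> V" "indep_mod J W"
  obtains P where "pprime V P" "J \<subseteq> P" "indep_mod P W"
proof -
  obtain P where "pprime V P" "J \<subseteq> P" "P \<inter> (polys W - {0}) = {}"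
    by (rule prime_avoiding[OF fin J, of "polys W - {0}"])
       (use W polys_mono[OF W(1)] in auto)
  then show ?thesis using that by blast
qed

lemma long_chain_above:
  fixes P :: "'k::field_char_0 mpoly set"
  assumes fin: "finite V" and P: "pprime V P" and W: "W \<subseteq> V" "indep_mod P W"
  shows "\<exists>C. C 0 = P \<and> (\<forall>i\<le>card W. pprime V (C i)) \<and> (\<forall>i<card W. C i \<subset> C (Suc i))"
  using P W
proof (induction "card W" arbitrary: W P)
  case 0
  then show ?case by (intro exI[of _ "\<lambda>_. P"]) auto
next
  case (Suc n)
  then obtain w where w: "w \<in> W" by (metis card.empty equals0I nat.simps(3))
  obtain Q where Q: "pprime V Q" "P \<subset> Q" "indep_mod Q (W - {w})"
    using next_prime[OF fin Suc.prems w] by blast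
  have card: "n = card (W - {w})" using Suc.hyps(2) w by simp
  then obtain C where C: "C 0 = Q" "\<And>i. i \<le> n \<Longrightarrow> pprime V (C i)" "\<And>i. i < n \<Longrightarrow> C i \<subset> C (Suc i)"
    using Suc.hyps(1)[OF card Q(1) _ Q(3)] Suc.prems(2) by auto
  define D where "D i = (case i of 0 \<Rightarrow> P | Suc k \<Rightarrow> C k)" for i
  have "pprime V (D i)" if "i \<le> Suc n" for i
    using that Suc.prems C by (cases i) (auto simp: D_def)
  moreover have "D i \<subset> D (Suc i)" if "i < Suc n" for i
    using that Q C by (cases i) (auto simp: D_def)
  ultimately show ?case unfolding Suc.hyps(2)[symmetric] by (intro exI[of _ D]) (auto simp: D_def)
qed

lemma chain_length_le_idim:
  assumes fin: "finite V" and prime: "\<And>i. i \<le> l \<Longrightarrow> pprime V (C i)" "J \<subseteq> C 0"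
    and strict: "\<And>i. i < l \<Longrightarrow> C i \<subset> C (Suc i)"
  shows "l \<le> idim V J"
proof -
  have "idim V (C i) + i \<le> idim V (C 0)" if "i \<le> l" for i
    using that
  proof (induction i)
    case (Suc i)
    then show ?case
      using idim_strict_antimono[OF fin prime(1) prime(1) strict, of i] by simp
  qed simp
  from this[of l] show ?thesis
    using idim_antimono[OF fin prime(2)] by simp
qed

lemma chain_of_length_idim:
  fixes J :: "'k::field_char_0 mpoly set"
  assumes fin: "finite V" and J: "pideal V J" "1 \<notin> J"
  obtains C where "\<forall>i\<le>idim V J. pprime V (C i) \<and> J \<subseteq> C i" "\<forall>i<idim V J. C i \<subset> C (Suc i)"
proof -
  obtain W where W: "W \<subseteq> V" "indep_mod J W" "card W = idim V J"
    using idim_attained[OF fin J] by blast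
  obtain P where P: "pprime V P" "J \<subseteq> P" "indep_mod P W"
    using prime_containing_indep[OF fin J(1) W(1,2)] by blast
  obtain C where C: "C 0 = P" "\<And>i. i \<le> card W \<Longrightarrow> pprime V (C i)" "\<And>i. i < card W \<Longrightarrow> C i \<subset> C (Suc i)"
    using long_chain_above[OF fin P(1) W(1) P(3)] by blast
  have "J \<subseteq> C i" if "i \<le> card W" for i
    using that
  proof (induction i)
    case (Suc i)
    then show ?case using C(3)[of i] by auto
  qed (use P C in auto)
  then show ?thesis using that[of C] C W(3) by simp
qed

subsection \<open>Comparison with the Krull dimension of the quotient\<close>

lemma coset_eq: "a_r_coset (mpoly_ring V) J r = (\<lambda>h. h + r) ` J"
  by (auto simp: a_r_coset_def r_coset_def)

lemma coset_eq_iff: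
  assumes J: "pideal V J" and "r \<in> polys V" "s \<in> polys V"
  shows "a_r_coset (mpoly_ring V) J r = a_r_coset (mpoly_ring V) J s \<longleftrightarrow> r - s \<in> J"
proof
  assume "a_r_coset (mpoly_ring V) J r = a_r_coset (mpoly_ring V) J s"
  then have "r \<in> (\<lambda>h. h + s) ` J" using pideal_0[OF J] unfolding coset_eq by force
  then show "r - s \<in> J" by auto
next
  assume rs: "r - s \<in> J"
  have "h + r \<in> (\<lambda>h. h + s) ` J" if "h \<in> J" for h
    using pideal_add[OF J that rs] by (intro image_eqI[of _ _ "h + (r - s)"]) auto
  moreover have "h + s \<in> (\<lambda>h. h + r) ` J" if "h \<in> J" for h
    using pideal_diff[OF J that rs] by (intro image_eqI[of _ _ "h - (r - s)"]) auto
  ultimately show "a_r_coset (mpoly_ring V) J r = a_r_coset (mpoly_ring V) J s"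
    unfolding coset_eq by blast
qed

lemma coset_eq_ideal:
  assumes "pideal V J" "r \<in> J"
  shows "a_r_coset (mpoly_ring V) J r = J"
  using coset_eq_iff[OF assms(1), of r 0] assms pideal_subset[OF assms(1)] by (auto simp: coset_eq)

lemma pprime_quotient_vimage:
  assumes J: "pideal V J" and X: "primeideal X (mpoly_ring V Quot J)"
  shows "pprime V {r \<in> polys V. a_r_coset (mpoly_ring V) J r \<in> X}"
    "J \<subseteq> {r \<in> polys V. a_r_coset (mpoly_ring V) J r \<in> X}"
proof -
  interpret ring_hom_ring "mpoly_ring V" "mpoly_ring V Quot J" "a_r_coset (mpoly_ring V) J"
    by (rule ideal.rcos_ring_hom_ring[OF J])
  show "pprime V {r \<in> polys V. a_r_coset (mpoly_ring V) J r \<in> X}"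
    by (rule primeideal_vimage[OF cring_mpoly_ring X])
  have X': "ideal X (mpoly_ring V Quot J)" using X by (rule primeideal.axioms)
  have "\<zero>\<^bsub>mpoly_ring V Quot J\<^esub> \<in> X"
    by (rule additive_subgroup.zero_closed[OF ideal.axioms(1)[OF X']])
  then have "J \<in> X" by (simp add: FactRing_def)
  then show "J \<subseteq> {r \<in> polys V. a_r_coset (mpoly_ring V) J r \<in> X}"
    using pideal_subset[OF J] coset_eq_ideal[OF J] by auto
qed

lemma pprime_quotient_image:
  assumes J: "pideal V J" and P: "pprime V P" "J \<subseteq> P"
  shows "primeideal (a_r_coset (mpoly_ring V) J ` P) (mpoly_ring V Quot J)"
proof -
  let ?c = "a_r_coset (mpoly_ring V) J"
  interpret h: ring_hom_ring "mpoly_ring V" "mpoly_ring V Quot J" ?c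
    by (rule ideal.rcos_ring_hom_ring[OF J])
  note ideal = pprime_pideal[OF P(1)]
  have carr: "carrier (mpoly_ring V Quot J) = ?c ` polys V"
    by (auto simp: FactRing_def A_RCOSETS_def')
  have mem: "?c r \<in> ?c ` P \<longleftrightarrow> r \<in> P" if "r \<in> polys V" for r
    using coset_eq_iff[OF J that] P(2) pideal_subset[OF ideal] pideal_add_cancel[OF ideal, of r] by blast
  show ?thesis
  proof (rule primeidealI)
    show "ideal (?c ` P) (mpoly_ring V Quot J)"
      by (rule ring.ring_ideal_imp_quot_ideal[OF ring_mpoly_ring J ideal])
    show "cring (mpoly_ring V Quot J)"
      by (rule ideal.quotient_is_cring[OF J cring_mpoly_ring])
    show "carrier (mpoly_ring V Quot J) \<noteq> ?c ` P"
      using mem[OF polys_1] pprime_1[OF P(1)] carr by blast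
  next
    fix a b assume ab: "a \<in> carrier (mpoly_ring V Quot J)" "b \<in> carrier (mpoly_ring V Quot J)"
      "a \<otimes>\<^bsub>mpoly_ring V Quot J\<^esub> b \<in> ?c ` P"
    then obtain r s where rs: "r \<in> polys V" "s \<in> polys V" "a = ?c r" "b = ?c s" by (auto simp: carr)
    then have "?c (r * s) \<in> ?c ` P" using ab(3) h.hom_mult[of r s] by simp
    then have "r * s \<in> P" using mem rs by blast
    then show "a \<in> ?c ` P \<or> b \<in> ?c ` P" using pprime_mult[OF P(1)] rs by blast
  qed
qed

text \<open>
  Primes of the quotient correspond to the primes above \<open>J\<close>, whose chains are bounded by
  \<open>idim_strict_antimono\<close> and produced by iterating \<open>next_prime\<close>.
\<close>

theorem krull_dim_eq_idim:
  fixes J :: "'k::field_char_0 mpoly set"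
  assumes fin: "finite V" and J: "pideal V J"
  shows "krull_dim (mpoly_ring V Quot J) = enat (idim V J)"
proof -
  let ?c = "a_r_coset (mpoly_ring V) J"
  let ?L = "{enat l | l. \<exists>P :: nat \<Rightarrow> 'k mpoly set set.
     (\<forall>i\<le>l. primeideal (P i) (mpoly_ring V Quot J)) \<and> (\<forall>i<l. P i \<subset> P (Suc i))}"
  have "l \<le> idim V J" if X: "\<forall>i\<le>l. primeideal (X i) (mpoly_ring V Quot J)" "\<forall>i<l. X i \<subset> X (Suc i)" for l X
  proof -
    define P where "P i = {r \<in> polys V. ?c r \<in> X i}" for i
    have prime: "pprime V (P i)" "J \<subseteq> P i" if "i \<le> l" for i
      unfolding P_def using pprime_quotient_vimage[OF J X(1)[rule_format, OF that]] .
    have XP: "X i = ?c ` P i" if "i \<le> l" for i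
      unfolding P_def using X(1) that
        additive_subgroup.a_subset[OF ideal.axioms(1)[OF primeideal.axioms(1)], of "X i" "mpoly_ring V Quot J"]
      by (auto simp: FactRing_def A_RCOSETS_def')
    have strict: "P i \<subset> P (Suc i)" if "i < l" for i
    proof -
      have "P i \<subseteq> P (Suc i)" unfolding P_def using X(2) that by blast
      moreover have "P i \<noteq> P (Suc i)" using XP[of i] XP[of "Suc i"] X(2) that by force
      ultimately show ?thesis by blast
    qed
    show ?thesis by (rule chain_length_le_idim[OF fin prime(1) prime(2)[of 0] strict]) auto
  qed
  then have "Sup ?L \<le> enat (idim V J)" by (intro Sup_least) auto
  moreover have "enat (idim V J) \<le> Sup ?L"
  proof (cases "1 \<in> J")
    case True
    then have "\<not> indep_mod J W" for W by auto
    then have "idim V J = 0" by (simp add: idim_def)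
    then show ?thesis by (simp flip: zero_enat_def)
  next
    case False
    obtain C where chain: "\<forall>i\<le>idim V J. pprime V (C i) \<and> J \<subseteq> C i" "\<forall>i<idim V J. C i \<subset> C (Suc i)"
      by (rule chain_of_length_idim[OF fin J False])
    then have C: "\<And>i. i \<le> idim V J \<Longrightarrow> pprime V (C i)" "\<And>i. i \<le> idim V J \<Longrightarrow> J \<subseteq> C i"
      "\<And>i. i < idim V J \<Longrightarrow> C i \<subset> C (Suc i)"
      by auto
    have primes: "primeideal (?c ` C i) (mpoly_ring V Quot J)" if "i \<le> idim V J" for i
      using that C(1,2) by (intro pprime_quotient_image[OF J]) auto
    have strict: "?c ` C i \<subset> ?c ` C (Suc i)" if i: "i < idim V J" for i
    proof -
      obtain f where f: "f \<in> C (Suc i)" "f \<notin> C i" using C(3)[OF i] by blast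
      have ideal: "pideal V (C i)" "pideal V (C (Suc i))" using C(1) i by (auto intro: pprime_pideal)
      have "f \<in> polys V" using f(1) pideal_subset[OF ideal(2)] by blast
      then have "?c f \<notin> ?c ` C i"
        using coset_eq_iff[OF J] f(2) C(2)[of i] i pideal_subset[OF ideal(1)] pideal_add_cancel[OF ideal(1), of f]
        by (metis (no_types, opaque_lifting) image_iff less_imp_le subsetD)
      then show ?thesis using f C(3)[OF i] by blast
    qed
    have "(\<forall>i\<le>idim V J. primeideal (?c ` C i) (mpoly_ring V Quot J)) \<and> (\<forall>i<idim V J. ?c ` C i \<subset> ?c ` C (Suc i))"
      using primes strict by simp
    then have X: "\<exists>X :: nat \<Rightarrow> 'k mpoly set set. (\<forall>i\<le>idim V J. primeideal (X i) (mpoly_ring V Quot J)) \<and> (\<forall>i<idim V J. X i \<subset> X (Suc i))"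
      by (rule exI[of _ "\<lambda>i. ?c ` C i"])
    have "enat (idim V J) \<in> ?L"
      unfolding mem_Collect_eq by (rule exI[of _ "idim V J"], rule conjI, rule refl, rule X)
    then show ?thesis by (rule Sup_upper)
  qed
  ultimately show ?thesis unfolding krull_dim_def by (rule antisym)
qed



subsection \<open>Algebraically independent elements\<close>

lemma pprime_subst_image:
  assumes V: "\<And>i. i \<in> V1 \<Longrightarrow> \<tau> i \<in> polys V2" and surj: "polys V2 \<subseteq> subst \<tau> ` polys V1"
    and P: "pprime V1 P" and ker: "\<And>f. f \<in> polys V1 \<Longrightarrow> subst \<tau> f = 0 \<Longrightarrow> f \<in> P"
  shows "pprime V2 (subst \<tau> ` P)" "\<And>f. f \<in> polys V1 \<Longrightarrow> subst \<tau> f \<in> subst \<tau> ` P \<longleftrightarrow> f \<in> P"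
proof -
  note ideal = pprime_pideal[OF P]
  note PV = pideal_subset[OF ideal]
  show mem: "subst \<tau> f \<in> subst \<tau> ` P \<longleftrightarrow> f \<in> P" if f: "f \<in> polys V1" for f
  proof
    assume "subst \<tau> f \<in> subst \<tau> ` P"
    then obtain g where g: "g \<in> P" "subst \<tau> f = subst \<tau> g" by blast
    then have "f - g \<in> P" using f PV by (intro ker) (auto simp: subst_simps)
    then show "f \<in> P" using pideal_add_cancel[OF ideal] g(1) by blast
  qed blast
  show "pprime V2 (subst \<tau> ` P)"
  proof (intro pprimeI pidealI)
    show "subst \<tau> ` P \<subseteq> polys V2" using PV V by (auto intro: subst_in_polys)
    show "0 \<in> subst \<tau> ` P" using pideal_0[OF ideal] by (force simp: subst_simps)
    show "1 \<notin> subst \<tau> ` P" using mem[OF polys_1] pprime_1[OF P] by (simp add: subst_simps)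
  next
    fix f g assume "f \<in> subst \<tau> ` P" "g \<in> subst \<tau> ` P"
    then obtain f' g' where "f' \<in> P" "g' \<in> P" "f = subst \<tau> f'" "g = subst \<tau> g'" by blast
    then have "f' + g' \<in> P" "f + g = subst \<tau> (f' + g')" by (auto intro: pideal_add[OF ideal] simp: subst_simps)
    then show "f + g \<in> subst \<tau> ` P" by blast
  next
    fix f g :: "'a mpoly" assume fg: "f \<in> polys V2" "g \<in> subst \<tau> ` P"
    obtain f' where "f' \<in> polys V1" "f = subst \<tau> f'" using fg(1) surj by blast
    moreover obtain g' where "g' \<in> P" "g = subst \<tau> g'" using fg(2) by blast
    ultimately have fg': "f' \<in> polys V1" "g' \<in> P" "f = subst \<tau> f'" "g = subst \<tau> g'" by simp_all
    then have "f' * g' \<in> P" "f * g = subst \<tau> (f' * g')" by (auto intro: pideal_mult[OF ideal] simp: subst_simps)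
    then show "f * g \<in> subst \<tau> ` P" by blast
  next
    fix f g :: "'a mpoly" assume fg: "f \<in> polys V2" "g \<in> polys V2" "f * g \<in> subst \<tau> ` P"
    obtain f' where "f' \<in> polys V1" "f = subst \<tau> f'" using fg(1) surj by blast
    moreover obtain g' where "g' \<in> polys V1" "g = subst \<tau> g'" using fg(2) surj by blast
    ultimately have f': "f' \<in> polys V1" "g' \<in> polys V1" "f = subst \<tau> f'" "g = subst \<tau> g'" by simp_all
    then have "f' * g' \<in> P" using fg(3) mem[of "f' * g'"] by (auto simp: subst_simps)
    then show "f \<in> subst \<tau> ` P \<or> g \<in> subst \<tau> ` P" using f' pprime_mult[OF P] by blast
  qed
qed

lemma pideal_subst_vimage:
  assumes "\<And>i. i \<in> V1 \<Longrightarrow> \<tau> i \<in> polys V2" "pideal V2 J"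
  shows "pideal V1 {f \<in> polys V1. subst \<tau> f \<in> J}"
  using assms(2) subst_in_polys[of _ V1 \<tau> V2] assms(1)
  by (intro pidealI) (auto simp: subst_simps pideal_0 pideal_add pideal_mult)

lemma pprime_subst_vimage:
  assumes "\<And>i. i \<in> V1 \<Longrightarrow> \<tau> i \<in> polys V2" "pprime V2 P"
  shows "pprime V1 {f \<in> polys V1. subst \<tau> f \<in> P}"
  using pprime_1[OF assms(2)] pprime_mult[OF assms(2)] subst_in_polys[of _ V1 \<tau> V2] assms(1)
  by (intro pprimeI pideal_subst_vimage[OF assms(1)] pprime_pideal[OF assms(2)])
     (auto simp: subst_simps)

text \<open>
  The elements \<open>\<sigma> i\<close> become variables after passing to the graph of \<open>\<sigma>\<close>,
  in fresh variables.
\<close>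

lemma card_algebraically_independent_le:
  fixes J :: "'k::field_char_0 mpoly set"
  assumes fin: "finite V" "finite Z" and J: "pideal V J"
    and \<sigma>: "\<And>i. i \<in> Z \<Longrightarrow> \<sigma> i \<in> polys V"
    and inj: "\<And>f. f \<in> polys Z \<Longrightarrow> subst \<sigma> f \<in> J \<Longrightarrow> f = 0"
  shows "card Z \<le> idim V J"
proof -
  obtain B where B: "\<And>i. i \<in> V \<union> Z \<Longrightarrow> i < B"
    using fin finite_nat_set_iff_bounded[of "V \<union> Z"] by auto
  define Z' where "Z' = (\<lambda>i. i + B) ` Z"
  define V1 where "V1 = V \<union> Z'"
  define \<tau> where "\<tau> i = (if i < B then var i else \<sigma> (i - B))" for i
  have \<tau>: "\<tau> i \<in> polys V" if "i \<in> V1" for i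
    using that B \<sigma> unfolding V1_def Z'_def \<tau>_def by auto
  have \<tau>V: "subst \<tau> f = f" if "f \<in> polys V" for f
  proof -
    have "subst \<tau> f = subst var f" using that B by (intro subst_cong) (auto simp: \<tau>_def)
    then show ?thesis by simp
  qed
  have surj: "polys V \<subseteq> subst \<tau> ` polys V1"
  proof
    fix f :: "'k mpoly" assume f: "f \<in> polys V"
    have "polys V \<subseteq> polys V1" unfolding V1_def by (intro polys_mono) auto
    then show "f \<in> subst \<tau> ` polys V1" using \<tau>V[OF f] f by (metis image_eqI subsetD)
  qed
  define J1 where "J1 = {f \<in> polys V1. subst \<tau> f \<in> J}"
  have J1: "pideal V1 J1" unfolding J1_def using \<tau> J by (rule pideal_subst_vimage)
  have fin1: "finite V1" using fin by (simp add: V1_def Z'_def)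
  have "indep_mod J1 Z'"
  proof
    fix f assume f: "f \<in> J1 \<inter> polys Z'"
    define f' where "f' = subst (\<lambda>i. var (i - B)) f"
    have "f' \<in> polys Z"
      unfolding f'_def using f by (intro subst_in_polys[of _ Z']) (auto simp: Z'_def)
    moreover have "subst \<sigma> f' = subst \<tau> f"
      unfolding f'_def subst_subst using f by (intro subst_cong[of _ Z']) (auto simp: Z'_def \<tau>_def subst_simps)
    ultimately have "f' = 0" using inj f by (auto simp: J1_def)
    moreover have "subst (\<lambda>i. var (i + B)) f' = subst var f"
      unfolding f'_def subst_subst using f by (intro subst_cong[of _ Z']) (auto simp: Z'_def subst_simps)
    ultimately show "f \<in> {0}" by (simp add: subst_simps)
  qed
  then have "card Z \<le> idim V1 J1"
    using card_le_idim[OF fin1, of Z' J1] by (simp add: V1_def Z'_def card_image)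
  also have "\<dots> \<le> idim V J"
  proof (cases "1 \<in> J1")
    case True
    then have "\<not> indep_mod J1 W" for W by auto
    then show ?thesis by (simp add: idim_def)
  next
    case False
    obtain C where C: "\<forall>i\<le>idim V1 J1. pprime V1 (C i) \<and> J1 \<subseteq> C i" "\<forall>i<idim V1 J1. C i \<subset> C (Suc i)"
      by (rule chain_of_length_idim[OF fin1 J1 False])
    have ker: "f \<in> C i" if "i \<le> idim V1 J1" "f \<in> polys V1" "subst \<tau> f = 0" for i f
    proof -
      have "f \<in> J1" using that pideal_0[OF J] by (simp add: J1_def)
      then show ?thesis using C(1) that(1) by blast
    qed
    have prime: "pprime V (subst \<tau> ` C i)" if "i \<le> idim V1 J1" for i
      by (rule pprime_subst_image(1)[OF \<tau> surj]) (use C(1) ker that in auto)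
    have mem: "subst \<tau> f \<in> subst \<tau> ` C i \<longleftrightarrow> f \<in> C i" if "i \<le> idim V1 J1" "f \<in> polys V1" for i f
      by (rule pprime_subst_image(2)[OF \<tau> surj]) (use C(1) ker that in auto)
    show ?thesis
    proof (rule chain_length_le_idim[OF fin(1) prime])
      show "J \<subseteq> subst \<tau> ` C 0"
      proof
        fix f assume f: "f \<in> J"
        then obtain g where "g \<in> polys V1" "f = subst \<tau> g" using surj pideal_subset[OF J] by blast
        then show "f \<in> subst \<tau> ` C 0" using C(1) f by (auto simp: J1_def)
      qed
      fix i assume i: "i < idim V1 J1"
      then obtain f where f: "f \<in> C (Suc i)" "f \<notin> C i" using C(2) by blast
      have "f \<in> polys V1" using f(1) C(1) i pideal_subset[OF pprime_pideal] by (meson Suc_leI subsetD)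
      then have "subst \<tau> f \<notin> subst \<tau> ` C i" using mem[of i f] f(2) i by simp
      then show "subst \<tau> ` C i \<subset> subst \<tau> ` C (Suc i)" using f(1) C(2) i by blast
    qed
  qed
  finally show ?thesis .
qed

lemma ring_closed_subst_image: "ring_closed (subst \<sigma> ` polys Z)"
  unfolding ring_closed_def
proof (intro conjI ballI)
  show "0 \<in> subst \<sigma> ` polys Z" by (rule image_eqI[of _ _ 0]) (auto simp: subst_simps)
  show "1 \<in> subst \<sigma> ` polys Z" by (rule image_eqI[of _ _ 1]) (auto simp: subst_simps)
next
  fix a b assume "a \<in> subst \<sigma> ` polys Z" "b \<in> subst \<sigma> ` polys Z"
  then obtain f g where fg: "f \<in> polys Z" "g \<in> polys Z" "a = subst \<sigma> f" "b = subst \<sigma> g" by blast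
  show "a + b \<in> subst \<sigma> ` polys Z"
    by (rule image_eqI[of _ _ "f + g"]) (use fg in \<open>auto simp: subst_simps\<close>)
  show "a * b \<in> subst \<sigma> ` polys Z"
    by (rule image_eqI[of _ _ "f * g"]) (use fg in \<open>auto simp: subst_simps\<close>)
  show "- a \<in> subst \<sigma> ` polys Z"
    by (rule image_eqI[of _ _ "- f"]) (use fg in \<open>auto simp: subst_simps\<close>)
qed

text \<open>Chains of primes remain strict when contracted to a subring over which everything is finite.\<close>

lemma idim_le_card_of_finite:
  fixes P :: "'k::field_char_0 mpoly set"
  assumes fin: "finite V" "finite Z" and P: "pprime V P"
    and \<sigma>: "\<And>i. i \<in> Z \<Longrightarrow> \<sigma> i \<in> polys V"
    and gen: "generates_up_to (subst \<sigma> ` polys Z) E P 1 (polys V)"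
  shows "idim V P \<le> card Z"
proof -
  let ?S = "subst \<sigma> ` polys Z"
  have S: "?S \<subseteq> polys V" using \<sigma> by (auto intro: subst_in_polys)
  obtain C where C: "\<forall>i\<le>idim V P. pprime V (C i) \<and> P \<subseteq> C i" "\<forall>i<idim V P. C i \<subset> C (Suc i)"
    by (rule chain_of_length_idim[OF fin(1) pprime_pideal[OF P] pprime_1[OF P]])
  define D where "D i = {f \<in> polys Z. subst \<sigma> f \<in> C i}" for i
  have "idim V P \<le> idim Z (D 0)"
  proof (rule chain_length_le_idim[OF fin(2)])
    show "pprime Z (D i)" if "i \<le> idim V P" for i
      unfolding D_def using \<sigma> C(1) that by (intro pprime_subst_vimage) auto
  next
    fix i assume i: "i < idim V P"
    have C': "pprime V (C i)" "pprime V (C (Suc i))" "C i \<subset> C (Suc i)" "P \<subseteq> C i" using C i by auto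
    have "generates_up_to ?S E (C i) 1 (polys V)"
      using gen C'(4) unfolding generates_up_to_def by blast
    then have "\<exists>b\<in>?S. b \<in> C (Suc i) \<and> b \<notin> C i"
      using pprime_1[OF C'(1)]
      by (intro prime_increase_detected[OF C'(1-3) ring_closed_subst_image S ring_closedD(2)[OF ring_closed_subst_image]])
    then show "D i \<subset> D (Suc i)" using C'(3) unfolding D_def by blast
  qed simp
  also have "\<dots> \<le> card Z" using fin(2) by (intro idim_le) (auto intro: card_mono)
  finally show ?thesis .
qed

subsection \<open>Adding one variable\<close>

definition extend_ideal :: "nat set \<Rightarrow> nat \<Rightarrow> 'k::field mpoly set \<Rightarrow> 'k mpoly set" where
  "extend_ideal V j J = {f \<in> polys V. \<forall>k. coeff (expansion j f) k \<in> J}"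

lemma pideal_extend_ideal:
  assumes J: "pideal (V - {j}) J"
  shows "pideal V (extend_ideal V j J)"
proof (rule pidealI)
  fix f g :: "'a mpoly" assume fg: "f \<in> polys V" "g \<in> extend_ideal V j J"
  have "coeff (expansion j (f * g)) k \<in> J" for k
    using fg coeff_expansion_in_polys[OF fg(1), of j]
    by (auto simp: coeff_mult extend_ideal_def intro!: pideal_sum[OF J] pideal_mult[OF J])
  then show "f * g \<in> extend_ideal V j J" using fg by (auto simp: extend_ideal_def)
qed (auto simp: extend_ideal_def pideal_0[OF J] intro: pideal_add[OF J])

lemma polys_diff_singleton: "f \<in> polys (V - {j}) \<Longrightarrow> f \<in> polys V"
  using polys_mono[of "V - {j}" V] by blast

lemma extend_ideal_base:
  assumes J: "pideal (V - {j}) J"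
  shows "f \<in> J \<Longrightarrow> f \<in> extend_ideal V j J"
  using pideal_subset[OF J] pideal_0[OF J] polys_diff_singleton[of f V j]
  by (auto simp: extend_ideal_def expansion_free[of f "V - {j}" j] coeff_pCons split: nat.splits)

lemma idim_extend_ideal:
  assumes fin: "finite V" and j: "j \<in> V" and J: "pideal (V - {j}) J" "1 \<notin> J"
  shows "idim V (extend_ideal V j J) = Suc (idim (V - {j}) J)"
proof (rule antisym)
  show "idim V (extend_ideal V j J) \<le> Suc (idim (V - {j}) J)"
  proof (rule idim_le[OF fin])
    fix W assume W: "W \<subseteq> V" "indep_mod (extend_ideal V j J) W"
    have "J \<inter> polys (W - {j}) \<subseteq> extend_ideal V j J \<inter> polys W"
      using extend_ideal_base[OF J(1)] polys_diff_singleton by blast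
    then have "card (W - {j}) \<le> idim (V - {j}) J"
      using fin W by (intro card_le_idim) auto
    moreover have "card W \<le> Suc (card (W - {j}))"
      using finite_subset[OF W(1) fin] by (metis card_Diff_singleton_if card_Suc_Diff1 le_SucI order.refl Diff_empty Diff_insert0)
    ultimately show "card W \<le> Suc (idim (V - {j}) J)" by simp
  qed
  obtain W where W: "W \<subseteq> V - {j}" "indep_mod J W" "card W = idim (V - {j}) J"
    using idim_attained[OF _ J] fin by blast
  have "indep_mod (extend_ideal V j J) (insert j W)"
  proof
    fix f assume f: "f \<in> extend_ideal V j J \<inter> polys (insert j W)"
    have "coeff (expansion j f) k = 0" for k
      using f coeff_expansion_in_polys[of f "insert j W" j k] W polys_mono[of "insert j W - {j}" W]
      by (auto simp: extend_ideal_def)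
    then have "expansion j f = 0" by (simp add: poly_eq_iff)
    then show "f \<in> {0}" by simp
  qed
  then have "card (insert j W) \<le> idim V (extend_ideal V j J)"
    using W(1) j fin by (intro card_le_idim) auto
  then show "Suc (idim (V - {j}) J) \<le> idim V (extend_ideal V j J)"
    using W fin finite_subset[OF W(1)] by (subst (asm) card_insert_disjoint) auto
qed

lemma idim_contract_le:
  assumes fin: "finite V" and J: "J \<subseteq> polys V" "W \<subseteq> V"
  shows "idim W (J \<inter> polys W) \<le> idim V J"
proof (rule idim_le[OF finite_subset[OF J(2) fin]])
  fix U assume U: "U \<subseteq> W" "indep_mod (J \<inter> polys W) U"
  then have "indep_mod J U" using polys_mono[OF U(1)] by blast
  then show "card U \<le> idim V J" using U(1) J(2) fin by (intro card_le_idim) auto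
qed

lemma idim_le_Suc_contract:
  assumes fin: "finite V"
  shows "idim V J \<le> Suc (idim (V - {j}) (J \<inter> polys (V - {j})))"
proof (rule idim_le[OF fin])
  fix W assume W: "W \<subseteq> V" "indep_mod J W"
  have "indep_mod (J \<inter> polys (V - {j})) (W - {j})"
    using W(2) polys_diff_singleton[of _ W j] by blast
  then have "card (W - {j}) \<le> idim (V - {j}) (J \<inter> polys (V - {j}))"
    using W(1) fin by (intro card_le_idim) auto
  moreover have "card W \<le> Suc (card (W - {j}))"
    using finite_subset[OF W(1) fin] by (metis card_Diff_singleton_if card_Suc_Diff1 le_SucI order.refl Diff_empty Diff_insert0)
  ultimately show "card W \<le> Suc (idim (V - {j}) (J \<inter> polys (V - {j})))" by simp
qed

lemma difference_of_powers_in_pideal: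
  assumes J: "pideal V J" and ab: "a \<in> polys V" "b \<in> polys V" "a - b \<in> J"
  shows "a ^ n - b ^ n \<in> J"
proof (induction n)
  case (Suc n)
  have "a * (a ^ n - b ^ n) + b ^ n * (a - b) \<in> J"
    using Suc ab by (intro pideal_add[OF J] pideal_mult[OF J]) auto
  then show ?case by (simp add: algebra_simps)
qed (simp add: pideal_0[OF J])

text \<open>
  Modulo \<open>Q\<close> the variable \<open>x\<^sub>j\<close> is the fraction \<open>-r/c\<close> of elements without \<open>x\<^sub>j\<close>. A set \<open>W\<close> containing \<open>j\<close> is
  therefore matched by one without \<open>j\<close>: were \<open>W - {j}\<close> maximal, then a dependence between the
  elements \<open>c\<^sup>m\<^sup>-\<^sup>i (-r)\<^sup>i\<close> over \<open>polys (W - {j})\<close> would be one between the powers of \<open>x\<^sub>j\<close>.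
\<close>

lemma idim_contract_birational:
  assumes fin: "finite V" and j: "j \<in> V" and Q: "pprime V Q"
    and c: "c \<in> polys (V - {j})" "c \<notin> Q" and r: "r \<in> polys (V - {j})" "c * var j + r \<in> Q"
  shows "idim (V - {j}) (Q \<inter> polys (V - {j})) = idim V Q"
proof (rule antisym)
  let ?V = "V - {j}"
  let ?P = "Q \<inter> polys ?V"
  note ideal = pprime_pideal[OF Q]
  show "idim ?V ?P \<le> idim V Q"
    using pideal_subset[OF ideal] by (intro idim_contract_le fin) auto
  have P: "pprime ?V ?P" using Q by (rule pprime_restrict) auto
  show "idim V Q \<le> idim ?V ?P"
  proof (rule idim_le[OF fin])
    fix W assume W: "W \<subseteq> V" "indep_mod Q W"
    have indP: "indep_mod ?P (W - {j})" using W(2) polys_diff_singleton[of _ W j] by blast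
    have WV: "W - {j} \<subseteq> ?V" using W(1) by blast
    have finW: "finite W" using W(1) fin by (rule finite_subset)
    show "card W \<le> idim ?V ?P"
    proof (cases "j \<in> W")
      case False
      then show ?thesis using card_le_idim[OF _ WV indP] fin by simp
    next
      case True
      show ?thesis
      proof (cases "\<forall>x\<in>?V - (W - {j}). \<not> indep_mod ?P (insert x (W - {j}))")
        case False
        then obtain x where x: "x \<in> ?V - (W - {j})" "indep_mod ?P (insert x (W - {j}))" by blast
        have "card (insert x (W - {j})) \<le> idim ?V ?P"
          using x WV fin by (intro card_le_idim) auto
        moreover have "card (insert x (W - {j})) = card W"
        proof -
          have "x \<notin> W - {j}" using x by blast
          then have "card (insert x (W - {j})) = Suc (card (W - {j}))" using finW by simp
          also have "\<dots> = card W" by (rule card_Suc_Diff1[OF finW True])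
          finally show ?thesis .
        qed
        ultimately show ?thesis by simp
      next
        case max: True
        obtain E a where E: "a \<in> polys (W - {j})" "a \<noteq> 0" "generates_up_to (polys (W - {j})) E ?P a (polys ?V)"
          by (rule maximal_indep_generates[OF _ P WV indP max]) (use fin in auto)
        let ?m = "card E"
        have "a \<notin> ?P" using indP E by blast
        then have "\<exists>b. (\<forall>i\<le>?m. b i \<in> polys (W - {j})) \<and> (\<exists>i\<le>?m. b i \<notin> ?P) \<and>
            (\<Sum>i\<le>?m. b i * (c ^ (?m - i) * (- r) ^ i)) \<in> ?P"
          by (rule dependence_of_generated[OF P ring_closed_polys polys_mono[OF WV] E(1) _ order.refl E(3)])
             (use c r in auto)
        then obtain b where b: "\<And>i. i \<le> ?m \<Longrightarrow> b i \<in> polys (W - {j})" "\<exists>i\<le>?m. b i \<notin> ?P"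
            "(\<Sum>i\<le>?m. b i * (c ^ (?m - i) * (- r) ^ i)) \<in> ?P"
          by blast
        have V: "c \<in> polys V" "r \<in> polys V" "\<And>i. i \<le> ?m \<Longrightarrow> b i \<in> polys V" "var j \<in> polys V"
          using c r b(1) polys_mono[of "W - {j}" V] W(1) j by (auto intro: polys_diff_singleton)
        have "b i * (c ^ (?m - i) * ((c * var j) ^ i - (- r) ^ i)) \<in> Q" if "i \<le> ?m" for i
        proof -
          have "(c * var j) ^ i - (- r) ^ i \<in> Q"
            using V r(2) by (intro difference_of_powers_in_pideal[OF ideal]) auto
          then show ?thesis using V that by (blast intro: pideal_mult[OF ideal])
        qed
        then have "(\<Sum>i\<le>?m. b i * (c ^ (?m - i) * ((c * var j) ^ i - (- r) ^ i))) \<in> Q"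
          by (intro pideal_sum[OF ideal]) auto
        then have "(\<Sum>i\<le>?m. b i * (c ^ (?m - i) * ((c * var j) ^ i - (- r) ^ i))) +
            (\<Sum>i\<le>?m. b i * (c ^ (?m - i) * (- r) ^ i)) \<in> Q"
          using b(3) by (intro pideal_add[OF ideal]) auto
        also have "(\<Sum>i\<le>?m. b i * (c ^ (?m - i) * ((c * var j) ^ i - (- r) ^ i))) +
            (\<Sum>i\<le>?m. b i * (c ^ (?m - i) * (- r) ^ i)) = (\<Sum>i\<le>?m. c ^ ?m * (b i * var j ^ i))"
          unfolding sum.distrib[symmetric]
        proof (intro sum.cong refl)
          fix i assume "i \<in> {..?m}"
          then have "c ^ ?m = c ^ (?m - i) * c ^ i" by (simp flip: power_add)
          then show "b i * (c ^ (?m - i) * ((c * var j) ^ i - (- r) ^ i)) + b i * (c ^ (?m - i) * (- r) ^ i) =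
              c ^ ?m * (b i * var j ^ i)"
            by (simp add: algebra_simps power_mult_distrib)
        qed
        finally have "c ^ ?m * (\<Sum>i\<le>?m. b i * var j ^ i) \<in> Q" by (simp add: sum_distrib_left)
        moreover have "c ^ ?m \<notin> Q" using pprime_power[OF Q V(1)] c(2) by blast
        moreover have sumW: "(\<Sum>i\<le>?m. b i * var j ^ i) \<in> polys W"
          using b(1) True by (auto intro!: polys_sum polys_mult intro: polys_diff_singleton)
        ultimately have "(\<Sum>i\<le>?m. b i * var j ^ i) \<in> Q"
          using pprime_mult[OF Q] V polys_mono[OF W(1)] by blast
        then have "(\<Sum>i\<le>?m. b i * var j ^ i) = 0" using W(2) sumW by blast
        moreover have "(\<Sum>i\<le>?m. b i * var j ^ i) = poly (\<Sum>i\<le>?m. monom (b i) i) (var j)"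
          by (simp add: poly_sum poly_monom)
        moreover have "expansion j (poly (\<Sum>i\<le>?m. monom (b i) i) (var j)) = (\<Sum>i\<le>?m. monom (b i) i)"
          by (rule expansion_poly[of _ "W - {j}"]) (use b(1) in \<open>auto simp: coeff_sum\<close>)
        ultimately have "(\<Sum>i\<le>?m. monom (b i) i) = 0" by simp
        then have "coeff (\<Sum>i\<le>?m. monom (b i) i) k = 0" for k by simp
        then have *: "(if k \<le> ?m then b k else 0) = 0" for k by (simp add: coeff_sum)
        have "b i = 0" if "i \<le> ?m" for i using *[of i] that by simp
        then show ?thesis using b(2) pideal_0[OF pprime_pideal[OF P]] by auto
      qed
    qed
  qed
qed



section \<open>Noether normalization\<close>

lemma poly_expansion_eq_subst:
  "poly (expansion z g) a = subst (\<lambda>i. if i = z then a else var i) g"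
proof -
  have "g \<in> polys UNIV" by simp
  then show ?thesis by (induction rule: polys_induct) (auto simp: expansion_var subst_simps)
qed

lemma exists_nonvanishing_point:
  fixes g :: "'k::field_char_0 mpoly"
  assumes "finite Z" "g \<in> polys Z" "g \<noteq> 0"
  shows "\<exists>\<kappa>. subst (\<lambda>i. const (\<kappa> i)) g \<noteq> 0"
  using assms
proof (induction Z arbitrary: g rule: finite_induct)
  case empty
  then obtain c where "g = const c" by (auto elim: polys_emptyE)
  then show ?case using empty by (simp add: subst_simps)
next
  case (insert z Z)
  obtain c where c: "poly (expansion z g) (const c) \<noteq> 0"
    using exists_nonroot[of "expansion z g"] insert.prems by auto
  let ?g = "poly (expansion z g) (const c)"
  have "?g \<in> polys Z"
    using coeff_expansion_in_polys[OF insert.prems(1), of z] insert.hyps by (intro poly_in_polys) auto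
  then obtain \<kappa> where \<kappa>: "subst (\<lambda>i. const (\<kappa> i)) ?g \<noteq> 0" using insert.IH c by blast
  have "subst (\<lambda>i. const (\<kappa> i)) ?g = subst (\<lambda>i. const ((\<kappa>(z := c)) i)) g"
    unfolding poly_expansion_eq_subst subst_subst
    by (intro subst_cong[of _ UNIV]) (auto simp: subst_simps)
  then show ?case using \<kappa> by metis
qed

lemma coeff_mult_at_bounds:
  fixes F G :: "'a::comm_ring_1 poly"
  assumes "degree F \<le> a" "degree G \<le> b"
  shows "coeff (F * G) (a + b) = coeff F a * coeff G b"
proof -
  have "coeff (F * G) (a + b) = (\<Sum>i\<le>a + b. coeff F i * coeff G (a + b - i))"
    by (rule coeff_mult)
  also have "\<dots> = (\<Sum>i\<in>{a}. coeff F i * coeff G (a + b - i))"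
  proof (intro sum.mono_neutral_right ballI)
    fix i assume i: "i \<in> {..a + b} - {a}"
    show "coeff F i * coeff G (a + b - i) = 0"
    proof (cases "a < i")
      case True
      then show ?thesis using assms(1) by (simp add: coeff_eq_0)
    next
      case False
      then have "b < a + b - i" using i by auto
      then show ?thesis using assms(2) by (simp add: coeff_eq_0)
    qed
  qed auto
  finally show ?thesis by simp
qed

text \<open>
  After a generic shear along \<open>z\<close>, the top coefficient in \<open>z\<close> of a polynomial is the value
  of its leading form at the direction of the shear.
\<close>

lemma degree_coeff_shear_monomial:
  fixes \<kappa> :: "nat \<Rightarrow> 'k::field" and z :: nat
  defines "\<tau> \<equiv> \<lambda>i. if i = z then const (\<kappa> z) * var z else var i + const (\<kappa> i) * var z"
  shows "degree (expansion z (monomial_value \<tau> m)) \<le> total_degree m"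
    "coeff (expansion z (monomial_value \<tau> m)) (total_degree m) = monomial_value (\<lambda>i. const (\<kappa> i)) m"
proof -
  have lin: "degree (expansion z (\<tau> i)) \<le> 1" "coeff (expansion z (\<tau> i)) 1 = const (\<kappa> i)" for i
    by (auto simp: \<tau>_def expansion_var degree_pCons_eq_if)
  have pow: "degree (expansion z (\<tau> i ^ n)) \<le> n \<and> coeff (expansion z (\<tau> i ^ n)) n = const (\<kappa> i) ^ n" for i n
  proof (induction n)
    case (Suc n)
    then show ?case
      using lin[of i] degree_mult_le[of "expansion z (\<tau> i)" "expansion z (\<tau> i) ^ n"]
        coeff_mult_at_bounds[of "expansion z (\<tau> i)" 1 "expansion z (\<tau> i) ^ n" n]
      by auto
  qed (simp add: one_pCons[symmetric])
  have "degree (expansion z (\<Prod>i\<in>A. \<tau> i ^ n i)) \<le> (\<Sum>i\<in>A. n i) \<and>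
      coeff (expansion z (\<Prod>i\<in>A. \<tau> i ^ n i)) (\<Sum>i\<in>A. n i) = (\<Prod>i\<in>A. const (\<kappa> i) ^ n i)"
    if "finite A" for A n
    using that
  proof (induction A)
    case (insert x A)
    let ?F = "expansion z (\<tau> x ^ n x)" and ?G = "expansion z (\<Prod>i\<in>A. \<tau> i ^ n i)"
    have "degree (?F * ?G) \<le> n x + (\<Sum>i\<in>A. n i)"
      using insert.IH pow[of x "n x"] degree_mult_le[of ?F ?G] by linarith
    moreover have "coeff (?F * ?G) (n x + (\<Sum>i\<in>A. n i)) = const (\<kappa> x) ^ n x * (\<Prod>i\<in>A. const (\<kappa> i) ^ n i)"
      using insert.IH pow[of x "n x"] by (subst coeff_mult_at_bounds) auto
    ultimately show ?case using insert.hyps by simp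
  qed simp
  from this[of "Poly_Mapping.keys m" "Poly_Mapping.lookup m"]
  show "degree (expansion z (monomial_value \<tau> m)) \<le> total_degree m"
    "coeff (expansion z (monomial_value \<tau> m)) (total_degree m) = monomial_value (\<lambda>i. const (\<kappa> i)) m"
    by (auto simp: monomial_value_def total_degree_def)
qed

lemma exists_shear:
  fixes f :: "'k::field_char_0 mpoly"
  assumes fin: "finite Z" and z: "z \<in> Z" and f: "f \<in> polys Z" "f \<noteq> 0"
  shows "\<exists>\<kappa> c. \<kappa> z \<noteq> 0 \<and> c \<noteq> 0 \<and> lead_coeff (expansion z
    (subst (\<lambda>i. if i = z then const (\<kappa> z) * var z else var i + const (\<kappa> i) * var z) f)) = const c"
proof -
  let ?K = "Poly_Mapping.keys f"
  have K: "finite ?K" "?K \<noteq> {}" using f(2) by auto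
  define D where "D = Max (total_degree ` ?K)"
  have D: "total_degree m \<le> D" if "m \<in> ?K" for m unfolding D_def using that K by simp
  define A where "A = {m \<in> ?K. total_degree m = D}"
  have "D \<in> total_degree ` ?K" unfolding D_def using K by (intro Max_in) auto
  then obtain m0 where m0: "m0 \<in> A" unfolding A_def by blast
  define top where "top = (\<Sum>m\<in>A. Poly_Mapping.single m (Poly_Mapping.lookup f m))"
  have finA: "finite A" unfolding A_def using K by simp
  have "Poly_Mapping.lookup top m0 = Poly_Mapping.lookup f m0"
  proof -
    have "Poly_Mapping.lookup top m0 = (\<Sum>m\<in>A. if m = m0 then Poly_Mapping.lookup f m0 else 0)"
      unfolding top_def lookup_sum by (intro sum.cong) (auto simp: lookup_single when_def)
    then show ?thesis using m0 finA by simp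
  qed
  then have "top \<noteq> 0" using m0 unfolding A_def by (auto simp: in_keys_iff)
  moreover have var0: "var z \<noteq> (0 :: 'k mpoly)"
  proof
    assume "var z = (0 :: 'k mpoly)"
    then have "expansion z (var z :: 'k mpoly) = 0" by simp
    then show False by simp
  qed
  moreover have topZ: "top \<in> polys Z"
  proof -
    have "Poly_Mapping.single m (Poly_Mapping.lookup f m) \<in> polys Z" if "m \<in> A" for m
      using that f(1) unfolding A_def by (auto simp: polys_iff)
    then show ?thesis unfolding top_def by blast
  qed
  ultimately obtain \<kappa> where \<kappa>: "subst (\<lambda>i. const (\<kappa> i)) (top * var z) \<noteq> 0"
    using exists_nonvanishing_point[OF fin, of "top * var z"] z by auto
  then have \<kappa>z: "\<kappa> z \<noteq> 0" and val: "subst (\<lambda>i. const (\<kappa> i)) top \<noteq> 0"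
    by (auto simp: subst_simps)
  define \<tau> where "\<tau> = (\<lambda>i. if i = z then const (\<kappa> z) * var z else var i + const (\<kappa> i) * var z)"
  note mon = degree_coeff_shear_monomial[of z \<kappa>, folded \<tau>_def]
  have exp: "expansion z (subst \<tau> f) =
      (\<Sum>m\<in>?K. [:const (Poly_Mapping.lookup f m):] * expansion z (monomial_value \<tau> m))"
    by (simp add: evaluation_def)
  have le: "degree (expansion z (subst \<tau> f)) \<le> D"
    unfolding exp
  proof (intro degree_sum_le K(1))
    fix m assume m: "m \<in> ?K"
    have "degree ([:const (Poly_Mapping.lookup f m):] * expansion z (monomial_value \<tau> m)) \<le>
        degree (expansion z (monomial_value \<tau> m))"
      by (simp add: degree_smult_le)
    then show "degree ([:const (Poly_Mapping.lookup f m):] * expansion z (monomial_value \<tau> m)) \<le> D"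
      using mon(1)[of m] D[OF m] by linarith
  qed
  have "coeff (expansion z (subst \<tau> f)) D =
      (\<Sum>m\<in>?K. const (Poly_Mapping.lookup f m) * coeff (expansion z (monomial_value \<tau> m)) D)"
    unfolding exp by (simp add: coeff_sum)
  also have "\<dots> = (\<Sum>m\<in>A. const (Poly_Mapping.lookup f m) * coeff (expansion z (monomial_value \<tau> m)) D)"
  proof (intro sum.mono_neutral_right)
    show "\<forall>m\<in>?K - A. const (Poly_Mapping.lookup f m) * coeff (expansion z (monomial_value \<tau> m)) D = 0"
    proof
      fix m assume m: "m \<in> ?K - A"
      then have "total_degree m < D" using D[of m] unfolding A_def by auto
      then show "const (Poly_Mapping.lookup f m) * coeff (expansion z (monomial_value \<tau> m)) D = 0"
        using mon(1)[of m] by (simp add: coeff_eq_0)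
    qed
  qed (auto simp: A_def)
  also have "\<dots> = (\<Sum>m\<in>A. const (Poly_Mapping.lookup f m) * monomial_value (\<lambda>i. const (\<kappa> i)) m)"
    using mon(2) by (intro sum.cong) (auto simp: A_def)
  also have "\<dots> = subst (\<lambda>i. const (\<kappa> i)) top"
    unfolding top_def by (simp add: subst_simps const_hom.evaluation_single)
  finally have coeff: "coeff (expansion z (subst \<tau> f)) D = subst (\<lambda>i. const (\<kappa> i)) top" .
  then have "degree (expansion z (subst \<tau> f)) = D"
    using le val by (metis le_antisym le_degree)
  then have "lead_coeff (expansion z (subst \<tau> f)) = subst (\<lambda>i. const (\<kappa> i)) top"
    using coeff by simp
  moreover have "subst (\<lambda>i. const (\<kappa> i)) top \<in> polys {}" by (intro subst_in_polys[of _ UNIV]) auto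
  then obtain c where "subst (\<lambda>i. const (\<kappa> i)) top = const c" by (rule polys_emptyE)
  ultimately show ?thesis using \<kappa>z val unfolding \<tau>_def by (intro exI[of _ \<kappa>] exI[of _ c]) auto
qed

text \<open>
  The new coordinates \<open>\<sigma>'\<close> of the subring generated by the \<open>\<sigma> i\<close> arise from \<open>\<sigma>\<close> by the inverse of a shear that makes
  \<open>f\<close> monic in \<open>z\<close> up to a constant.
\<close>

lemma exists_monic_coordinates:
  fixes f :: "'k::field_char_0 mpoly"
  assumes fin: "finite Z" and z: "z \<in> Z" and f: "f \<in> polys Z" "f \<noteq> 0"
    and \<sigma>: "\<And>i. i \<in> Z \<Longrightarrow> \<sigma> i \<in> polys V"
  obtains \<sigma>' F c where "\<forall>i\<in>Z. \<sigma>' i \<in> polys V" "subst \<sigma>' ` polys Z = subst \<sigma> ` polys Z"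
    "\<forall>g\<in>polys Z. \<exists>g'\<in>polys Z. subst \<sigma>' g = subst \<sigma> g' \<and> (g' = 0 \<longrightarrow> g = 0)"
    "lead_coeff F = 1" "\<forall>k. coeff F k \<in> polys (Z - {z})"
    "subst \<sigma>' (poly F (var z)) = const c * subst \<sigma> f"
proof -
  obtain \<kappa> c where \<kappa>: "\<kappa> z \<noteq> 0" "c \<noteq> 0" "lead_coeff (expansion z
    (subst (\<lambda>i. if i = z then const (\<kappa> z) * var z else var i + const (\<kappa> i) * var z) f)) = const c"
    using exists_shear[OF fin z f] by blast
  define \<tau> where "\<tau> = (\<lambda>i. if i = z then const (\<kappa> z) * var z else var i + const (\<kappa> i) * var z)"
  define \<rho> where "\<rho> = (\<lambda>i. if i = z then const (inverse (\<kappa> z)) * var z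
     else var i - const (\<kappa> i) * (const (inverse (\<kappa> z)) * var z))"
  have inv: "const (\<kappa> z) * (const (inverse (\<kappa> z)) * g) = g" "const (inverse (\<kappa> z)) * (const (\<kappa> z) * g) = g" for g
  proof -
    note k = const_inverse[OF \<kappa>(1)]
    show "const (\<kappa> z) * (const (inverse (\<kappa> z)) * g) = g"
      unfolding mult.assoc[symmetric] k by (rule mult_1)
    show "const (inverse (\<kappa> z)) * (const (\<kappa> z) * g) = g"
      unfolding mult.assoc[symmetric] mult.commute[of "const (inverse (\<kappa> z))"] k by (rule mult_1)
  qed
  have \<tau>\<rho>: "subst \<tau> (subst \<rho> g) = g" and \<rho>\<tau>: "subst \<rho> (subst \<tau> g) = g" for g
  proof -
    have "subst \<tau> (subst \<rho> g) = subst var g" "subst \<rho> (subst \<tau> g) = subst var g"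
      unfolding subst_subst by (intro subst_cong[of _ UNIV]; auto simp: \<tau>_def \<rho>_def subst_simps inv)+
    then show "subst \<tau> (subst \<rho> g) = g" "subst \<rho> (subst \<tau> g) = g" by simp_all
  qed
  have \<tau>Z: "subst \<tau> g \<in> polys Z" and \<rho>Z: "subst \<rho> g \<in> polys Z" if "g \<in> polys Z" for g
    by (rule subst_in_polys[OF that]; use z in \<open>auto simp: \<tau>_def \<rho>_def\<close>)+
  define \<sigma>' where "\<sigma>' = (\<lambda>i. subst \<sigma> (\<rho> i))"
  have \<sigma>': "subst \<sigma>' g = subst \<sigma> (subst \<rho> g)" for g by (simp add: \<sigma>'_def subst_subst)
  define F where "F = smult (const (inverse c)) (expansion z (subst \<tau> f))"
  show ?thesis
  proof (rule that)
    show "\<forall>i\<in>Z. \<sigma>' i \<in> polys V"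
    proof
      fix i assume "i \<in> Z"
      then have "\<rho> i \<in> polys Z" using z by (auto simp: \<rho>_def)
      then show "\<sigma>' i \<in> polys V" unfolding \<sigma>'_def using \<sigma> by (rule subst_in_polys)
    qed
    show "subst \<sigma>' ` polys Z = subst \<sigma> ` polys Z"
    proof
      show "subst \<sigma>' ` polys Z \<subseteq> subst \<sigma> ` polys Z" using \<sigma>' \<rho>Z by auto
      show "subst \<sigma> ` polys Z \<subseteq> subst \<sigma>' ` polys Z"
      proof
        fix x assume "x \<in> subst \<sigma> ` polys Z"
        then obtain g where "g \<in> polys Z" "x = subst \<sigma> g" by blast
        then show "x \<in> subst \<sigma>' ` polys Z"
          using \<sigma>'[of "subst \<tau> g"] \<rho>\<tau>[of g] \<tau>Z[of g] by (intro image_eqI[of _ _ "subst \<tau> g"]) auto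
      qed
    qed
    show "\<forall>g\<in>polys Z. \<exists>g'\<in>polys Z. subst \<sigma>' g = subst \<sigma> g' \<and> (g' = 0 \<longrightarrow> g = 0)"
    proof
      fix g :: "'k mpoly" assume g: "g \<in> polys Z"
      show "\<exists>g'\<in>polys Z. subst \<sigma>' g = subst \<sigma> g' \<and> (g' = 0 \<longrightarrow> g = 0)"
      proof (intro bexI[of _ "subst \<rho> g"] conjI impI)
        show "g = 0" if "subst \<rho> g = 0" using \<tau>\<rho>[of g] that by (simp add: subst_simps)
      qed (use \<sigma>' \<rho>Z[OF g] in auto)
    qed
    show "lead_coeff F = 1"
      using \<kappa>(2,3) const_inverse[OF \<kappa>(2)] unfolding F_def \<tau>_def by (simp add: mult.commute)
    show "\<forall>k. coeff F k \<in> polys (Z - {z})"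
      using coeff_expansion_in_polys[OF \<tau>Z[OF f(1)], of z] by (auto simp: F_def)
    show "subst \<sigma>' (poly F (var z)) = const (inverse c) * subst \<sigma> f"
      by (simp add: F_def \<sigma>' subst_simps \<rho>\<tau>)
  qed
qed

lemma subst_poly:
  "subst \<sigma> (poly F x) = poly (map_poly (subst \<sigma>) F) (subst \<sigma> x)"
  by (induction F) (auto simp: map_poly_pCons subst_simps)

lemma subst_image_polys_insert:
  assumes "z \<in> Z"
  shows "subst \<sigma> ` polys Z = {poly G (\<sigma> z) | G. \<forall>k. coeff G k \<in> subst \<sigma> ` polys (Z - {z})}"
proof
  have Z: "insert z (Z - {z}) = Z" using assms by auto
  note polysZ = polys_insert_eq[of z "Z - {z}", unfolded Z, simplified]
  show "subst \<sigma> ` polys Z \<subseteq> {poly G (\<sigma> z) | G. \<forall>k. coeff G k \<in> subst \<sigma> ` polys (Z - {z})}"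
  proof
    fix x assume "x \<in> subst \<sigma> ` polys Z"
    then obtain G where G: "\<And>k. coeff G k \<in> polys (Z - {z})" "x = subst \<sigma> (poly G (var z))"
      unfolding polysZ by auto
    have "x = poly (map_poly (subst \<sigma>) G) (\<sigma> z)" by (simp add: G(2) subst_poly subst_simps)
    moreover have "coeff (map_poly (subst \<sigma>) G) k \<in> subst \<sigma> ` polys (Z - {z})" for k
      using G(1) by (simp add: coeff_map_poly)
    ultimately show "x \<in> {poly G (\<sigma> z) | G. \<forall>k. coeff G k \<in> subst \<sigma> ` polys (Z - {z})}" by blast
  qed
  show "{poly G (\<sigma> z) | G. \<forall>k. coeff G k \<in> subst \<sigma> ` polys (Z - {z})} \<subseteq> subst \<sigma> ` polys Z"
  proof
    fix x assume "x \<in> {poly G (\<sigma> z) | G. \<forall>k. coeff G k \<in> subst \<sigma> ` polys (Z - {z})}"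
    then obtain G where G: "\<And>k. coeff G k \<in> subst \<sigma> ` polys (Z - {z})" "x = poly G (\<sigma> z)" by blast
    have S: "ring_closed (subst \<sigma> ` polys Z)" by (rule ring_closed_subst_image)
    have "coeff G k \<in> subst \<sigma> ` polys Z" for k
      using G(1)[of k] polys_mono[of "Z - {z}" Z] by blast
    moreover have "\<sigma> z \<in> subst \<sigma> ` polys Z"
      using assms by (intro image_eqI[of _ _ "var z"]) (auto simp: subst_simps)
    ultimately show "x \<in> subst \<sigma> ` polys Z"
      unfolding G(2) poly_altdef by (intro ring_closed_sum[OF S] ring_closedD(4)[OF S] ring_closed_power[OF S]) auto
  qed
qed

text \<open>
  As long as the elements \<open>\<sigma> i\<close> satisfy an algebraic relation modulo \<open>P\<close>, a change of coordinates makes the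
  relation monic in one of them, which can then be dropped.
\<close>

theorem noether_normalization:
  fixes P :: "'k::field_char_0 mpoly set"
  assumes fin: "finite V" and P: "pprime V P"
  obtains Z \<sigma> E where "finite Z" "\<forall>i\<in>Z. \<sigma> i \<in> polys V"
    "\<forall>f\<in>polys Z. subst \<sigma> f \<in> P \<longrightarrow> f = 0" "generates_up_to (subst \<sigma> ` polys Z) E P 1 (polys V)"
proof -
  note ideal = pprime_pideal[OF P]
  define good where "good Z \<sigma> \<longleftrightarrow> finite Z \<and> (\<forall>i\<in>Z. \<sigma> i \<in> polys V) \<and>
      (\<exists>E. generates_up_to (subst \<sigma> ` polys Z) E P 1 (polys V))" for Z \<sigma>
  have step: "\<exists>Z' \<sigma>'. good Z' \<sigma>' \<and> card Z' < card Z"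
    if good: "good Z \<sigma>" and f: "f \<in> polys Z" "subst \<sigma> f \<in> P" "f \<noteq> 0" for Z \<sigma> f
  proof -
    note Z = good[unfolded good_def]
    have "Z \<noteq> {}"
    proof
      assume "Z = {}"
      then obtain c where c: "f = const c" using f(1) by (auto elim: polys_emptyE)
      then have "const (inverse c) * const c \<in> P"
        using f(2) by (intro pideal_mult[OF ideal]) (auto simp: subst_simps)
      moreover have "c \<noteq> 0" using f(3) c by auto
      ultimately have "1 \<in> P" by (simp add: const_inverse[of c] mult.commute)
      then show False using pprime_1[OF P] by blast
    qed
    then obtain z where z: "z \<in> Z" by blast
    obtain E where E: "generates_up_to (subst \<sigma> ` polys Z) E P 1 (polys V)" using Z by blast
    obtain \<sigma>' F c where \<sigma>': "\<forall>i\<in>Z. \<sigma>' i \<in> polys V" "subst \<sigma>' ` polys Z = subst \<sigma> ` polys Z"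
      "lead_coeff F = 1" "\<forall>k. coeff F k \<in> polys (Z - {z})" "subst \<sigma>' (poly F (var z)) = const c * subst \<sigma> f"
      by (rule exists_monic_coordinates[OF _ z f(1,3), of \<sigma> V]) (use Z in auto)
    let ?S = "subst \<sigma>' ` polys (Z - {z})" and ?G = "map_poly (subst \<sigma>') F"
    have S: "ring_closed ?S" "?S \<subseteq> polys V"
      using \<sigma>'(1) by (auto intro: ring_closed_subst_image subst_in_polys)
    have SZ: "?S \<subseteq> subst \<sigma>' ` polys Z" using polys_mono[of "Z - {z}" Z] by blast
    have coG: "coeff ?G k \<in> ?S" for k using \<sigma>'(4) by (simp add: coeff_map_poly subst_simps)
    have lcG: "lead_coeff ?G = 1"
    proof -
      have "coeff ?G (degree F) = 1" using \<sigma>'(3) by (simp add: coeff_map_poly subst_simps)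
      moreover from this have "degree F \<le> degree ?G" by (intro le_degree) simp
      moreover have "degree ?G \<le> degree F"
        by (rule degree_le) (auto simp: coeff_map_poly subst_simps coeff_eq_0)
      ultimately have "coeff ?G (degree F) = 1" "degree ?G = degree F" by simp_all
      then show ?thesis using \<open>coeff ?G (degree F) = 1\<close> by simp
    qed
    have "poly ?G (\<sigma>' z) = const c * subst \<sigma> f"
      using \<sigma>'(5) by (simp add: subst_poly subst_simps)
    also have "\<dots> \<in> P" using f(2) by (intro pideal_mult[OF ideal]) auto
    finally have "generates_up_to ?S ((\<lambda>i. \<sigma>' z ^ i) ` {..<degree ?G}) P (lead_coeff ?G)
        {poly G (\<sigma>' z) | G. \<forall>i. coeff G i \<in> ?S}"
      using S coG \<sigma>'(1) z by (intro generates_up_to_adjoin[where V = V] ideal) auto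
    then have "generates_up_to ?S ((\<lambda>i. \<sigma>' z ^ i) ` {..<degree ?G}) P 1 (subst \<sigma>' ` polys Z)"
      unfolding lcG subst_image_polys_insert[OF z, of \<sigma>'] .
    then have "generates_up_to ?S ((\<lambda>(e, f). e * f) ` (((\<lambda>i. \<sigma>' z ^ i) ` {..<degree ?G}) \<times> E)) P (1 * 1) (polys V)"
      using E S SZ \<sigma>'(1) unfolding \<sigma>'(2)[symmetric]
      by (intro generates_up_to_trans[where V = V and T = "subst \<sigma>' ` polys Z"] ring_closed_polys ideal)
         (auto intro: subst_in_polys ring_closedD(2))
    moreover have "card (Z - {z}) < card Z" using Z z by (meson card_Diff1_less)
    ultimately show ?thesis using Z \<sigma>'(1) by (intro exI[of _ "Z - {z}"] exI[of _ \<sigma>']) (auto simp: good_def)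
  qed
  have "\<exists>Z \<sigma>. good Z \<sigma> \<and> (\<forall>f\<in>polys Z. subst \<sigma> f \<in> P \<longrightarrow> f = 0)" if "good Z \<sigma>" for Z \<sigma>
    using that
  proof (induction "card Z" arbitrary: Z \<sigma> rule: less_induct)
    case less
    show ?case
    proof (cases "\<forall>f\<in>polys Z. subst \<sigma> f \<in> P \<longrightarrow> f = 0")
      case False
      then obtain f where "f \<in> polys Z" "subst \<sigma> f \<in> P" "f \<noteq> 0" by blast
      from step[OF less.prems this] obtain Z' \<sigma>' where Z': "good Z' \<sigma>'" "card Z' < card Z"
        by blast
      show ?thesis by (rule less.hyps[OF Z'(2,1)])
    qed (use less.prems in blast)
  qed
  moreover have "good V var"
  proof -
    have "generates_up_to (subst var ` polys V) {1} P 1 (subst var ` polys V)"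
      by (rule generates_up_to_refl) (auto simp: ring_closed_polys pideal_0[OF ideal])
    then show ?thesis using fin by (auto simp: good_def)
  qed
  ultimately obtain Z \<sigma> where "good Z \<sigma>" "\<forall>f\<in>polys Z. subst \<sigma> f \<in> P \<longrightarrow> f = 0" by blast
  then show ?thesis using that unfolding good_def by blast
qed



section \<open>Fractions with a conductor of codimension two are integral\<close>

lemma monic_division:
  fixes F A :: "'a::idom poly"
  assumes F: "lead_coeff F = 1"
  obtains q r where "A = F * q + r" "r = 0 \<or> degree r < degree F"
proof -
  have "F \<noteq> 0" using F by auto
  obtain q r where qr: "pseudo_divmod A F = (q, r)" by (cases "pseudo_divmod A F")
  show ?thesis
    using pseudo_divmod[OF \<open>F \<noteq> 0\<close> qr] F that[of q r] by simp
qed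

text \<open>
  The remainder \<open>r\<close> of \<open>a\<close> on division by the monic polynomial vanishes, because a multiple of \<open>r\<close> with a
  factor free of \<open>z\<close>, which leaves the degree in \<open>z\<close> unchanged, is divisible by the monic polynomial.
\<close>

lemma monic_dvd_of_free_multiple:
  assumes z: "z \<in> Z" and F: "lead_coeff F = 1" "\<forall>k. coeff F k \<in> polys (Z - {z})"
    and v: "v \<in> polys (Z - {z})" "v \<noteq> 0" and a: "a \<in> polys Z" and b: "b \<in> polys Z"
    and eq: "v ^ k * a = poly F (var z) ^ k * b"
  shows "\<exists>g\<in>polys Z. a = poly F (var z) ^ k * g"
proof -
  have expF: "expansion z (poly F (var z)) = F"
    using F(2) by (intro expansion_poly[of _ "Z - {z}"]) auto
  have FZ: "poly F (var z) \<in> polys Z"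
    using F(2) z polys_diff_singleton by (intro poly_in_polys) auto
  have expv: "expansion z (v ^ k) = [:v ^ k:]"
    using v(1) by (intro expansion_free[of _ "Z - {z}"]) auto
  have lc: "lead_coeff (F ^ k) = 1" using F(1) by (simp add: lead_coeff_power)
  then obtain q r where qr: "expansion z a = F ^ k * q + r" "r = 0 \<or> degree r < degree (F ^ k)"
    by (rule monic_division)
  have "r = 0"
  proof (rule ccontr)
    assume r: "r \<noteq> 0"
    have "smult (v ^ k) (expansion z a) = F ^ k * expansion z b"
      using arg_cong[OF eq, of "expansion z"] expv expF by simp
    then have "smult (v ^ k) r = F ^ k * (expansion z b - smult (v ^ k) q)"
      by (simp add: qr(1) algebra_simps smult_add_right)
    moreover have "smult (v ^ k) r \<noteq> 0" using r v(2) by simp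
    ultimately have "expansion z b - smult (v ^ k) q \<noteq> 0" "F ^ k \<noteq> 0" by auto
    then have "degree (F ^ k) \<le> degree (smult (v ^ k) r)"
      unfolding \<open>smult (v ^ k) r = _\<close> by (simp add: degree_mult_eq)
    then show False using qr(2) r v(2) by simp
  qed
  then have "poly (expansion z a) (var z) = poly (F ^ k * q) (var z)" using qr(1) by simp
  then have a_eq: "a = poly F (var z) ^ k * poly q (var z)" by (simp add: poly_power)
  \<comment> \<open>the quotient may involve variables outside \<open>Z\<close>, which can be set to \<open>0\<close>\<close>
  define \<pi> where "\<pi> = (\<lambda>i. if i \<in> Z then var i else (0 :: 'a mpoly))"
  have \<pi>: "subst \<pi> h = h" if "h \<in> polys Z" for h
  proof -
    have "subst \<pi> h = subst var h" using that by (intro subst_cong[of _ Z]) (auto simp: \<pi>_def)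
    then show ?thesis by simp
  qed
  have "subst \<pi> (poly q (var z)) \<in> polys Z"
    by (rule subst_in_polys[of _ UNIV]) (auto simp: \<pi>_def)
  moreover have "a = poly F (var z) ^ k * subst \<pi> (poly q (var z))"
    using arg_cong[OF a_eq, of "subst \<pi>"] \<pi>[OF a] \<pi>[OF FZ] by (simp add: subst_simps)
  ultimately show ?thesis by blast
qed

text \<open>
  \<open>E0\<close> is a maximal independent subset of \<open>E\<close>, and \<open>w\<close> is the product of the coefficients with which
  the other generators enter their relations over \<open>E0\<close>.
\<close>

lemma exists_free_submodule:
  assumes P: "pprime V P" and \<sigma>: "\<forall>i\<in>Z. \<sigma> i \<in> polys V"
    and inj: "\<forall>f\<in>polys Z. subst \<sigma> f \<in> P \<longrightarrow> f = 0"
    and gen: "generates_up_to (subst \<sigma> ` polys Z) E P 1 (polys V)"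
  obtains E0 w where "finite E0" "E0 \<subseteq> polys V" "w \<in> polys Z" "w \<noteq> 0"
    "\<forall>t. (\<forall>e\<in>E0. t e \<in> polys Z) \<longrightarrow> (\<Sum>e\<in>E0. subst \<sigma> (t e) * e) \<in> P \<longrightarrow> (\<forall>e\<in>E0. t e = 0)"
    "\<forall>x\<in>polys V. \<exists>t. (\<forall>e\<in>E0. t e \<in> polys Z) \<and> subst \<sigma> w * x - (\<Sum>e\<in>E0. subst \<sigma> (t e) * e) \<in> P"
proof -
  note ideal = pprime_pideal[OF P]
  let ?S = "subst \<sigma> ` polys Z"
  have S: "ring_closed ?S" "?S \<subseteq> polys V" using \<sigma> by (auto intro: ring_closed_subst_image subst_in_polys)
  have E: "finite E" "E \<subseteq> polys V" using gen by (auto simp: generates_up_to_def)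
  define free where "free E0 \<longleftrightarrow> (\<forall>t. (\<forall>e\<in>E0. t e \<in> polys Z) \<longrightarrow> (\<Sum>e\<in>E0. subst \<sigma> (t e) * e) \<in> P \<longrightarrow> (\<forall>e\<in>E0. t e = 0))" for E0
  let ?A = "{E0. E0 \<subseteq> E \<and> free E0}"
  have "finite ?A" using E(1) by (intro finite_subset[of ?A "Pow E"]) auto
  moreover have "{} \<in> ?A" by (auto simp: free_def)
  ultimately obtain E0 where E0: "E0 \<in> ?A" "\<forall>E1\<in>?A. E0 \<subseteq> E1 \<longrightarrow> E0 = E1"
    using finite_has_maximal[of ?A] by (metis (no_types, lifting) empty_iff)
  have sub: "E0 \<subseteq> E" and fr: "free E0" using E0(1) by auto
  have fin0: "finite E0" using sub E(1) by (rule finite_subset)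
  have dep: "\<exists>w. w \<in> polys Z \<and> w \<noteq> 0 \<and> (\<exists>h\<in>lin_comb ?S E0. subst \<sigma> w * e - h \<in> P)" if e: "e \<in> E" "e \<notin> E0" for e
  proof -
    have "\<not> free (insert e E0)" using E0(2) e sub by blast
    then obtain t where t: "\<forall>x\<in>insert e E0. t x \<in> polys Z" "(\<Sum>x\<in>insert e E0. subst \<sigma> (t x) * x) \<in> P"
      "\<exists>x\<in>insert e E0. t x \<noteq> 0" unfolding free_def by blast
    have split: "(\<Sum>x\<in>insert e E0. subst \<sigma> (t x) * x) = subst \<sigma> (t e) * e + (\<Sum>x\<in>E0. subst \<sigma> (t x) * x)"
      using e(2) fin0 by simp
    have "t e \<noteq> 0"
    proof
      assume "t e = 0"
      then have "(\<Sum>x\<in>E0. subst \<sigma> (t x) * x) \<in> P" using t(2) split by (simp add: subst_simps)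
      then show False using fr t(1,3) \<open>t e = 0\<close> unfolding free_def by auto
    qed
    moreover have "subst \<sigma> (t e) * e - (\<Sum>x\<in>E0. - subst \<sigma> (t x) * x) \<in> P"
      using t(2) unfolding split by (simp add: sum_negf)
    moreover have "(\<Sum>x\<in>E0. - subst \<sigma> (t x) * x) \<in> lin_comb ?S E0"
      using t(1) by (intro lin_combI ring_closedD(5)[OF S(1)]) auto
    ultimately show ?thesis using t(1) by blast
  qed
  have "\<exists>w. \<forall>e. e \<in> E - E0 \<longrightarrow> w e \<in> polys Z \<and> w e \<noteq> 0 \<and> (\<exists>h\<in>lin_comb ?S E0. subst \<sigma> (w e) * e - h \<in> P)"
    by (rule choice) (use dep in blast)
  then obtain w where w: "\<And>e. e \<in> E - E0 \<Longrightarrow> w e \<in> polys Z" "\<And>e. e \<in> E - E0 \<Longrightarrow> w e \<noteq> 0"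
    "\<And>e. e \<in> E - E0 \<Longrightarrow> \<exists>h\<in>lin_comb ?S E0. subst \<sigma> (w e) * e - h \<in> P" by blast
  define W where "W = (\<Prod>e\<in>E - E0. w e)"
  have WZ: "W \<in> polys Z" "W \<noteq> 0" using w E(1) unfolding W_def by (auto simp: prod_zero_iff)
  have gens: "\<exists>h\<in>lin_comb ?S E0. subst \<sigma> W * e - h \<in> P" if e: "e \<in> E" for e
  proof (cases "e \<in> E0")
    case True
    have "subst \<sigma> W * e \<in> lin_comb ?S E0" using True fin0 WZ by (intro lin_comb_base[OF S(1)]) auto
    then show ?thesis using pideal_0[OF ideal] by (intro bexI[of _ "subst \<sigma> W * e"]) auto
  next
    case False
    then obtain h where h: "h \<in> lin_comb ?S E0" "subst \<sigma> (w e) * e - h \<in> P" using w(3) e by blast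
    define r where "r = (\<Prod>e\<in>E - E0 - {e}. w e)"
    have r: "r \<in> polys Z" "W = r * w e"
      using w(1) e False E(1) unfolding r_def W_def by (auto simp: prod.remove mult.commute)
    have "subst \<sigma> r * (subst \<sigma> (w e) * e - h) \<in> P"
      using h(2) r(1) S(2) by (intro pideal_mult[OF ideal]) auto
    then have "subst \<sigma> W * e - subst \<sigma> r * h \<in> P" by (simp add: r(2) subst_simps algebra_simps)
    moreover have "subst \<sigma> r * h \<in> lin_comb ?S E0" using r(1) h(1) by (intro lin_comb_mult[OF S(1)]) auto
    ultimately show ?thesis by blast
  qed
  have gen0: "\<exists>t. (\<forall>e\<in>E0. t e \<in> polys Z) \<and> subst \<sigma> W * x - (\<Sum>e\<in>E0. subst \<sigma> (t e) * e) \<in> P" if x: "x \<in> polys V" for x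
  proof -
    obtain h where h: "h \<in> lin_comb ?S E" "x - h \<in> P" using gen x unfolding generates_up_to_def by auto
    obtain s where s: "\<And>e. e \<in> E \<Longrightarrow> s e \<in> ?S" "h = (\<Sum>e\<in>E. s e * e)" using h(1) unfolding lin_comb_def by blast
    have "\<exists>g. \<forall>e. e \<in> E \<longrightarrow> g e \<in> lin_comb ?S E0 \<and> subst \<sigma> W * e - g e \<in> P"
      by (rule choice) (use gens in blast)
    then obtain g where g: "\<And>e. e \<in> E \<Longrightarrow> g e \<in> lin_comb ?S E0" "\<And>e. e \<in> E \<Longrightarrow> subst \<sigma> W * e - g e \<in> P" by blast
    define G where "G = (\<Sum>e\<in>E. s e * g e)"
    have "G \<in> lin_comb ?S E0" unfolding G_def using s(1) g(1) by (intro lin_comb_sum[OF S(1)] lin_comb_mult[OF S(1)]) auto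
    then obtain c where c: "\<forall>e\<in>E0. c e \<in> ?S" "G = (\<Sum>e\<in>E0. c e * e)" unfolding lin_comb_def by blast
    have "\<exists>t. \<forall>e. e \<in> E0 \<longrightarrow> t e \<in> polys Z \<and> c e = subst \<sigma> (t e)"
      by (rule choice) (use c(1) in blast)
    then obtain t where t: "\<forall>e\<in>E0. t e \<in> polys Z" "\<And>e. e \<in> E0 \<Longrightarrow> c e = subst \<sigma> (t e)" by blast
    have Geq: "G = (\<Sum>e\<in>E0. subst \<sigma> (t e) * e)" unfolding c(2) using t(2) by (intro sum.cong) auto
    have WV: "subst \<sigma> W \<in> polys V" using WZ(1) S(2) by blast
    have "(\<Sum>e\<in>E. s e * (subst \<sigma> W * e - g e)) \<in> P"
    proof (rule pideal_sum[OF ideal])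
      fix e assume "e \<in> E"
      then show "s e * (subst \<sigma> W * e - g e) \<in> P" using s(1) S(2) g(2) by (blast intro: pideal_mult[OF ideal])
    qed
    then have "subst \<sigma> W * (x - h) + (\<Sum>e\<in>E. s e * (subst \<sigma> W * e - g e)) \<in> P"
      using pideal_mult[OF ideal WV h(2)] by (intro pideal_add[OF ideal])
    moreover have "(\<Sum>e\<in>E. s e * (subst \<sigma> W * e - g e)) = subst \<sigma> W * h - G"
      unfolding s(2) G_def sum_distrib_left sum_subtractf[symmetric] by (intro sum.cong) (auto simp: algebra_simps)
    ultimately have "subst \<sigma> W * (x - h) + (subst \<sigma> W * h - G) \<in> P" by simp
    then have "subst \<sigma> W * x - G \<in> P" by (simp add: algebra_simps)
    then show ?thesis using t(1) unfolding Geq by blast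
  qed
  show ?thesis
    by (rule that[OF fin0 _ WZ]) (use sub E(2) fr gen0 in \<open>auto simp: free_def\<close>)
qed

lemma pideal_lin_comb_sum:
  assumes P: "pideal V P" and h: "\<And>i. i \<le> (n::nat) \<Longrightarrow> h i \<in> polys V"
  shows "pideal V {p + (\<Sum>i\<le>n. a i * h i) | p a. p \<in> P \<and> (\<forall>i. a i \<in> polys V)}" (is "pideal V ?J")
proof (rule pidealI)
  show "?J \<subseteq> polys V" using pideal_subset[OF P] h by (auto intro!: polys_add polys_sum polys_mult)
  show "0 \<in> ?J"
    by (intro CollectI exI[of _ 0] exI[of _ "\<lambda>_. 0"]) (auto simp: pideal_0[OF P])
next
  fix f g assume "f \<in> ?J" "g \<in> ?J"
  then obtain p a q b where *: "f = p + (\<Sum>i\<le>n. a i * h i)" "g = q + (\<Sum>i\<le>n. b i * h i)"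
    "p \<in> P" "q \<in> P" "\<forall>i. a i \<in> polys V" "\<forall>i. b i \<in> polys V" by blast
  then have "f + g = (p + q) + (\<Sum>i\<le>n. (a i + b i) * h i)"
    by (simp add: algebra_simps sum.distrib)
  moreover have "p + q \<in> P" "\<forall>i. a i + b i \<in> polys V" using * by (auto intro: pideal_add[OF P])
  ultimately show "f + g \<in> ?J" by (intro CollectI exI[of _ "p + q"] exI[of _ "\<lambda>i. a i + b i"]) auto
next
  fix f g :: "'a mpoly" assume f: "f \<in> polys V" "g \<in> ?J"
  then obtain q b where *: "g = q + (\<Sum>i\<le>n. b i * h i)" "q \<in> P" "\<forall>i. b i \<in> polys V" by blast
  then have "f * g = f * q + (\<Sum>i\<le>n. (f * b i) * h i)"
    by (simp add: algebra_simps sum_distrib_left)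
  moreover have "f * q \<in> P" "\<forall>i. f * b i \<in> polys V" using * f by (auto intro: pideal_mult[OF P])
  ultimately show "f * g \<in> ?J" by (intro CollectI exI[of _ "f * q"] exI[of _ "\<lambda>i. f * b i"]) auto
qed

text \<open>
  Modulo \<open>Q\<close>, \<open>y = x\<^sub>j\<close> is a fraction over \<open>A = polys (V - {j})\<close>, and \<open>C\<close> multiplies it into \<open>A\<close>. Choose a
  Noether normalization \<open>S\<close> of \<open>A\<close>. By the bound on its dimension, \<open>C\<close> contains an element \<open>u\<close> of \<open>S\<close>, monic in
  one of the coordinates after a change of coordinates, and an element \<open>v \<noteq> 0\<close> of \<open>S\<close> without this
  coordinate. A nonzero multiple \<open>w A\<close> lies in a free submodule of \<open>A\<close>. Then so do \<open>w u\<^sup>k y\<^sup>k\<close> and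
  \<open>w v\<^sup>k y\<^sup>k\<close>, and, \<open>u\<close> and \<open>v\<close> being coprime, also \<open>w y\<^sup>k\<close>. So the \<open>A\<close>-modules
  generated by \<open>1, y, \<dots>, y\<^sup>k\<close> become ideals of \<open>A\<close> when multiplied with \<open>w\<close>, and the ascending chain
  condition turns some power of \<open>y\<close> into a combination of lower ones.
\<close>

theorem monic_of_conductor_codimension_two:
  fixes Q :: "'k::field_char_0 mpoly set"
  assumes fin: "finite V" and j: "j \<in> V" and Q: "pprime V Q" and C: "pideal (V - {j}) C"
    and conductor: "\<And>c. c \<in> C \<Longrightarrow> \<exists>r\<in>polys (V - {j}). c * var j + r \<in> Q"
    and dim: "idim (V - {j}) C + 2 \<le> idim (V - {j}) (Q \<inter> polys (V - {j}))"
  shows "\<exists>g\<in>Q. lead_coeff (expansion j g) = 1"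
proof -
  let ?V = "V - {j}" and ?y = "var j :: 'k mpoly"
  let ?P = "Q \<inter> polys ?V"
  note ideal = pprime_pideal[OF Q]
  have fin': "finite ?V" using fin by simp
  have P: "pprime ?V ?P" using Q by (rule pprime_restrict) auto
  note idealP = pprime_pideal[OF P]
  obtain Z \<sigma> E where N: "finite Z" "\<forall>i\<in>Z. \<sigma> i \<in> polys ?V"
    "\<forall>f\<in>polys Z. subst \<sigma> f \<in> ?P \<longrightarrow> f = 0" "generates_up_to (subst \<sigma> ` polys Z) E ?P 1 (polys ?V)"
    by (rule noether_normalization[OF fin' P])
  have cardZ: "idim ?V ?P \<le> card Z"
    by (rule idim_le_card_of_finite[OF fin' N(1) P _ N(4)]) (use N(2) in auto)
  have "\<not> (\<forall>f\<in>polys Z. subst \<sigma> f \<in> C \<longrightarrow> f = 0)"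
  proof
    assume "\<forall>f\<in>polys Z. subst \<sigma> f \<in> C \<longrightarrow> f = 0"
    then have "card Z \<le> idim ?V C"
      using N(2) by (intro card_algebraically_independent_le[OF fin' N(1) C, of \<sigma>]) auto
    then show False using cardZ dim by simp
  qed
  then obtain f where f: "f \<in> polys Z" "subst \<sigma> f \<in> C" "f \<noteq> 0" by blast
  have "Z \<noteq> {}" using cardZ dim by auto
  then obtain z where z: "z \<in> Z" by blast
  obtain \<sigma>' F c where \<sigma>': "\<forall>i\<in>Z. \<sigma>' i \<in> polys ?V" "subst \<sigma>' ` polys Z = subst \<sigma> ` polys Z"
    "\<forall>g\<in>polys Z. \<exists>g'\<in>polys Z. subst \<sigma>' g = subst \<sigma> g' \<and> (g' = 0 \<longrightarrow> g = 0)"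
    "lead_coeff F = 1" "\<forall>k. coeff F k \<in> polys (Z - {z})"
    "subst \<sigma>' (poly F (var z)) = const c * subst \<sigma> f"
    by (rule exists_monic_coordinates[OF N(1) z f(1,3), of \<sigma> ?V]) (use N(2) in auto)
  have inj: "\<forall>g\<in>polys Z. subst \<sigma>' g \<in> ?P \<longrightarrow> g = 0"
  proof (intro ballI impI)
    fix g assume g: "g \<in> polys Z" "subst \<sigma>' g \<in> ?P"
    then obtain g' where "g' \<in> polys Z" "subst \<sigma>' g = subst \<sigma> g'" "g' = 0 \<longrightarrow> g = 0"
      using \<sigma>'(3) by blast
    then show "g = 0" using N(3) g(2) by auto
  qed
  define u where "u = poly F (var z)"
  have uZ: "u \<in> polys Z" unfolding u_def
    using \<sigma>'(5) z polys_diff_singleton by (intro poly_in_polys) auto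
  have u0: "u \<noteq> 0"
  proof
    assume "u = 0"
    moreover have "expansion z u = F"
      unfolding u_def using \<sigma>'(5) by (intro expansion_poly[of _ "Z - {z}"]) auto
    ultimately show False using \<sigma>'(4) by simp
  qed
  have uC: "subst \<sigma>' u \<in> C" unfolding u_def \<sigma>'(6) using f(2) by (intro pideal_mult[OF C]) auto
  have "\<not> (\<forall>f\<in>polys (Z - {z}). subst \<sigma>' f \<in> C \<longrightarrow> f = 0)"
  proof
    assume "\<forall>f\<in>polys (Z - {z}). subst \<sigma>' f \<in> C \<longrightarrow> f = 0"
    then have "card (Z - {z}) \<le> idim ?V C"
      using N(1) \<sigma>'(1) by (intro card_algebraically_independent_le[OF fin' _ C, of _ \<sigma>']) auto
    then show False using cardZ dim z N(1) by simp
  qed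
  then obtain v where v: "v \<in> polys (Z - {z})" "subst \<sigma>' v \<in> C" "v \<noteq> 0" by blast
  have vZ: "v \<in> polys Z" using v(1) by (rule polys_diff_singleton)
  have SV: "subst \<sigma>' g \<in> polys ?V" "subst \<sigma>' g \<in> polys V" if "g \<in> polys Z" for g
    using that \<sigma>'(1) subst_in_polys[of g Z \<sigma>' ?V] polys_diff_singleton by auto
  obtain E0 w where E0: "finite E0" "E0 \<subseteq> polys ?V" "w \<in> polys Z" "w \<noteq> 0"
    "\<forall>t. (\<forall>e\<in>E0. t e \<in> polys Z) \<longrightarrow> (\<Sum>e\<in>E0. subst \<sigma>' (t e) * e) \<in> ?P \<longrightarrow> (\<forall>e\<in>E0. t e = 0)"
    "\<forall>x\<in>polys ?V. \<exists>t. (\<forall>e\<in>E0. t e \<in> polys Z) \<and> subst \<sigma>' w * x - (\<Sum>e\<in>E0. subst \<sigma>' (t e) * e) \<in> ?P"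
    by (rule exists_free_submodule[OF P \<sigma>'(1) inj, of E]) (use N(4) \<sigma>'(2) in auto)
  have yV: "?y \<in> polys V" using j by simp
  \<comment> \<open>modulo \<open>Q\<close>, the products of \<open>w\<close> with \<open>c\<^sup>k y\<^sup>k\<close> for \<open>c \<in> C\<close> lie in the free module\<close>
  have scaled: "\<exists>t. (\<forall>e\<in>E0. t e \<in> polys Z) \<and> subst \<sigma>' w * (subst \<sigma>' g ^ k * ?y ^ k) - (\<Sum>e\<in>E0. subst \<sigma>' (t e) * e) \<in> Q"
    if g: "g \<in> polys Z" "subst \<sigma>' g \<in> C" for g k
  proof -
    obtain r where r: "r \<in> polys ?V" "subst \<sigma>' g * ?y + r \<in> Q" using conductor[OF g(2)] by blast
    have rV: "r \<in> polys V" using r(1) by (rule polys_diff_singleton)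
    have "(subst \<sigma>' g * ?y) ^ k - (- r) ^ k \<in> Q"
      using SV(2)[OF g(1)] yV rV r(2) by (intro difference_of_powers_in_pideal[OF ideal]) auto
    then have "subst \<sigma>' w * ((subst \<sigma>' g * ?y) ^ k - (- r) ^ k) \<in> Q"
      using SV(2)[OF E0(3)] by (intro pideal_mult[OF ideal])
    moreover have "(- r) ^ k \<in> polys ?V" using r(1) by auto
    then obtain t where t: "\<forall>e\<in>E0. t e \<in> polys Z" "subst \<sigma>' w * (- r) ^ k - (\<Sum>e\<in>E0. subst \<sigma>' (t e) * e) \<in> ?P"
      using E0(6) by blast
    ultimately have "subst \<sigma>' w * ((subst \<sigma>' g * ?y) ^ k - (- r) ^ k) +
        (subst \<sigma>' w * (- r) ^ k - (\<Sum>e\<in>E0. subst \<sigma>' (t e) * e)) \<in> Q"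
      by (intro pideal_add[OF ideal]) auto
    then show ?thesis using t(1) by (auto simp: algebra_simps power_mult_distrib)
  qed
  have "\<exists>h\<in>polys ?V. subst \<sigma>' w * ?y ^ k - h \<in> Q" for k
  proof -
    obtain a where a: "\<forall>e\<in>E0. a e \<in> polys Z"
      "subst \<sigma>' w * (subst \<sigma>' u ^ k * ?y ^ k) - (\<Sum>e\<in>E0. subst \<sigma>' (a e) * e) \<in> Q"
      using scaled[OF uZ uC] by blast
    obtain b where b: "\<forall>e\<in>E0. b e \<in> polys Z"
      "subst \<sigma>' w * (subst \<sigma>' v ^ k * ?y ^ k) - (\<Sum>e\<in>E0. subst \<sigma>' (b e) * e) \<in> Q"
      using scaled[OF vZ v(2)] by blast
    let ?A = "\<Sum>e\<in>E0. subst \<sigma>' (a e) * e" and ?B = "\<Sum>e\<in>E0. subst \<sigma>' (b e) * e"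
    have "subst \<sigma>' u ^ k * (subst \<sigma>' w * (subst \<sigma>' v ^ k * ?y ^ k) - ?B) -
        subst \<sigma>' v ^ k * (subst \<sigma>' w * (subst \<sigma>' u ^ k * ?y ^ k) - ?A) \<in> Q"
      using SV(2)[OF uZ] SV(2)[OF vZ]
      by (intro pideal_diff[OF ideal] pideal_mult[OF ideal _ a(2)] pideal_mult[OF ideal _ b(2)]) auto
    then have "subst \<sigma>' v ^ k * ?A - subst \<sigma>' u ^ k * ?B \<in> Q" by (simp add: algebra_simps)
    moreover have "subst \<sigma>' v ^ k * ?A - subst \<sigma>' u ^ k * ?B = (\<Sum>e\<in>E0. subst \<sigma>' (v ^ k * a e - u ^ k * b e) * e)"
      unfolding sum_distrib_left sum_subtractf[symmetric] by (intro sum.cong) (auto simp: subst_simps algebra_simps)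
    moreover have "(\<Sum>e\<in>E0. subst \<sigma>' (v ^ k * a e - u ^ k * b e) * e) \<in> polys ?V"
      using a(1) b(1) uZ vZ E0(2) by (intro polys_sum polys_mult SV(1) polys_diff polys_power) auto
    ultimately have "(\<Sum>e\<in>E0. subst \<sigma>' (v ^ k * a e - u ^ k * b e) * e) \<in> ?P" by simp
    moreover have "\<forall>e\<in>E0. v ^ k * a e - u ^ k * b e \<in> polys Z" using a(1) b(1) uZ vZ by auto
    ultimately have zero: "\<forall>e\<in>E0. v ^ k * a e - u ^ k * b e = 0"
      using E0(5)[rule_format, of "\<lambda>e. v ^ k * a e - u ^ k * b e"] by blast
    have div: "\<exists>g. g \<in> polys Z \<and> a e = u ^ k * g" if e: "e \<in> E0" for e
    proof -
      have eq: "v ^ k * a e = poly F (var z) ^ k * b e" using zero e unfolding u_def[symmetric] by simp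
      have "\<exists>g\<in>polys Z. a e = poly F (var z) ^ k * g"
        by (rule monic_dvd_of_free_multiple[OF z \<sigma>'(4,5) v(1,3) _ _ eq]) (use a(1) b(1) e in auto)
      then show ?thesis unfolding u_def by blast
    qed
    have "\<exists>g. \<forall>e. e \<in> E0 \<longrightarrow> g e \<in> polys Z \<and> a e = u ^ k * g e"
      by (rule choice) (use div in blast)
    then obtain g where g: "\<And>e. e \<in> E0 \<Longrightarrow> g e \<in> polys Z" "\<And>e. e \<in> E0 \<Longrightarrow> a e = u ^ k * g e" by blast
    define h where "h = (\<Sum>e\<in>E0. subst \<sigma>' (g e) * e)"
    have hV: "h \<in> polys ?V" unfolding h_def using g(1) E0(2) by (intro polys_sum polys_mult SV(1)) auto
    have "?A = subst \<sigma>' u ^ k * h"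
      unfolding h_def sum_distrib_left by (intro sum.cong) (auto simp: g(2) subst_simps mult_ac)
    then have "subst \<sigma>' u ^ k * (subst \<sigma>' w * ?y ^ k - h) \<in> Q" using a(2) by (simp add: algebra_simps)
    moreover have "subst \<sigma>' u ^ k \<in> polys V" using SV(2)[OF uZ] by auto
    moreover have "subst \<sigma>' w * ?y ^ k - h \<in> polys V"
      using SV(2)[OF E0(3)] yV polys_diff_singleton[OF hV] by auto
    moreover have "subst \<sigma>' u \<notin> Q" using inj uZ u0 SV(1)[OF uZ] by blast
    then have "subst \<sigma>' u ^ k \<notin> Q" using pprime_power[OF Q SV(2)[OF uZ]] by blast
    ultimately have "subst \<sigma>' w * ?y ^ k - h \<in> Q" using pprime_mult[OF Q] by blast
    then show ?thesis using hV by blast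
  qed
  then have "\<exists>h. \<forall>k. h k \<in> polys ?V \<and> subst \<sigma>' w * ?y ^ k - h k \<in> Q" by (intro choice) blast
  then obtain h where h: "\<And>k. h k \<in> polys ?V" "\<And>k. subst \<sigma>' w * ?y ^ k - h k \<in> Q" by blast
  define J where "J n = {p + (\<Sum>i\<le>n. a i * h i) | p a. p \<in> ?P \<and> (\<forall>i. a i \<in> polys ?V)}" for n
  have hJ: "h n \<in> J n" for n
  proof -
    have "(\<Sum>i\<le>n. (if i = n then 1 else 0) * h i) = h n" by (simp add: if_distrib[of "\<lambda>x. x * _"] cong: if_cong)
    then show ?thesis unfolding J_def
      by (intro CollectI exI[of _ 0] exI[of _ "\<lambda>i. if i = n then 1 else 0"]) (auto simp: pideal_0[OF ideal])
  qed
  have J_mono: "J n \<subseteq> J (Suc n)" for n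
  proof
    fix x assume "x \<in> J n"
    then obtain p a where pa: "x = p + (\<Sum>i\<le>n. a i * h i)" "p \<in> ?P" "\<forall>i. a i \<in> polys ?V" unfolding J_def by blast
    have "(\<Sum>i\<le>Suc n. (if i \<le> n then a i else 0) * h i) = (\<Sum>i\<le>n. a i * h i)" by simp
    then show "x \<in> J (Suc n)" unfolding J_def
      using pa by (intro CollectI exI[of _ p] exI[of _ "\<lambda>i. if i \<le> n then a i else 0"]) auto
  qed
  have J_ideal: "pideal ?V (J n)" for n
    unfolding J_def using h(1) by (rule pideal_lin_comb_sum[OF idealP])
  have "\<exists>n. \<forall>m\<ge>n. J m = J n"
    by (rule pideal_chain_stabilizes[where J = J, OF fin' J_ideal J_mono])
  then obtain n where n: "\<forall>m\<ge>n. J m = J n" by blast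
  then have "J (Suc n) = J n" using le_SucI by blast
  then have "h (Suc n) \<in> J n" using hJ[of "Suc n"] by (simp only:)
  then obtain p a where pa: "h (Suc n) = p + (\<Sum>i\<le>n. a i * h i)" "p \<in> ?P" "\<forall>i. a i \<in> polys ?V"
    unfolding J_def by blast
  define G where "G = monom 1 (Suc n) - (\<Sum>i\<le>n. monom (a i) i)"
  define g where "g = poly G ?y"
  have aV: "a i \<in> polys V" for i using pa(3) polys_diff_singleton by blast
  have g_eq: "g = ?y ^ Suc n - (\<Sum>i\<le>n. a i * ?y ^ i)"
    unfolding g_def G_def by (simp add: poly_monom poly_sum)
  have "(subst \<sigma>' w * ?y ^ Suc n - h (Suc n)) - (\<Sum>i\<le>n. a i * (subst \<sigma>' w * ?y ^ i - h i)) + p \<in> Q"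
  proof (rule pideal_add[OF ideal pideal_diff[OF ideal h(2) pideal_sum[OF ideal]]])
    show "a i * (subst \<sigma>' w * ?y ^ i - h i) \<in> Q" for i by (rule pideal_mult[OF ideal aV h(2)])
    show "p \<in> Q" using pa(2) by blast
  qed
  moreover have "(\<Sum>i\<le>n. a i * (subst \<sigma>' w * ?y ^ i - h i)) = subst \<sigma>' w * (\<Sum>i\<le>n. a i * ?y ^ i) - (\<Sum>i\<le>n. a i * h i)"
    unfolding sum_distrib_left sum_subtractf[symmetric] by (intro sum.cong) (auto simp: algebra_simps)
  ultimately have "subst \<sigma>' w * g \<in> Q" unfolding g_eq pa(1) by (simp add: algebra_simps)
  moreover have "g \<in> polys V" unfolding g_eq using aV yV by (intro polys_diff polys_sum polys_mult polys_power) auto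
  moreover have "subst \<sigma>' w \<notin> Q" using inj E0(3,4) SV(1)[OF E0(3)] by blast
  ultimately have "g \<in> Q" using pprime_mult[OF Q] SV(2)[OF E0(3)] by blast
  moreover have "coeff G k \<in> polys ?V" for k unfolding G_def using pa(3) by (auto simp: coeff_sum)
  then have "expansion j g = G" unfolding g_def by (rule expansion_poly) simp
  moreover have G1: "coeff G (Suc n) = 1" by (simp add: G_def coeff_sum)
  moreover have "degree G = Suc n"
  proof (rule antisym)
    show "Suc n \<le> degree G" using G1 by (intro le_degree) simp
    show "degree G \<le> Suc n"
      unfolding G_def by (intro degree_diff_le degree_monom_le degree_sum_le) (auto intro: order.trans[OF degree_monom_le])
  qed
  ultimately have "g \<in> Q" "lead_coeff (expansion j g) = 1" by simp_all
  then show ?thesis by blast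
qed



section \<open>Geometric vertex decompositions\<close>

subsection \<open>Coefficient ideals determine the decomposition\<close>

lemma poly_degree_0: "degree F = 0 \<Longrightarrow> poly F x = coeff F 0"
  by (auto elim: degree_eq_zeroE)

lemma mem_pideal_if_coeffs:
  assumes J: "pideal V J" and j: "j \<in> V" and co: "\<And>k. coeff (expansion j f) k \<in> J"
  shows "f \<in> J"
proof -
  have "poly (expansion j f) (var j) \<in> J"
    unfolding poly_altdef using j by (intro pideal_sum[OF J] pideal_mult2[OF J _ co]) auto
  then show ?thesis by simp
qed

lemma genideal_eq_extend_ideal:
  assumes S: "S \<subseteq> polys (V - {j})" and j: "j \<in> V"
  shows "genideal (mpoly_ring V) S = extend_ideal V j (contraction V j (genideal (mpoly_ring V) S))"
    "pideal (V - {j}) (contraction V j (genideal (mpoly_ring V) S))"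
proof -
  let ?J = "genideal (mpoly_ring V) S"
  let ?J' = "contraction V j ?J"
  have SV: "S \<subseteq> polys V" using S polys_diff_singleton by blast
  have J: "pideal V ?J" using SV by (rule pideal_genideal)
  show J': "pideal (V - {j}) ?J'"
    unfolding contraction_def using J by (rule pideal_restrict) auto
  have "S \<subseteq> ?J'" using genideal_subset[OF SV] S by (auto simp: contraction_def)
  then have "S \<subseteq> extend_ideal V j ?J'" using extend_ideal_base[OF J'] by blast
  then have "?J \<subseteq> extend_ideal V j ?J'"
    by (intro genideal_least pideal_extend_ideal J')
  moreover have "extend_ideal V j ?J' \<subseteq> ?J"
    using mem_pideal_if_coeffs[OF J j] by (auto simp: extend_ideal_def contraction_def)
  ultimately show "?J = extend_ideal V j ?J'" by blast
qed

lemma coeff_ideal_extend_ideal: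
  assumes j: "j \<in> V" and J: "pideal (V - {j}) J"
  shows "coeff_ideal j k (extend_ideal V j J) = J"
proof
  show "coeff_ideal j k (extend_ideal V j J) \<subseteq> J"
    by (auto simp: coeff_ideal_def extend_ideal_def)
  show "J \<subseteq> coeff_ideal j k (extend_ideal V j J)"
  proof
    fix a assume a: "a \<in> J"
    then have aV: "a \<in> polys (V - {j})" using pideal_subset[OF J] by blast
    have exp: "expansion j (a * var j ^ k) = monom a k"
      by (simp add: expansion_free[OF aV] monom_altdef)
    have "a * var j ^ k \<in> polys V" using polys_diff_singleton[OF aV] j by auto
    then have "a * var j ^ k \<in> extend_ideal V j J"
      using a pideal_0[OF J] unfolding extend_ideal_def exp mem_Collect_eq by simp
    then show "a \<in> coeff_ideal j k (extend_ideal V j J)"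
      unfolding coeff_ideal_def
      by (intro CollectI exI[of _ "a * var j ^ k"]) (simp only: exp, simp add: degree_monom_le)
  qed
qed

lemma expansion_initial_form:
  assumes "f \<noteq> 0"
  shows "expansion j (initial_form j f) = monom (lead_coeff (expansion j f)) (degree (expansion j f))"
proof -
  have "lead_coeff (expansion j f) \<in> polys (UNIV - {j})"
    by (rule coeff_expansion_in_polys) simp
  then have "expansion j (lead_coeff (expansion j f)) = [:lead_coeff (expansion j f):]"
    by (rule expansion_free) simp
  then show ?thesis
    using assms by (simp add: initial_form_def lead_coeff_in_eq deg_in_eq_degree monom_altdef)
qed

lemma initial_form_in_polys:
  assumes "f \<in> polys V" "j \<in> V"
  shows "initial_form j f \<in> polys V"
proof (cases "f = 0")
  case True
  then show ?thesis by (simp add: initial_form_def)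
next
  case False
  have "poly (expansion j (initial_form j f)) (var j) \<in> polys V"
    unfolding expansion_initial_form[OF False]
    using coeff_expansion_in_polys[OF assms(1), of j] assms(2) polys_diff_singleton
    by (intro poly_in_polys) (auto simp: coeff_monom)
  then show ?thesis by simp
qed

text \<open>
  The \<open>x\<^sub>j\<close>-initial ideal is graded by the exponent of \<open>x\<^sub>j\<close>, with the coefficient ideals as
  its components. Intersecting with \<open>N + \<langle>x\<^sub>j\<rangle>\<close> changes only the component of exponent \<open>0\<close>.
\<close>

theorem coeff_ideals_of_decomposition:
  assumes gvd: "geometric_vertex_decomposition V j r G I"
  shows "coeff_ideal j 0 I = contraction V j (N_ideal V j G)"
    "coeff_ideal j (Suc k) I = contraction V j (C_ideal V j G)"
    "N_ideal V j G = extend_ideal V j (contraction V j (N_ideal V j G))"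
    "C_ideal V j G = extend_ideal V j (contraction V j (C_ideal V j G))"
proof -
  let ?C = "C_ideal V j G" and ?N = "N_ideal V j G" and ?In = "initial_form_ideal V j I"
  let ?C' = "contraction V j ?C" and ?N' = "contraction V j ?N"
  have j: "j \<in> V" and I: "pideal V I" and G: "G \<subseteq> I - {0}"
    and eq: "?In = ?C \<inter> (?N <+>\<^bsub>mpoly_ring V\<^esub> genideal (mpoly_ring V) {var j})"
    using gvd by (auto simp: geometric_vertex_decomposition_def groebner_basis_def)
  have lcV: "lead_coeff_in j g \<in> polys (V - {j})" if "g \<in> G" for g
  proof -
    have "g \<noteq> 0" "g \<in> polys V" using that G pideal_subset[OF I] by auto
    then show ?thesis using coeff_expansion_in_polys[of g V j] by (simp add: lead_coeff_in_eq)
  qed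
  show N: "?N = extend_ideal V j ?N'"
    unfolding N_ideal_def by (rule genideal_eq_extend_ideal) (use lcV j in auto)
  show C: "?C = extend_ideal V j ?C'"
    unfolding C_ideal_def by (rule genideal_eq_extend_ideal) (use lcV j in auto)
  have N': "pideal (V - {j}) ?N'"
    unfolding N_ideal_def by (rule genideal_eq_extend_ideal) (use lcV j in auto)
  have C': "pideal (V - {j}) ?C'"
    unfolding C_ideal_def by (rule genideal_eq_extend_ideal) (use lcV j in auto)
  define T where "T = {f \<in> polys V. \<forall>k. coeff (expansion j f) k \<in> coeff_ideal j k I}"
  note L = pideal_coeff_ideal[OF I, of j]
  have T: "pideal V T"
  proof (rule pidealI)
    fix f g :: "'a mpoly" assume fg: "f \<in> polys V" "g \<in> T"
    have "coeff (expansion j (f * g)) k \<in> coeff_ideal j k I" for k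
    proof -
      have "coeff (expansion j f) i * coeff (expansion j g) (k - i) \<in> coeff_ideal j k I" if "i \<le> k" for i
        using fg(2) coeff_ideal_le[OF I j, of "k - i" k] coeff_expansion_in_polys[OF fg(1), of j i]
        by (intro pideal_mult[OF L]) (auto simp: T_def)
      then show ?thesis by (auto simp: coeff_mult intro!: pideal_sum[OF L])
    qed
    then show "f * g \<in> T" using fg by (auto simp: T_def)
  qed (auto simp: T_def pideal_0[OF L] intro: pideal_add[OF L])
  have inV: "initial_form j ` I \<subseteq> polys V"
    using pideal_subset[OF I] initial_form_in_polys[OF _ j] by blast
  have "initial_form j ` I \<subseteq> T"
  proof
    fix x assume "x \<in> initial_form j ` I"
    then obtain f where f: "f \<in> I" "x = initial_form j f" by blast
    show "x \<in> T"
    proof (cases "f = 0")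
      case True
      then show ?thesis using f pideal_0[OF T] by (simp add: initial_form_def)
    next
      case False
      then show ?thesis
        using f inV lead_coeff_in_coeff_ideal[OF f(1) refl, of j] pideal_0[OF L]
        by (auto simp: T_def expansion_initial_form)
    qed
  qed
  then have In_T: "?In \<subseteq> T" unfolding initial_form_ideal_def by (intro genideal_least T)
  have L_In: "a * var j ^ k \<in> ?In" if a: "a \<in> coeff_ideal j k I" for a k
  proof (cases "a = 0")
    case True
    then show ?thesis using pideal_0[OF pideal_genideal[OF inV]] by (simp add: initial_form_ideal_def)
  next
    case False
    obtain f where f: "f \<in> I" "degree (expansion j f) \<le> k" "a = coeff (expansion j f) k"
      using a by (auto simp: coeff_ideal_def)
    then have deg: "degree (expansion j f) = k" using False le_degree[of "expansion j f" k] by simp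
    then have "f \<noteq> 0" using False f(3) by auto
    then have "initial_form j f = a * var j ^ k"
      using f(3) deg by (simp add: initial_form_def lead_coeff_in_eq deg_in_eq_degree)
    then show ?thesis
      using f(1) genideal_subset[OF inV] unfolding initial_form_ideal_def by (metis image_eqI subsetD)
  qed
  have exp: "expansion j (a * var j ^ k) = monom a k" if "a \<in> polys (V - {j})" for a k
    using that by (simp add: expansion_free[of a "V - {j}"] monom_altdef)
  have LV: "coeff_ideal j k I \<subseteq> polys (V - {j})" for k by (rule pideal_subset[OF L])
  have L_C: "coeff_ideal j k I \<subseteq> ?C'" for k
  proof
    fix a assume a: "a \<in> coeff_ideal j k I"
    then have "a * var j ^ k \<in> extend_ideal V j ?C'" using L_In eq C by auto
    then have "coeff (expansion j (a * var j ^ k)) k \<in> ?C'" by (simp add: extend_ideal_def)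
    moreover have "a \<in> polys (V - {j})" using a LV by blast
    ultimately show "a \<in> ?C'" by (simp only: exp coeff_monom if_True simp_thms)
  qed
  have yideal: "pideal V (genideal (mpoly_ring V) {var j})" using j by (intro pideal_genideal) auto
  have sumI: "h \<in> ?N <+>\<^bsub>mpoly_ring V\<^esub> genideal (mpoly_ring V) {var j}" if "h \<in> genideal (mpoly_ring V) {var j}" for h
  proof -
    have "0 \<in> ?N" using N pideal_0[OF pideal_extend_ideal[OF N']] by simp
    then show ?thesis using that by (force simp: set_add_def' intro!: exI[of _ 0])
  qed
  have CV: "pideal V ?C"
    unfolding C_ideal_def using lcV polys_diff_singleton by (intro pideal_genideal) blast
  have C_L: "?C' \<subseteq> coeff_ideal j 1 I"
  proof
    fix a assume a: "a \<in> ?C'"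
    have aV: "a \<in> polys (V - {j})" using a by (simp add: contraction_def)
    have "a * var j \<in> ?C"
      by (rule pideal_mult2[OF CV]) (use a j in \<open>auto simp: contraction_def\<close>)
    moreover have "a * var j \<in> genideal (mpoly_ring V) {var j}"
      using aV j genideal_subset[of "{var j}" V] by (intro pideal_mult[OF yideal]) (auto intro: polys_diff_singleton)
    ultimately have "a * var j ^ 1 \<in> ?In" using sumI eq by simp
    then have "coeff (expansion j (a * var j ^ 1)) 1 \<in> coeff_ideal j 1 I" using In_T unfolding T_def by blast
    then show "a \<in> coeff_ideal j 1 I" unfolding exp[OF aV] by simp
  qed
  show "coeff_ideal j (Suc k) I = ?C'"
    using L_C[of "Suc k"] C_L coeff_ideal_le[OF I j, of 1 "Suc k"] by auto
  have L0: "coeff_ideal j 0 I = I \<inter> polys (V - {j})"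
  proof
    show "coeff_ideal j 0 I \<subseteq> I \<inter> polys (V - {j})"
    proof
      fix a assume a: "a \<in> coeff_ideal j 0 I"
      then obtain f where f: "f \<in> I" "degree (expansion j f) = 0" "a = coeff (expansion j f) 0"
        by (auto simp: coeff_ideal_def)
      then have "poly (expansion j f) (var j) = a" by (simp only: poly_degree_0)
      then show "a \<in> I \<inter> polys (V - {j})" using f(1) a LV by auto
    qed
    show "I \<inter> polys (V - {j}) \<subseteq> coeff_ideal j 0 I"
      using expansion_free[of _ "V - {j}" j] by (force simp: coeff_ideal_def)
  qed
  show "coeff_ideal j 0 I = ?N'"
  proof
    show "coeff_ideal j 0 I \<subseteq> ?N'"
    proof
      fix a assume a: "a \<in> coeff_ideal j 0 I"
      have aV: "a \<in> polys (V - {j})" using a LV by blast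
      have "a \<in> ?N <+>\<^bsub>mpoly_ring V\<^esub> genideal (mpoly_ring V) {var j}"
        using L_In[OF a] eq by simp
      then obtain n h where nh: "a = n + h" "n \<in> ?N" "h \<in> genideal (mpoly_ring V) {var j}"
        by (auto simp: set_add_def')
      have "pideal V {f \<in> polys V. coeff (expansion j f) 0 = 0}"
        by (rule pidealI) (auto simp: coeff_mult)
      then have "genideal (mpoly_ring V) {var j} \<subseteq> {f \<in> polys V. coeff (expansion j f) 0 = 0}"
        using j by (intro genideal_least) auto
      then have "coeff (expansion j a) 0 = coeff (expansion j n) 0" using nh(1,3) by auto
      also have "coeff (expansion j a) 0 = a" using aV by (simp add: expansion_free[of a "V - {j}"])
      finally have "a \<in> ?N'" using nh(2) N by (auto simp: extend_ideal_def)
      then show "a \<in> ?N'" .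
    qed
    have "lead_coeff_in j ` {g \<in> G. deg_in j g = 0} \<subseteq> I"
    proof
      fix x assume "x \<in> lead_coeff_in j ` {g \<in> G. deg_in j g = 0}"
      then obtain g where g: "g \<in> G" "deg_in j g = 0" "x = lead_coeff_in j g" by blast
      then have "g \<noteq> 0" "g \<in> I" using G by auto
      then have "degree (expansion j g) = 0" "x = lead_coeff (expansion j g)"
        using g by (auto simp: deg_in_eq_degree lead_coeff_in_eq)
      then have "x = poly (expansion j g) (var j)" by (simp only: poly_degree_0)
      then show "x \<in> I" using \<open>g \<in> I\<close> by simp
    qed
    then have "?N \<subseteq> I" unfolding N_ideal_def by (intro genideal_least I)
    then show "?N' \<subseteq> coeff_ideal j 0 I" unfolding L0 by (auto simp: contraction_def)
  qed
qed

subsection \<open>Dimensions\<close>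

definition radical_ideal :: "nat set \<Rightarrow> 'k::field mpoly set \<Rightarrow> bool" where
  "radical_ideal V I \<longleftrightarrow> (\<forall>f\<in>polys V. \<forall>n. f ^ n \<in> I \<longrightarrow> f \<in> I)"

text \<open>
  A geometric vertex decomposition in terms of coefficient ideals; \<open>C\<close> and \<open>N\<close> live in the ring without \<open>x\<^sub>j\<close>.
\<close>

locale vertex_split =
  fixes V :: "nat set" and j :: nat and I C N :: "'k::field_char_0 mpoly set"
  assumes fin: "finite V" and j: "j \<in> V" and I: "pideal V I"
    and coeff_0: "coeff_ideal j 0 I = N"
    and coeff_Suc: "\<And>k. coeff_ideal j (Suc k) I = C"
begin

abbreviation "V' \<equiv> V - {j}"

lemma fin': "finite V'" using fin by simp

lemma N: "pideal V' N" using pideal_coeff_ideal[OF I, of j 0] coeff_0 by simp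

lemma C: "pideal V' C" using pideal_coeff_ideal[OF I, of j 1] coeff_Suc[of 0] by simp

lemma N_subset_C: "N \<subseteq> C" using coeff_ideal_Suc[OF I j, of 0] coeff_0 coeff_Suc by simp

lemma N_eq: "N = I \<inter> polys V'"
proof
  show "N \<subseteq> I \<inter> polys V'"
  proof
    fix a assume a: "a \<in> N"
    then obtain f where f: "f \<in> I" "degree (expansion j f) = 0" "a = coeff (expansion j f) 0"
      unfolding coeff_0[symmetric] by (auto simp: coeff_ideal_def)
    then have "poly (expansion j f) (var j) = a" by (simp only: poly_degree_0)
    then show "a \<in> I \<inter> polys V'" using f(1) a pideal_subset[OF N] by auto
  qed
  show "I \<inter> polys V' \<subseteq> N"
    unfolding coeff_0[symmetric] using expansion_free[of _ V' j] by (force simp: coeff_ideal_def)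
qed

lemma conductor:
  assumes "c \<in> C"
  obtains r where "r \<in> polys V'" "c * var j + r \<in> I"
proof -
  obtain f where f: "f \<in> I" "degree (expansion j f) \<le> 1" "c = coeff (expansion j f) 1"
    using assms unfolding coeff_Suc[of 0, symmetric] by (auto simp: coeff_ideal_def)
  have "expansion j f = [:coeff (expansion j f) 0, coeff (expansion j f) 1:]"
    using f(2) by (intro poly_eqI) (auto simp: coeff_pCons coeff_eq_0 split: nat.splits)
  then have "poly (expansion j f) (var j) = c * var j + coeff (expansion j f) 0"
    unfolding f(3) by (metis (no_types) poly_pCons poly_0 mult_zero_right add_0_right add.commute mult.commute)
  then have "c * var j + coeff (expansion j f) 0 \<in> I" using f(1) by simp
  moreover have "coeff (expansion j f) 0 \<in> polys V'"
    using f(1) pideal_subset[OF I] coeff_expansion_in_polys by blast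
  ultimately show ?thesis using that by blast
qed

lemma idim_N_le: "idim V' N \<le> idim V I"
  unfolding N_eq using pideal_subset[OF I] by (intro idim_contract_le fin) auto

lemma unmixed_idim:
  assumes "unmixed V I" "Q \<in> associated_primes V I"
  shows "idim V Q = idim V I"
  using assms krull_dim_eq_idim[OF fin I] krull_dim_eq_idim[OF fin pprime_pideal[OF associated_prime_pprime[OF assms(2)]]]
  unfolding unmixed_def by (metis enat.inject)

text \<open>
  Some associated prime of \<open>I\<close> avoids the powers of \<open>c\<close>, because no power of \<open>c\<close> lies in \<open>N = I \<inter> polys V'\<close>. Modulo it
  \<open>x\<^sub>j\<close> is a fraction with denominator \<open>c\<close>.
\<close>

lemma idim_le_N:
  assumes um: "unmixed V I" and c: "c \<in> C" "\<And>n. c ^ n \<notin> N"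
  shows "idim V I \<le> idim V' N"
proof -
  have cV': "c \<in> polys V'" using c(1) pideal_subset[OF C] by blast
  then have cV: "c \<in> polys V" by (rule polys_diff_singleton)
  have "range (\<lambda>n. c ^ n) \<inter> I = {}"
    using c(2) cV' N_eq by (auto intro: polys_power)
  then have "\<exists>Q\<in>associated_primes V I. Q \<inter> range (\<lambda>n. c ^ n) = {}"
  proof (intro associated_prime_avoiding[OF fin I])
    show "1 \<in> range (\<lambda>n. c ^ n)" by (rule range_eqI[of _ _ 0]) simp
    show "s * t \<in> range (\<lambda>n. c ^ n)" if "s \<in> range (\<lambda>n. c ^ n)" "t \<in> range (\<lambda>n. c ^ n)" for s t
      using that by (auto simp flip: power_add)
  qed (use cV in auto)
  then obtain Q where Q: "Q \<in> associated_primes V I" "Q \<inter> range (\<lambda>n. c ^ n) = {}" by blast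
  have prime: "pprime V Q" using Q(1) by (rule associated_prime_pprime)
  have IQ: "I \<subseteq> Q" using Q(1) I by (rule associated_prime_contains)
  have "c \<notin> Q" using Q(2) rangeI[of "\<lambda>n. c ^ n" 1] by auto
  obtain r where r: "r \<in> polys V'" "c * var j + r \<in> I" by (rule conductor[OF c(1)])
  have "idim V I = idim V Q" using unmixed_idim[OF um Q(1)] by simp
  also have "\<dots> = idim V' (Q \<inter> polys V')"
    using idim_contract_birational[OF fin j prime cV' \<open>c \<notin> Q\<close> r(1)] r(2) IQ by auto
  also have "\<dots> \<le> idim V' N" using IQ unfolding N_eq by (intro idim_antimono fin') auto
  finally show ?thesis .
qed

text \<open>
  A component \<open>P\<close> of \<open>C\<close> of the dimension of \<open>N\<close> is a component of \<open>N\<close> as well. As \<open>N\<close> is radical, some \<open>p \<notin> P\<close>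
  has \<open>p P \<subseteq> N\<close>; hence \<open>c x\<^sub>j + r \<in> I\<close> with \<open>c \<in> C\<close> implies \<open>p r \<in> N\<close> and \<open>r \<in> P\<close>. So all of \<open>I\<close>
  vanishes on the cylinder over the component.
\<close>

lemma Suc_idim_C_le:
  assumes proper: "1 \<notin> C" and rad: "radical_ideal V' N"
  shows "Suc (idim V' C) \<le> idim V I"
proof (cases "idim V' C < idim V' N")
  case True
  then show ?thesis using idim_N_le by simp
next
  case False
  obtain W where W: "W \<subseteq> V'" "indep_mod C W" "card W = idim V' C"
    using idim_attained[OF fin' C proper] by blast
  obtain P where P: "pprime V' P" "C \<subseteq> P" "indep_mod P W"
    by (rule prime_containing_indep[OF fin' C W(1,2)])
  have PV: "P \<subseteq> polys V'" using P(1) pprime_pideal pideal_subset by blast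
  have dimP: "idim V' N \<le> idim V' P"
    using card_le_idim[OF fin' W(1) P(3)] W(3) False by simp
  have "\<exists>P1\<in>associated_primes V' N. P1 \<inter> (polys V' - P) = {}"
  proof (rule associated_prime_avoiding[OF fin' N])
    show "1 \<in> polys V' - P" using pprime_1[OF P(1)] by auto
    show "s * t \<in> polys V' - P" if "s \<in> polys V' - P" "t \<in> polys V' - P" for s t
      using that pprime_mult[OF P(1)] by auto
    show "(polys V' - P) \<inter> N = {}" using N_subset_C P(2) by blast
  qed auto
  then obtain P1 where P1: "P1 \<in> associated_primes V' N" "P1 \<inter> (polys V' - P) = {}" by blast
  have prime1: "pprime V' P1" using P1(1) by (rule associated_prime_pprime)
  have "P1 \<subseteq> P" using P1(2) pideal_subset[OF pprime_pideal[OF prime1]] by blast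
  moreover have "\<not> P1 \<subset> P"
  proof
    assume "P1 \<subset> P"
    then have "idim V' P < idim V' P1" by (rule idim_strict_antimono[OF fin' prime1 P(1)])
    moreover have "idim V' P1 \<le> idim V' N"
      using associated_prime_contains[OF P1(1) N] by (rule idim_antimono[OF fin'])
    ultimately show False using dimP by simp
  qed
  ultimately have "P \<in> associated_primes V' N" using P1(1) by blast
  then obtain p where p: "p \<in> polys V'" "P = {r \<in> polys V'. r * p \<in> N}"
    unfolding associated_primes_def by blast
  have pP: "p \<notin> P"
  proof
    assume "p \<in> P"
    then have "p ^ 2 \<in> N" using p(2) by (simp add: power2_eq_square)
    then have "p \<in> N" using rad p(1) unfolding radical_ideal_def by blast
    then have "1 \<in> P" unfolding p(2) by auto
    then show False using pprime_1[OF P(1)] by blast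
  qed
  have rP: "r \<in> P" if c: "c \<in> C" and r: "r \<in> polys V'" "c * var j + r \<in> I" for c r
  proof -
    have "c * p \<in> N" using c P(2) p(2) by blast
    then have "c * p \<in> I" using N_eq by blast
    then have "var j * (c * p) \<in> I" using j by (blast intro: pideal_mult[OF I])
    moreover have "p * (c * var j + r) \<in> I" by (rule pideal_mult[OF I polys_diff_singleton[OF p(1)] r(2)])
    ultimately have "p * (c * var j + r) - var j * (c * p) \<in> I" using pideal_diff[OF I] by blast
    then have "p * r \<in> I" by (simp add: algebra_simps)
    then have "p * r \<in> N" using N_eq p(1) r(1) by blast
    then have "p * r \<in> P" using N_subset_C P(2) by blast
    then show ?thesis using pprime_mult[OF P(1)] p(1) r(1) pP by blast
  qed
  have ext: "pideal V (extend_ideal V j P)" by (rule pideal_extend_ideal[OF pprime_pideal[OF P(1)]])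
  have base: "a \<in> P \<Longrightarrow> a \<in> extend_ideal V j P" for a by (rule extend_ideal_base[OF pprime_pideal[OF P(1)]])
  have "f \<in> extend_ideal V j P" if "f \<in> I" for f
    using that
  proof (induction "degree (expansion j f)" arbitrary: f rule: less_induct)
    case less
    let ?k = "degree (expansion j f)"
    show ?case
    proof (cases ?k)
      case 0
      then obtain a where a: "expansion j f = [:a:]" by (rule degree_eq_zeroE)
      then have "f = a" using poly_expansion[of j f] by simp
      moreover have "a \<in> coeff_ideal j 0 I" using coeff_idealI[OF less.prems, of j 0] a by simp
      ultimately show ?thesis using coeff_0 N_subset_C P(2) base by blast
    next
      case (Suc m)
      define c where "c = lead_coeff (expansion j f)"
      have c: "c \<in> C" using lead_coeff_in_coeff_ideal[OF less.prems refl, of j] coeff_Suc[of m] Suc by (simp add: c_def)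
      obtain r where r: "r \<in> polys V'" "c * var j + r \<in> I" by (rule conductor[OF c])
      \<comment> \<open>\<open>h\<close> cancels the leading term of \<open>f\<close>\<close>
      define h where "h = var j ^ m * (c * var j + r)"
      have cV: "c \<in> polys V'" using c pideal_subset[OF C] by blast
      have eh: "expansion j h = monom 1 m * [:r, c:]"
        unfolding h_def using expansion_free[OF cV, of j] expansion_free[OF r(1), of j] by (simp add: monom_altdef)
      have hI: "h \<in> I" unfolding h_def using r(2) j by (intro pideal_mult[OF I]) auto
      have hP: "h \<in> extend_ideal V j P"
        unfolding h_def mult.commute[of c] using base[of c] base[OF rP[OF c r]] c P(2) j
        by (intro pideal_mult[OF ext] pideal_add[OF ext] polys_power polys_var) auto
      have "f - h \<in> extend_ideal V j P"
      proof (cases "f - h = 0")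
        case True
        then show ?thesis using pideal_0[OF ext] by simp
      next
        case False
        have "degree (expansion j h) \<le> Suc m"
          unfolding eh using degree_mult_le[of "monom 1 m" "[:r, c:]"] degree_monom_le[of "1 :: 'k mpoly" m]
            degree_pCons_le[of r "[:c:]"] by simp
        moreover have e1: "coeff (expansion j h) (Suc m) = c"
          unfolding eh by (simp only: coeff_monom_mult) simp
        ultimately have "degree (expansion j f - expansion j h) < Suc m"
        proof (intro degree_less_if_coeff_0)
          show "coeff (expansion j f - expansion j h) (Suc m) = 0" using e1 Suc by (simp add: c_def)
        qed (use False Suc in \<open>auto intro: degree_diff_le\<close>)
        then show ?thesis using less.hyps[of "f - h"] Suc pideal_diff[OF I less.prems hI] by simp
      qed
      then show ?thesis using pideal_add[OF ext _ hP] by fastforce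
    qed
  qed
  then have "idim V (extend_ideal V j P) \<le> idim V I" by (intro idim_antimono fin) blast
  moreover have "idim V (extend_ideal V j P) = Suc (idim V' P)"
    by (rule idim_extend_ideal[OF fin j pprime_pideal[OF P(1)] pprime_1[OF P(1)]])
  moreover have "idim V' C \<le> idim V' P" using card_le_idim[OF fin' W(1) P(3)] W(3) by simp
  ultimately show ?thesis by simp
qed

text \<open>
  A prime component of \<open>I\<close> without monic elements in \<open>x\<^sub>j\<close> is birational to its projection; were the locus
  of indeterminacy \<open>C\<close> of codimension at least two, then \<open>x\<^sub>j\<close> would be integral.
\<close>

lemma idim_N_le_Suc_C:
  assumes um: "unmixed V I" and proper: "1 \<notin> C" and eq: "idim V I = idim V' N"
  shows "idim V' N \<le> Suc (idim V' C)"
proof (rule ccontr)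
  assume contra: "\<not> ?thesis"
  define M where "M = {f :: 'k mpoly. f \<in> polys V \<and> lead_coeff (expansion j f) = 1}"
  have "\<exists>Q\<in>associated_primes V I. Q \<inter> M = {}"
  proof (rule associated_prime_avoiding[OF fin I])
    show "M \<inter> I = {}"
    proof (rule ccontr)
      assume "M \<inter> I \<noteq> {}"
      then obtain f where "f \<in> I" "lead_coeff (expansion j f) = 1" by (auto simp: M_def)
      then have "1 \<in> coeff_ideal j (degree (expansion j f)) I"
        using lead_coeff_in_coeff_ideal[of f I j] by force
      then show False using proper N_subset_C coeff_0 coeff_Suc by (cases "degree (expansion j f)") auto
    qed
    show "s * t \<in> M" if "s \<in> M" "t \<in> M" for s t
      using that by (auto simp: M_def lead_coeff_mult)
  qed (auto simp: M_def)
  then obtain Q where Q: "Q \<in> associated_primes V I" "Q \<inter> M = {}" by blast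
  have prime: "pprime V Q" using Q(1) by (rule associated_prime_pprime)
  have IQ: "I \<subseteq> Q" using Q(1) I by (rule associated_prime_contains)
  have dimQ: "idim V Q = idim V' N" using unmixed_idim[OF um Q(1)] eq by simp
  have "\<not> C \<subseteq> Q"
  proof
    assume "C \<subseteq> Q"
    then have "C \<subseteq> Q \<inter> polys V'" using pideal_subset[OF C] by blast
    then have "idim V' (Q \<inter> polys V') \<le> idim V' C" by (rule idim_antimono[OF fin'])
    then show False using idim_le_Suc_contract[OF fin, of Q j] dimQ contra by simp
  qed
  then obtain c where c: "c \<in> C" "c \<notin> Q" by blast
  obtain r where r: "r \<in> polys V'" "c * var j + r \<in> I" by (rule conductor[OF c(1)])
  have "idim V' (Q \<inter> polys V') = idim V Q"
    by (rule idim_contract_birational[OF fin j prime _ c(2) r(1)]) (use c(1) pideal_subset[OF C] r(2) IQ in auto)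
  then have "\<exists>g\<in>Q. lead_coeff (expansion j g) = 1"
  proof (intro monic_of_conductor_codimension_two[OF fin j prime C])
    show "\<exists>r\<in>polys V'. c * var j + r \<in> Q" if "c \<in> C" for c
      using conductor[OF that] IQ by blast
  qed (use dimQ contra in simp)
  then show False using Q(2) pideal_subset[OF pprime_pideal[OF prime]] by (auto simp: M_def)
qed

theorem idims_nondegenerate:
  assumes "unmixed V I" "1 \<notin> C" "radical_ideal V' N" "c \<in> C" "\<And>n. c ^ n \<notin> N"
  shows "idim V' N = idim V I" "Suc (idim V' C) = idim V I"
proof -
  show "idim V' N = idim V I"
    using idim_N_le idim_le_N[OF assms(1,4,5)] by simp
  then show "Suc (idim V' C) = idim V I"
    using idim_N_le_Suc_C[OF assms(1,2)] Suc_idim_C_le[OF assms(2,3)] by simp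
qed

text \<open>
  If \<open>f\<^sup>n \<in> I\<close>, then the leading coefficient of \<open>f\<close> has a power in \<open>C\<close> or \<open>N\<close>, so it is the leading
  coefficient of an element of \<open>I\<close> of the same degree, and subtracting this element lowers the degree of \<open>f\<close>.
\<close>

lemma radical:
  assumes radC: "radical_ideal V' C" and radN: "radical_ideal V' N"
  shows "radical_ideal V I"
  unfolding radical_ideal_def
proof (intro ballI allI impI)
  fix f n assume "f \<in> polys V" "f ^ n \<in> I"
  then show "f \<in> I"
  proof (induction "degree (expansion j f)" arbitrary: f rule: less_induct)
    case less
    let ?k = "degree (expansion j f)"
    show ?case
    proof (cases ?k)
      case 0
      then obtain a where a: "expansion j f = [:a:]" by (rule degree_eq_zeroE)
      then have fa: "f = a" using poly_expansion[of j f] by simp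
      have "a \<in> polys V'" using coeff_expansion_in_polys[OF less.prems(1), of j 0] a by simp
      then show ?thesis using less.prems(2) radN N_eq fa unfolding radical_ideal_def by blast
    next
      case (Suc m)
      define c where "c = lead_coeff (expansion j f)"
      have cV: "c \<in> polys V'" unfolding c_def by (rule coeff_expansion_in_polys[OF less.prems(1)])
      have "lead_coeff (expansion j (f ^ n)) \<in> coeff_ideal j (degree (expansion j (f ^ n))) I"
        by (rule lead_coeff_in_coeff_ideal[OF less.prems(2) refl])
      also have "\<dots> \<subseteq> C"
        using coeff_0 coeff_Suc N_subset_C by (cases "degree (expansion j (f ^ n))") auto
      finally have "c ^ n \<in> C" by (simp add: c_def lead_coeff_power)
      then have "c \<in> C" using radC cV unfolding radical_ideal_def by blast
      then have "c \<in> coeff_ideal j (Suc m) I" using coeff_Suc by simp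
      then obtain h where h: "h \<in> I" "degree (expansion j h) \<le> Suc m" "c = coeff (expansion j h) (Suc m)"
        by (auto simp: coeff_ideal_def)
      have hV: "h \<in> polys V" using h(1) pideal_subset[OF I] by blast
      have "f - h \<in> I"
      proof (cases "f - h = 0")
        case True
        then show ?thesis using pideal_0[OF I] by simp
      next
        case False
        then have "degree (expansion j (f - h)) < ?k"
          using h Suc by (intro degree_less_if_coeff_0) (auto simp: c_def intro: degree_diff_le)
        moreover have "f ^ n - (f - h) ^ n \<in> I"
          using less.prems(1) hV h(1) by (intro difference_of_powers_in_pideal[OF I]) auto
        then have "(f - h) ^ n \<in> I" using pideal_add_cancel[OF I] less.prems(2) by blast
        ultimately show ?thesis using less.hyps less.prems(1) hV by blast
      qed
      then show ?thesis using pideal_add[OF I _ h(1)] by fastforce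
    qed
  qed
qed

end

lemma vertex_split_of_decomposition:
  assumes "finite V" "geometric_vertex_decomposition V j r G (I :: 'k::field_char_0 mpoly set)"
  shows "vertex_split V j I (contraction V j (C_ideal V j G)) (contraction V j (N_ideal V j G))"
proof (rule vertex_split.intro)
  show "finite V" by (rule assms(1))
  show "j \<in> V" "pideal V I" using assms(2) by (auto simp: geometric_vertex_decomposition_def)
  show "coeff_ideal j 0 I = contraction V j (N_ideal V j G)"
    "\<And>k. coeff_ideal j (Suc k) I = contraction V j (C_ideal V j G)"
    by (rule coeff_ideals_of_decomposition[OF assms(2)])+
qed



section \<open>Hilbert functions\<close>

subsection \<open>Vector space dimensions\<close>

lemma (in vector_space) span_disjoint:
  assumes B: "independent B" and DE: "D \<subseteq> B" "E \<subseteq> B" "D \<inter> E = {}" and x: "x \<in> span D" "x \<in> span E"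
  shows "x = 0"
proof -
  have "representation B x = representation D x" "representation B x = representation E x"
    by (rule representation_extend[OF B x(1) DE(1)], rule representation_extend[OF B x(2) DE(2)])
  then have "representation B x b = 0" for b
    using representation_ne_zero[of D x b] representation_ne_zero[of E x b] DE(3) by auto
  moreover have "x \<in> span B" using x(1) span_mono[OF DE(1)] by blast
  ultimately show ?thesis using sum_nonzero_representation_eq[OF B, of x] by simp
qed

text \<open>
  Rank and nullity for finite-dimensional subspaces of a space that may have infinite dimension itself.
\<close>

lemma (in vector_space) dim_eq_dim_kernel_plus_dim_image:
  assumes T: "Vector_Spaces.linear scale scale T" and X: "subspace X" "finite F" "X \<subseteq> span F"
  shows "dim X = dim {x \<in> X. T x = 0} + dim (T ` X)"
proof -
  interpret T: Vector_Spaces.linear scale scale T by (rule T)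
  let ?K = "{x \<in> X. T x = 0}"
  obtain B0 where B0: "B0 \<subseteq> ?K" "independent B0" "?K \<subseteq> span B0" "card B0 = dim ?K"
    by (rule basis_exists)
  obtain B where B: "B0 \<subseteq> B" "B \<subseteq> X" "independent B" "X \<subseteq> span B"
    using maximal_independent_subset_extend[OF _ B0(2), of X] B0(1) by blast
  have finB: "finite B" using independent_span_bound[OF X(2) B(3)] B(2) X(3) by blast
  define D where "D = B - B0"
  have D: "D \<subseteq> B" "independent D" using B(3) dependent_mono[of "B - B0" B] unfolding D_def by auto
  have spanD: "span D \<subseteq> X" using D(1) B(2) X(1) by (intro span_minimal) auto
  have inj: "inj_on T (span D)"
  proof -
    have "x = 0" if x: "x \<in> span D" "T x = 0" for x
    proof -
      have "x \<in> span B0" using x spanD B0(3) by blast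
      then show ?thesis using span_disjoint[OF B(3) D(1) B(1) _ x(1)] by (auto simp: D_def)
    qed
    then show ?thesis using T.inj_on_iff_eq_0[OF subspace_span] by blast
  qed
  have indT: "independent (T ` D)" by (rule T.independent_injective_image[OF D(2) inj])
  have "T ` X \<subseteq> span (T ` D)"
  proof
    fix y assume "y \<in> T ` X"
    then obtain x where x: "x \<in> X" "y = T x" by blast
    have "B = B0 \<union> D" using B(1) by (auto simp: D_def)
    then obtain a b where ab: "x = a + b" "a \<in> span B0" "b \<in> span D"
      using x(1) B(4) span_Un[of B0 D] by blast
    have "span B0 \<subseteq> ?K"
      using B0(1) X(1) by (intro span_minimal) (auto simp: subspace_def T.add T.scale T.zero)
    then have "T a = 0" using ab(2) by blast
    then have "y = T b" using x(2) ab(1) by (simp add: T.add)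
    then show "y \<in> span (T ` D)" using ab(3) T.span_image[of D] by blast
  qed
  moreover have "T ` D \<subseteq> T ` X" using D(1) B(2) by blast
  ultimately have "card (T ` D) = dim (T ` X)" using basis_card_eq_dim indT by blast
  moreover have "card (T ` D) = card D"
    using inj_on_subset[OF inj span_superset] by (rule card_image)
  moreover have "card B = card B0 + card D"
    unfolding D_def using finB B(1) by (metis card_mono card_Diff_subset finite_subset le_add_diff_inverse)
  moreover have "card B = dim X" by (rule basis_card_eq_dim[OF B(2,4,3)])
  ultimately show ?thesis using B0(4) by simp
qed

interpretation mp: vector_space "\<lambda>(c :: 'k::field) (f :: 'k mpoly). const c * f"
  by unfold_locales (auto simp: algebra_simps const_add const_mult)

lemma subspace_pideal: "pideal V J \<Longrightarrow> mp.subspace J"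
  by (auto simp: mp.subspace_def pideal_0 pideal_add intro: pideal_mult)

subsection \<open>Homogeneous components\<close>

lemma total_degree_superset:
  "finite A \<Longrightarrow> Poly_Mapping.keys m \<subseteq> A \<Longrightarrow> total_degree m = (\<Sum>i\<in>A. Poly_Mapping.lookup m i)"
  unfolding total_degree_def by (rule sum.mono_neutral_left) (auto simp: in_keys_iff)

lemma total_degree_add [simp]: "total_degree (m + n) = total_degree m + total_degree n"
proof -
  let ?A = "Poly_Mapping.keys m \<union> Poly_Mapping.keys n"
  have "total_degree (m + n) = (\<Sum>i\<in>?A. Poly_Mapping.lookup (m + n) i)"
    using Poly_Mapping.keys_add[of m n] by (intro total_degree_superset) auto
  then show ?thesis
    by (simp add: lookup_add sum.distrib total_degree_superset[of ?A m] total_degree_superset[of ?A n])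
qed

lemma total_degree_single [simp]: "total_degree (Poly_Mapping.single i n) = n"
  by (subst total_degree_superset[of "{i}"]) auto

definition component :: "nat \<Rightarrow> 'k::field mpoly \<Rightarrow> 'k mpoly" where
  "component d f = (\<Sum>m\<in>{m \<in> Poly_Mapping.keys f. total_degree m = d}.
     Poly_Mapping.single m (Poly_Mapping.lookup f m))"

lemma lookup_component:
  "Poly_Mapping.lookup (component d f) m = (if total_degree m = d then Poly_Mapping.lookup f m else 0)"
proof -
  have "Poly_Mapping.lookup (component d f) m =
      (\<Sum>n\<in>{n \<in> Poly_Mapping.keys f. total_degree n = d}. if n = m then Poly_Mapping.lookup f m else 0)"
    unfolding component_def lookup_sum by (intro sum.cong) (auto simp: lookup_single when_def)
  then show ?thesis by (auto simp: in_keys_iff)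
qed

lemma component_add [simp]: "component d (f + g) = component d f + component d g"
  by (rule poly_mapping_eqI) (simp add: lookup_component lookup_add)

lemma component_0 [simp]: "component d 0 = 0"
  by (rule poly_mapping_eqI) (simp add: lookup_component)

lemma component_sum: "component d (sum f A) = (\<Sum>i\<in>A. component d (f i))"
  by (induction A rule: infinite_finite_induct) auto

lemma component_single:
  "component d (Poly_Mapping.single m c) = (if total_degree m = d then Poly_Mapping.single m c else 0)"
  by (rule poly_mapping_eqI) (auto simp: lookup_component lookup_single when_def)

lemma component_single_mult:
  "component d (Poly_Mapping.single m c * f) =
     (if total_degree m \<le> d then Poly_Mapping.single m c * component (d - total_degree m) f else 0)"
proof -
  let ?s = "\<lambda>a. Poly_Mapping.single a (Poly_Mapping.lookup f a)"
  have "component d (Poly_Mapping.single m c * f) =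
      (\<Sum>a\<in>Poly_Mapping.keys f. component d (Poly_Mapping.single m c * ?s a))"
    by (subst (1) poly_mapping_sum_singles[of f]) (simp add: sum_distrib_left component_sum)
  also have "\<dots> = (\<Sum>a\<in>Poly_Mapping.keys f. if total_degree m \<le> d
      then Poly_Mapping.single m c * component (d - total_degree m) (?s a) else 0)"
    by (intro sum.cong) (auto simp: mult_single component_single)
  also have "\<dots> = (if total_degree m \<le> d
      then Poly_Mapping.single m c * component (d - total_degree m) (\<Sum>a\<in>Poly_Mapping.keys f. ?s a) else 0)"
    by (auto simp: component_sum sum_distrib_left)
  finally show ?thesis by (simp only: poly_mapping_sum_singles[of f, symmetric])
qed

lemma component_in_polys: "f \<in> polys V \<Longrightarrow> component d f \<in> polys V"
  by (auto simp: polys_iff in_keys_iff lookup_component split: if_splits)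

lemma homogeneous_part_iff: "f \<in> homogeneous_part V d \<longleftrightarrow> f \<in> polys V \<and> component d f = f"
proof -
  have "(\<forall>m\<in>Poly_Mapping.keys f. total_degree m = d) \<longleftrightarrow> component d f = f"
    by (auto simp: poly_mapping_eq_iff fun_eq_iff lookup_component in_keys_iff)
  then show ?thesis by (simp add: homogeneous_part_def)
qed

lemma component_component: "component d (component d f) = component d f"
  by (rule poly_mapping_eqI) (simp add: lookup_component)

lemma component_const_mult: "component d (const c * f) = const c * component d f"
  by (simp add: component_single_mult total_degree_def)

lemma subspace_homogeneous_part: "mp.subspace (homogeneous_part V d)"
  unfolding mp.subspace_def by (auto simp: homogeneous_part_iff component_const_mult)

definition graded_ideal :: "'k::field mpoly set \<Rightarrow> bool" where
  "graded_ideal J \<longleftrightarrow> (\<forall>f\<in>J. \<forall>d. component d f \<in> J)"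

lemma graded_ideal_polys: "graded_ideal (polys V)"
  by (auto simp: graded_ideal_def component_in_polys)

lemma homogeneous_ideal_graded:
  assumes "homogeneous_ideal V J"
  shows "pideal V J" "graded_ideal J"
proof -
  obtain S where S: "S \<subseteq> (\<Union>d. homogeneous_part V d)" "J = genideal (mpoly_ring V) S"
    using assms unfolding homogeneous_ideal_def by blast
  then have SV: "S \<subseteq> polys V" by (auto simp: homogeneous_part_def)
  show J: "pideal V J" unfolding S(2) by (rule pideal_genideal[OF SV])
  let ?T = "{f \<in> J. \<forall>d. component d f \<in> J}"
  have "pideal V ?T"
  proof (rule pidealI)
    show "?T \<subseteq> polys V" using pideal_subset[OF J] by blast
  next
    fix f g :: "'a mpoly" assume fg: "f \<in> polys V" "g \<in> ?T"
    let ?s = "\<lambda>m. Poly_Mapping.single m (Poly_Mapping.lookup f m)"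
    have s: "?s m \<in> polys V" if "m \<in> Poly_Mapping.keys f" for m
      using that fg(1) by (auto simp: polys_iff)
    have "f * g = (\<Sum>m\<in>Poly_Mapping.keys f. ?s m * g)"
      by (subst (1) poly_mapping_sum_singles[of f]) (simp add: sum_distrib_right)
    then have "component d (f * g) = (\<Sum>m\<in>Poly_Mapping.keys f. component d (?s m * g))" for d
      by (simp add: component_sum)
    moreover have "component d (?s m * g) \<in> J" if "m \<in> Poly_Mapping.keys f" for d m
      using fg(2) s[OF that] by (auto simp: component_single_mult pideal_0[OF J] intro: pideal_mult[OF J])
    ultimately have "component d (f * g) \<in> J" for d by (simp add: pideal_sum[OF J])
    then show "f * g \<in> ?T" using fg pideal_mult[OF J] by blast
  qed (auto simp: pideal_0[OF J] pideal_add[OF J])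
  moreover have "S \<subseteq> ?T"
  proof
    fix f assume f: "f \<in> S"
    then obtain e where "f \<in> homogeneous_part V e" using S(1) by blast
    then have "component d f = (if d = e then f else 0)" for d
      by (intro poly_mapping_eqI) (auto simp: homogeneous_part_def lookup_component in_keys_iff)
    then show "f \<in> ?T" using f genideal_subset[OF SV] S(2) pideal_0[OF J] by auto
  qed
  ultimately have "J \<subseteq> ?T" unfolding S(2) by (intro genideal_least) auto
  then show "graded_ideal J" by (auto simp: graded_ideal_def)
qed

lemma lookup_coeff_expansion_eq_0:
  assumes "Poly_Mapping.lookup n j \<noteq> 0"
  shows "Poly_Mapping.lookup (coeff (expansion j f) k) n = 0"
proof (rule ccontr)
  assume "Poly_Mapping.lookup (coeff (expansion j f) k) n \<noteq> 0"
  then have n: "n \<in> Poly_Mapping.keys (coeff (expansion j f) k)" by (simp add: in_keys_iff)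
  have "coeff (expansion j f) k \<in> polys (UNIV - {j})"
    by (rule coeff_expansion_in_polys) simp
  then have "n \<in> monomials (UNIV - {j})" using n unfolding polys_iff by blast
  then have "j \<notin> Poly_Mapping.keys n" unfolding monomials_def by blast
  then show False using assms by (simp add: in_keys_iff)
qed

lemma coeff_expansion_component:
  "coeff (expansion j (component (d + k) f)) k = component d (coeff (expansion j f) k)"
proof (rule poly_mapping_eqI)
  fix n
  show "Poly_Mapping.lookup (coeff (expansion j (component (d + k) f)) k) n =
      Poly_Mapping.lookup (component d (coeff (expansion j f) k)) n"
  proof (cases "Poly_Mapping.lookup n j = 0")
    case True
    then show ?thesis by (simp add: lookup_coeff_expansion lookup_component)
  next
    case False
    then show ?thesis by (simp add: lookup_component lookup_coeff_expansion_eq_0)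
  qed
qed

lemma coeff_expansion_component_less:
  assumes "d < k"
  shows "coeff (expansion j (component d f)) k = 0"
proof (rule poly_mapping_eqI)
  fix n
  show "Poly_Mapping.lookup (coeff (expansion j (component d f)) k) n = Poly_Mapping.lookup 0 n"
  proof (cases "Poly_Mapping.lookup n j = 0")
    case True
    then show ?thesis using assms by (simp add: lookup_coeff_expansion lookup_component)
  next
    case False
    then show ?thesis by (simp add: lookup_coeff_expansion_eq_0)
  qed
qed

lemma degree_expansion_component: "degree (expansion j (component d f)) \<le> degree (expansion j f)"
proof (rule degree_le, intro allI impI)
  fix i assume i: "degree (expansion j f) < i"
  show "coeff (expansion j (component d f)) i = 0"
  proof (cases "d < i")
    case True
    then show ?thesis by (rule coeff_expansion_component_less)
  next
    case False
    then show ?thesis using coeff_expansion_component[of j "d - i" i f] i by (simp add: coeff_eq_0)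
  qed
qed

lemma graded_coeff_ideal:
  assumes "graded_ideal I"
  shows "graded_ideal (coeff_ideal j k I)"
  unfolding graded_ideal_def
proof (intro ballI allI)
  fix a d assume "a \<in> coeff_ideal j k I"
  then obtain f where f: "f \<in> I" "degree (expansion j f) \<le> k" "a = coeff (expansion j f) k"
    by (auto simp: coeff_ideal_def)
  have "component (d + k) f \<in> I" using assms f(1) by (simp add: graded_ideal_def)
  moreover have "degree (expansion j (component (d + k) f)) \<le> k"
    using degree_expansion_component[of j "d + k" f] f(2) by simp
  ultimately show "component d a \<in> coeff_ideal j k I"
    unfolding f(3) coeff_expansion_component[symmetric] by (rule coeff_idealI)
qed

lemma finite_monomials_of_degree:
  assumes "finite V"
  shows "finite {m \<in> monomials V. total_degree m = d}"
proof (rule finite_imageD)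
  have le: "Poly_Mapping.lookup m i \<le> total_degree m" for m i
    by (cases "i \<in> Poly_Mapping.keys m") (auto simp: total_degree_def in_keys_iff intro: member_le_sum)
  show "finite (Poly_Mapping.lookup ` {m \<in> monomials V. total_degree m = d})"
  proof (rule finite_subset)
    show "finite {f :: nat \<Rightarrow> nat. \<forall>x. (x \<in> V \<longrightarrow> f x \<in> {..d}) \<and> (x \<notin> V \<longrightarrow> f x = 0)}"
      using assms by (intro finite_set_of_finite_funs) auto
    show "Poly_Mapping.lookup ` {m \<in> monomials V. total_degree m = d} \<subseteq>
        {f. \<forall>x. (x \<in> V \<longrightarrow> f x \<in> {..d}) \<and> (x \<notin> V \<longrightarrow> f x = 0)}"
    proof
      fix g assume "g \<in> Poly_Mapping.lookup ` {m \<in> monomials V. total_degree m = d}"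
      then obtain m where m: "m \<in> monomials V" "total_degree m = d" "g = Poly_Mapping.lookup m" by blast
      have "g x \<le> d" for x using le[of m x] m(2,3) by simp
      moreover have "g x = 0" if "x \<notin> V" for x
        using m(1,3) that by (auto simp: monomials_def in_keys_iff)
      ultimately show "g \<in> {f. \<forall>x. (x \<in> V \<longrightarrow> f x \<in> {..d}) \<and> (x \<notin> V \<longrightarrow> f x = 0)}" by simp
    qed
  qed
  show "inj_on Poly_Mapping.lookup {m \<in> monomials V. total_degree m = d}"
    by (rule inj_onI) (rule poly_mapping_eq_iff[THEN iffD2])
qed

lemma homogeneous_part_spanned:
  fixes V :: "nat set"
  assumes "finite V"
  obtains F :: "'k::field mpoly set" where "finite F" "homogeneous_part V d \<subseteq> mp.span F"
proof
  let ?M = "{m \<in> monomials V. total_degree m = d}"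
  show "finite ((\<lambda>m. Poly_Mapping.single m (1::'k)) ` ?M)"
    using finite_monomials_of_degree[OF assms] by simp
  show "homogeneous_part V d \<subseteq> mp.span ((\<lambda>m. Poly_Mapping.single m (1::'k)) ` ?M)"
  proof
    fix f :: "'k mpoly" assume f: "f \<in> homogeneous_part V d"
    have "const (Poly_Mapping.lookup f m) * Poly_Mapping.single m 1 \<in> mp.span ((\<lambda>m. Poly_Mapping.single m (1::'k)) ` ?M)"
      if "m \<in> Poly_Mapping.keys f" for m
      using f that by (intro mp.span_scale mp.span_base) (auto simp: homogeneous_part_def polys_iff)
    then have "(\<Sum>m\<in>Poly_Mapping.keys f. const (Poly_Mapping.lookup f m) * Poly_Mapping.single m 1) \<in>
        mp.span ((\<lambda>m. Poly_Mapping.single m (1::'k)) ` ?M)"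
      by (rule mp.span_sum)
    also have "(\<Sum>m\<in>Poly_Mapping.keys f. const (Poly_Mapping.lookup f m) * Poly_Mapping.single m 1) = f"
      by (simp add: mult_single poly_mapping_sum_singles[of f, symmetric])
    finally show "f \<in> mp.span ((\<lambda>m. Poly_Mapping.single m (1::'k)) ` ?M)" .
  qed
qed

definition graded_dim :: "nat set \<Rightarrow> 'k::field mpoly set \<Rightarrow> nat \<Rightarrow> nat" where
  "graded_dim V A n = mp.dim (A \<inter> homogeneous_part V n)"

text \<open>
  \<open>X k\<close> consists of the forms in \<open>A\<close> of degree below \<open>k\<close> in \<open>x\<^sub>j\<close>; taking the coefficient of \<open>x\<^sub>j\<^sup>k\<close> maps \<open>X (k + 1)\<close>
  onto a homogeneous part of a coefficient ideal, with kernel \<open>X k\<close>.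
\<close>

lemma graded_dim_eq_sum:
  assumes fin: "finite V" and A: "pideal V A" "graded_ideal A"
  shows "graded_dim V A n = (\<Sum>k\<le>n. graded_dim (V - {j}) (coeff_ideal j k A) (n - k))"
proof -
  define X where "X k = {f \<in> A \<inter> homogeneous_part V n. \<forall>i\<ge>k. coeff (expansion j f) i = 0}" for k
  obtain F :: "'a mpoly set" where F: "finite F" "homogeneous_part V n \<subseteq> mp.span F"
    by (rule homogeneous_part_spanned[OF fin])
  have exps: "expansion j (const c * f) = smult (const c) (expansion j f)" for c f by simp
  have X: "mp.subspace (X k)" for k
    using mp.subspace_inter[OF subspace_pideal[OF A(1)] subspace_homogeneous_part[of V n]]
    unfolding X_def mp.subspace_def exps by auto
  have "mp.dim (X k) = (\<Sum>i<k. graded_dim (V - {j}) (coeff_ideal j i A) (n - i))" if "k \<le> Suc n" for k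
    using that
  proof (induction k)
    case 0
    have "X 0 = {0}"
    proof -
      have "f = 0" if "f \<in> X 0" for f
      proof -
        have "expansion j f = 0" using that by (simp add: X_def poly_eq_iff)
        then show ?thesis by simp
      qed
      then show ?thesis using X[of 0] by (auto simp: mp.subspace_def)
    qed
    moreover have "mp.dim ({0} :: 'a mpoly set) = 0"
      using mp.dim_eq_card_independent[OF mp.independent_empty] mp.dim_span[of "{} :: 'a mpoly set"] by simp
    ultimately show ?case by simp
  next
    case (Suc k)
    let ?T = "\<lambda>f. coeff (expansion j f) k"
    have T: "Vector_Spaces.linear (\<lambda>c f. const c * f) (\<lambda>c f. const c * f) ?T"
      by unfold_locales (auto simp: exps)
    have "X (Suc k) \<subseteq> mp.span F" using F(2) by (auto simp: X_def)
    then have "mp.dim (X (Suc k)) = mp.dim {f \<in> X (Suc k). ?T f = 0} + mp.dim (?T ` X (Suc k))"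
      by (rule mp.dim_eq_dim_kernel_plus_dim_image[OF T X F(1)])
    also have "{f \<in> X (Suc k). ?T f = 0} = X k"
    proof -
      have "(\<forall>i\<ge>k. coeff F i = 0) \<longleftrightarrow> (\<forall>i\<ge>Suc k. coeff F i = 0) \<and> coeff F k = 0" for F :: "'a mpoly poly"
        by (metis Suc_leD Suc_leI le_neq_implies_less order_refl)
      then show ?thesis unfolding X_def by auto
    qed
    also have "?T ` X (Suc k) = coeff_ideal j k A \<inter> homogeneous_part (V - {j}) (n - k)"
    proof
      show "?T ` X (Suc k) \<subseteq> coeff_ideal j k A \<inter> homogeneous_part (V - {j}) (n - k)"
      proof
        fix a assume "a \<in> ?T ` X (Suc k)"
        then obtain f where f: "f \<in> A" "f \<in> homogeneous_part V n" "\<forall>i\<ge>Suc k. coeff (expansion j f) i = 0" "a = ?T f"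
          by (auto simp: X_def)
        have "degree (expansion j f) \<le> k" using f(3) by (intro degree_le) (auto simp: Suc_le_eq)
        then have "a \<in> coeff_ideal j k A" using f(1,4) coeff_idealI by blast
        moreover have "component (n - k) a = a"
          using coeff_expansion_component[of j "n - k" k f] Suc.prems f(2,4) by (simp add: homogeneous_part_iff)
        moreover have "a \<in> polys (V - {j})"
          using f(2,4) coeff_expansion_in_polys by (auto simp: homogeneous_part_iff)
        ultimately show "a \<in> coeff_ideal j k A \<inter> homogeneous_part (V - {j}) (n - k)"
          by (simp add: homogeneous_part_iff)
      qed
      show "coeff_ideal j k A \<inter> homogeneous_part (V - {j}) (n - k) \<subseteq> ?T ` X (Suc k)"
      proof
        fix a assume a: "a \<in> coeff_ideal j k A \<inter> homogeneous_part (V - {j}) (n - k)"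
        then obtain g where g: "g \<in> A" "degree (expansion j g) \<le> k" "a = ?T g" by (auto simp: coeff_ideal_def)
        have "component n g \<in> A \<inter> homogeneous_part V n"
          using A(2) g(1) pideal_subset[OF A(1)]
          by (auto simp: graded_ideal_def homogeneous_part_iff component_in_polys component_component)
        moreover have "coeff (expansion j (component n g)) i = 0" if "i \<ge> Suc k" for i
          using degree_expansion_component[of j n g] g(2) that by (intro coeff_eq_0) simp
        moreover have "?T (component n g) = a"
          using coeff_expansion_component[of j "n - k" k g] Suc.prems a g(3) by (simp add: homogeneous_part_iff)
        ultimately show "a \<in> ?T ` X (Suc k)" unfolding X_def by (intro image_eqI[of _ _ "component n g"]) auto
      qed
    qed
    finally show ?case using Suc by (simp add: graded_dim_def)
  qed
  from this[of "Suc n"] have "mp.dim (X (Suc n)) = (\<Sum>i\<le>n. graded_dim (V - {j}) (coeff_ideal j i A) (n - i))"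
    by (simp add: lessThan_Suc_atMost)
  moreover have "X (Suc n) = A \<inter> homogeneous_part V n"
  proof -
    have "coeff (expansion j x) i = 0" if "x \<in> homogeneous_part V n" "i \<ge> Suc n" for x i
      using coeff_expansion_component_less[of n i j x] that by (simp add: homogeneous_part_iff)
    then show ?thesis unfolding X_def by auto
  qed
  ultimately show ?thesis by (simp add: graded_dim_def)
qed



subsection \<open>Hilbert functions of quotients\<close>

lemma (in ring) line_extension_memI:
  "k \<in> K \<Longrightarrow> v \<in> E \<Longrightarrow> u = k \<otimes> a \<oplus> v \<Longrightarrow> u \<in> line_extension K a E"
  using line_extension_mem_iff by blast

lemma homogeneous_part_0: "homogeneous_part V 0 = range const"
proof
  show "homogeneous_part V 0 \<subseteq> range const"
  proof
    fix f assume f: "f \<in> homogeneous_part V 0"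
    have "m = 0" if "m \<in> Poly_Mapping.keys f" for m
    proof (rule poly_mapping_eqI)
      fix i
      have "total_degree m = 0" using f that by (simp add: homogeneous_part_def)
      then show "Poly_Mapping.lookup m i = Poly_Mapping.lookup 0 i"
        by (auto simp: total_degree_def in_keys_iff)
    qed
    then have "f = const (Poly_Mapping.lookup f 0)"
      by (intro poly_mapping_eqI) (auto simp: lookup_single when_def in_keys_iff)
    then show "f \<in> range const" by (rule range_eqI)
  qed
  show "range const \<subseteq> homogeneous_part V 0"
    by (auto simp: homogeneous_part_iff component_single total_degree_def)
qed

text \<open>
  A basis of the forms of degree \<open>d\<close> in \<open>I\<close> is extended to a basis of all forms of degree \<open>d\<close>. The cosets of the
  additional elements \<open>D\<close> form a basis of the homogeneous part of the quotient over the image of the constants.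
\<close>

lemma hilbert_function_eq:
  fixes I :: "'k::field mpoly set"
  assumes fin: "finite V" and I: "pideal V I" "1 \<notin> I"
  shows "graded_dim V (polys V :: 'k mpoly set) d = hilbert_function V I d + graded_dim V I d"
proof -
  let ?Q = "mpoly_ring V Quot I" and ?c = "a_r_coset (mpoly_ring V) I"
  let ?R = "homogeneous_part V d :: 'k mpoly set"
  interpret Q: cring ?Q by (rule ideal.quotient_is_cring[OF I(1) cring_mpoly_ring])
  interpret h: ring_hom_ring "mpoly_ring V" ?Q ?c
    by (rule ideal.rcos_ring_hom_ring[OF I(1)])
  have carr: "carrier ?Q = ?c ` polys V" by (auto simp: FactRing_def A_RCOSETS_def')
  have zero: "\<zero>\<^bsub>?Q\<^esub> = ?c 0" and one: "\<one>\<^bsub>?Q\<^esub> = ?c 1" using h.hom_zero h.hom_one by simp_all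
  have add: "?c f \<oplus>\<^bsub>?Q\<^esub> ?c g = ?c (f + g)" and mult: "?c f \<otimes>\<^bsub>?Q\<^esub> ?c g = ?c (f * g)"
    if "f \<in> polys V" "g \<in> polys V" for f g
    using that h.hom_add[of f g] h.hom_mult[of f g] by simp_all
  define K where "K = ?c ` range const"
  have K_carr: "K \<subseteq> carrier ?Q" unfolding K_def carr by auto
  have inv: "?c (const a) \<otimes>\<^bsub>?Q\<^esub> ?c (const (inverse a)) = \<one>\<^bsub>?Q\<^esub>" if "a \<noteq> 0" for a
    using const_inverse[OF that] by (simp add: mult one)
  have ne: "\<one>\<^bsub>?Q\<^esub> \<noteq> \<zero>\<^bsub>?Q\<^esub>"
    unfolding zero one using coset_eq_iff[OF I(1) polys_1 polys_0] I(2) by simp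
  have "subring K ?Q"
  proof (rule Q.subringI[OF K_carr])
    show "\<one>\<^bsub>?Q\<^esub> \<in> K" unfolding one K_def by (intro imageI range_eqI[of _ _ 1]) simp
    fix x assume "x \<in> K"
    then obtain a where a: "x = ?c (const a)" by (auto simp: K_def)
    have "?c (const (- a)) \<oplus>\<^bsub>?Q\<^esub> x = \<zero>\<^bsub>?Q\<^esub>"
      unfolding a zero by (simp add: add flip: const_add)
    then have "\<ominus>\<^bsub>?Q\<^esub> x = ?c (const (- a))"
      using Q.minus_equality[of "?c (const (- a))" x] K_carr by (auto simp: K_def a carr)
    then show "\<ominus>\<^bsub>?Q\<^esub> x \<in> K" by (auto simp: K_def)
    fix y assume "y \<in> K"
    then obtain b where b: "y = ?c (const b)" by (auto simp: K_def)
    show "x \<otimes>\<^bsub>?Q\<^esub> y \<in> K" "x \<oplus>\<^bsub>?Q\<^esub> y \<in> K"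
      unfolding a b K_def by (auto simp: add mult simp flip: const_add const_mult)
  qed
  then have subfield: "subfield K ?Q"
  proof (intro Q.subfieldI Q.subcringI')
    show "Units (?Q\<lparr>carrier := K\<rparr>) = K - {\<zero>\<^bsub>?Q\<^esub>}"
    proof
      show "Units (?Q\<lparr>carrier := K\<rparr>) \<subseteq> K - {\<zero>\<^bsub>?Q\<^esub>}"
      proof
        fix x assume "x \<in> Units (?Q\<lparr>carrier := K\<rparr>)"
        then obtain y where "x \<in> K" "y \<in> K" "x \<otimes>\<^bsub>?Q\<^esub> y = \<one>\<^bsub>?Q\<^esub>" by (auto simp: Units_def)
        then show "x \<in> K - {\<zero>\<^bsub>?Q\<^esub>}" using ne K_carr by (auto simp: subset_iff)
      qed
      show "K - {\<zero>\<^bsub>?Q\<^esub>} \<subseteq> Units (?Q\<lparr>carrier := K\<rparr>)"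
      proof
        fix x assume x: "x \<in> K - {\<zero>\<^bsub>?Q\<^esub>}"
        then obtain a where a: "x = ?c (const a)" by (auto simp: K_def)
        have "a \<noteq> 0"
        proof
          assume "a = 0"
          then have "x = \<zero>\<^bsub>?Q\<^esub>" unfolding a zero by simp
          then show False using x by blast
        qed
        then have "x \<otimes>\<^bsub>?Q\<^esub> ?c (const (inverse a)) = \<one>\<^bsub>?Q\<^esub>" unfolding a by (rule inv)
        moreover have "?c (const (inverse a)) \<in> K" by (simp add: K_def)
        moreover have "?c (const (inverse a)) \<otimes>\<^bsub>?Q\<^esub> x = x \<otimes>\<^bsub>?Q\<^esub> ?c (const (inverse a))"
          using x K_carr \<open>?c (const (inverse a)) \<in> K\<close> by (intro Q.m_comm) auto
        ultimately show "x \<in> Units (?Q\<lparr>carrier := K\<rparr>)"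
          using x unfolding Units_def by (intro CollectI conjI bexI[of _ "?c (const (inverse a))"]) simp_all
      qed
    qed
  qed
  have RV: "?R \<subseteq> polys V" by (auto simp: homogeneous_part_def)
  have span_polys: "mp.span D \<subseteq> polys V" if "D \<subseteq> polys V" for D
    using that by (intro mp.span_minimal) (auto simp: mp.subspace_def)
  have dimension: "Q.dimension (card D) K (?c ` mp.span D)"
    if "finite D" "D \<subseteq> polys V" "mp.independent D" "mp.span D \<inter> I \<subseteq> {0}" for D
    using that
  proof (induction D rule: finite_induct)
    case empty
    show ?case using Q.zero_dim[of K] by (simp add: zero)
  next
    case (insert v D)
    have sub: "mp.span D \<subseteq> mp.span (insert v D)" by (rule mp.span_mono) auto
    have v: "v \<notin> mp.span D" "mp.independent D"
      using insert.prems(2) insert.hyps by (auto simp: mp.independent_insert)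
    have vV: "v \<in> polys V" and DV: "mp.span D \<subseteq> polys V" using insert.prems(1) span_polys by auto
    have "?c v \<notin> ?c ` mp.span D"
    proof
      assume "?c v \<in> ?c ` mp.span D"
      then obtain w where w: "w \<in> mp.span D" "?c v = ?c w" by blast
      then have "v - w \<in> I" using coset_eq_iff[OF I(1) vV] DV by blast
      moreover have "v - w \<in> mp.span (insert v D)"
        using w(1) sub by (intro mp.span_diff) (auto intro: mp.span_base)
      ultimately show False using insert.prems(3) w(1) v(1) by auto
    qed
    moreover have "Q.dimension (card D) K (?c ` mp.span D)"
      using insert.IH insert.prems v sub by auto
    ultimately have "Q.dimension (Suc (card D)) K (Q.line_extension K (?c v) (?c ` mp.span D))"
      using vV by (intro Q.Suc_dim) (auto simp: carr)
    moreover have "Q.line_extension K (?c v) (?c ` mp.span D) = ?c ` mp.span (insert v D)"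
    proof
      show "Q.line_extension K (?c v) (?c ` mp.span D) \<subseteq> ?c ` mp.span (insert v D)"
      proof
        fix u assume "u \<in> Q.line_extension K (?c v) (?c ` mp.span D)"
        then obtain a w where aw: "w \<in> mp.span D" "u = ?c (const a) \<otimes>\<^bsub>?Q\<^esub> ?c v \<oplus>\<^bsub>?Q\<^esub> ?c w"
          unfolding Q.line_extension_mem_iff K_def by blast
        then have "u = ?c (const a * v + w)"
          using vV DV add[of "const a * v" w] mult[of "const a" v] by auto
        moreover have "const a * v + w \<in> mp.span (insert v D)"
          using aw(1) sub by (intro mp.span_add mp.span_scale) (auto intro: mp.span_base)
        ultimately show "u \<in> ?c ` mp.span (insert v D)" by blast
      qed
      show "?c ` mp.span (insert v D) \<subseteq> Q.line_extension K (?c v) (?c ` mp.span D)"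
      proof
        fix u assume "u \<in> ?c ` mp.span (insert v D)"
        then obtain x a where x: "u = ?c x" "x - const a * v \<in> mp.span D" by (auto simp: mp.span_insert)
        have "x = const a * v + (x - const a * v)" by simp
        then have "?c x = ?c (const a) \<otimes>\<^bsub>?Q\<^esub> ?c v \<oplus>\<^bsub>?Q\<^esub> ?c (x - const a * v)"
          using vV DV x(2) by (subst mult, simp, simp, subst add) auto
        then show "u \<in> Q.line_extension K (?c v) (?c ` mp.span D)"
          using x by (intro Q.line_extension_memI[of "?c (const a)" _ "?c (x - const a * v)"]) (auto simp: K_def)
      qed
    qed
    ultimately show ?case using insert.hyps by simp
  qed
  obtain F :: "'k mpoly set" where F: "finite F" "?R \<subseteq> mp.span F" by (rule homogeneous_part_spanned[OF fin])
  obtain B0 where B0: "B0 \<subseteq> I \<inter> ?R" "mp.independent B0" "I \<inter> ?R \<subseteq> mp.span B0" "card B0 = mp.dim (I \<inter> ?R)"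
    by (rule mp.basis_exists)
  obtain B where B: "B0 \<subseteq> B" "B \<subseteq> ?R" "mp.independent B" "?R \<subseteq> mp.span B"
    using mp.maximal_independent_subset_extend[OF _ B0(2), of ?R] B0(1) by blast
  have finB: "finite B" using mp.independent_span_bound[OF F(1) B(3)] B(2) F(2) by blast
  define D where "D = B - B0"
  have D: "D \<subseteq> B" "mp.independent D" using B(3) mp.dependent_mono[of "B - B0" B] unfolding D_def by auto
  have spanD: "mp.span D \<subseteq> ?R" using D(1) B(2) by (intro mp.span_minimal subspace_homogeneous_part) auto
  have "mp.span D \<inter> I \<subseteq> {0}"
  proof
    fix x assume x: "x \<in> mp.span D \<inter> I"
    then have "x \<in> mp.span B0" using spanD B0(3) by blast
    then show "x \<in> {0}" using mp.span_disjoint[OF B(3) D(1) B(1) _ _] x by (auto simp: D_def)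
  qed
  then have "Q.dimension (card D) K (?c ` mp.span D)"
    using D finB B(2) RV by (intro dimension) (auto intro: finite_subset)
  moreover have "?c ` mp.span D = ?c ` ?R"
  proof
    show "?c ` mp.span D \<subseteq> ?c ` ?R" using spanD by blast
    show "?c ` ?R \<subseteq> ?c ` mp.span D"
    proof
      fix u assume "u \<in> ?c ` ?R"
      then obtain x where x: "x \<in> ?R" "u = ?c x" by blast
      have "B = B0 \<union> D" using B(1) by (auto simp: D_def)
      then obtain a b where ab: "x = a + b" "a \<in> mp.span B0" "b \<in> mp.span D"
        using x(1) B(4) mp.span_Un[of B0 D] by blast
      have "mp.span B0 \<subseteq> I" using B0(1) by (intro mp.span_minimal subspace_pideal[OF I(1)]) auto
      then have "x - b \<in> I" using ab by auto
      moreover have "b \<in> polys V" "x \<in> polys V" using ab(3) spanD x(1) RV by auto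
      ultimately have "?c x = ?c b" using coset_eq_iff[OF I(1)] by blast
      then show "u \<in> ?c ` mp.span D" using x(2) ab(3) by blast
    qed
  qed
  ultimately have "Q.dimension (card D) K (?c ` ?R)" by simp
  then have "Q.dim K (?c ` ?R) = card D" using Q.dimI[OF subfield] by (simp add: over_def)
  then have "hilbert_function V I d = card D" by (simp add: hilbert_function_def K_def homogeneous_part_0)
  moreover have "card B = card B0 + card D"
    unfolding D_def using finB B(1) by (metis card_mono card_Diff_subset finite_subset le_add_diff_inverse)
  moreover have "card B = mp.dim ?R" by (rule mp.basis_card_eq_dim[OF B(2,4,3)])
  moreover have "polys V \<inter> ?R = ?R" using RV by blast
  ultimately show ?thesis using B0(4) by (simp add: graded_dim_def)
qed

subsection \<open>Hilbert series\<close>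

lemma one_minus_fps_X_nonzero: "(1 - fps_X :: rat fps) \<noteq> 0"
proof
  assume "(1 - fps_X :: rat fps) = 0"
  then have "fps_nth (1 - fps_X :: rat fps) 0 = 0" by (simp only: fps_zero_nth)
  then show False by simp
qed

definition graded_series :: "nat set \<Rightarrow> 'k::field mpoly set \<Rightarrow> rat fps" where
  "graded_series V A = Abs_fps (\<lambda>n. of_nat (graded_dim V A n))"

definition quotient_series :: "nat set \<Rightarrow> 'k::field mpoly set \<Rightarrow> rat fps" where
  "quotient_series V A = graded_series V (polys V :: 'k mpoly set) - graded_series V A"

lemma hilbert_series_eq:
  assumes "finite V" "pideal V I" "1 \<notin> I"
  shows "hilbert_series V I = quotient_series V I"
  unfolding hilbert_series_def quotient_series_def graded_series_def
  by (rule fps_ext) (simp add: hilbert_function_eq[OF assms])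

text \<open>
  Multiplication with \<open>1 - X\<close> turns the sum over the degrees in \<open>x\<^sub>j\<close> into a single step.
\<close>

lemma graded_series_split:
  assumes "finite V" "pideal V A" "graded_ideal A"
    and "coeff_ideal j 0 A = N" "\<And>k. coeff_ideal j (Suc k) A = C"
  shows "(1 - fps_X) * graded_series V A =
    (1 - fps_X) * graded_series (V - {j}) N + fps_X * graded_series (V - {j}) C"
proof (rule fps_ext)
  fix n
  let ?N = "\<lambda>n. of_nat (graded_dim (V - {j}) N n) :: rat" and ?C = "\<lambda>n. of_nat (graded_dim (V - {j}) C n) :: rat"
  have *: "of_nat (graded_dim V A n) = ?N n + (\<Sum>i<n. ?C i)" for n
  proof -
    have "graded_dim V A n = graded_dim (V - {j}) N n + (\<Sum>k<n. graded_dim (V - {j}) C (n - Suc k))"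
      unfolding graded_dim_eq_sum[OF assms(1-3), of n j] sum.atMost_shift by (simp add: assms(4,5))
    also have "(\<Sum>k<n. graded_dim (V - {j}) C (n - Suc k)) = (\<Sum>i<n. graded_dim (V - {j}) C i)"
      by (rule sum.nat_diff_reindex)
    finally show ?thesis by simp
  qed
  show "fps_nth ((1 - fps_X) * graded_series V A) n =
      fps_nth ((1 - fps_X) * graded_series (V - {j}) N + fps_X * graded_series (V - {j}) C) n"
    by (cases n) (simp_all add: graded_series_def left_diff_distrib *)
qed

lemma polys_eq_extend_ideal: "polys V = extend_ideal V j (polys (V - {j}))"
  using coeff_expansion_in_polys by (auto simp: extend_ideal_def)

lemma pideal_polys: "pideal V (polys V)"
  by (rule pidealI) auto

lemma coeff_ideal_polys: "j \<in> V \<Longrightarrow> coeff_ideal j k (polys V) = polys (V - {j})"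
  using coeff_ideal_extend_ideal[OF _ pideal_polys, of j V k] by (simp flip: polys_eq_extend_ideal)

theorem quotient_series_split:
  fixes A :: "'k::field mpoly set"
  assumes "finite V" "j \<in> V" "pideal V A" "graded_ideal A"
    and "coeff_ideal j 0 A = N" "\<And>k. coeff_ideal j (Suc k) A = C"
  shows "(1 - fps_X) * quotient_series V A =
    (1 - fps_X) * quotient_series (V - {j}) N + fps_X * quotient_series (V - {j}) C"
  using graded_series_split[OF assms(1,3,4,5,6)]
    graded_series_split[of V "polys V :: 'k mpoly set" j, OF assms(1) pideal_polys graded_ideal_polys
      coeff_ideal_polys[OF assms(2)] coeff_ideal_polys[OF assms(2)]]
  by (simp add: quotient_series_def algebra_simps)

lemma quotient_series_polys [simp]: "quotient_series V (polys V) = 0"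
  by (simp add: quotient_series_def)

definition has_h_polynomial :: "nat set \<Rightarrow> 'k::field mpoly set \<Rightarrow> nat \<Rightarrow> rat poly \<Rightarrow> bool" where
  "has_h_polynomial V A d h \<longleftrightarrow> (1 - fps_X) ^ d * quotient_series V A = fps_of_poly h"

lemma has_h_polynomial_mono:
  assumes "has_h_polynomial V A d h" "d \<le> e"
  shows "\<exists>h. has_h_polynomial V A e h"
proof
  have "(1 - fps_X) ^ e = (1 - fps_X) ^ (e - d) * (1 - fps_X :: rat fps) ^ d"
    using assms(2) by (simp only: power_add[symmetric] le_add_diff_inverse2)
  then have "(1 - fps_X) ^ e * quotient_series V A = (1 - fps_X) ^ (e - d) * fps_of_poly h"
    using assms(1) by (simp only: has_h_polynomial_def mult.assoc)
  moreover have "(1 - fps_X :: rat fps) = fps_of_poly [:1, - 1:]"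
    by (simp add: fps_of_poly_pCons)
  ultimately show "has_h_polynomial V A e ([:1, - 1:] ^ (e - d) * h)"
    by (simp only: has_h_polynomial_def fps_of_poly_mult fps_of_poly_power)
qed

lemma h_polynomial_eqI:
  fixes J :: "'k::field_char_0 mpoly set"
  assumes "finite V" "pideal V J" "1 \<notin> J" and h: "has_h_polynomial V J (idim V J) h"
  shows "h_polynomial V J = h"
proof -
  let ?u = "(1 - fps_X :: rat fps) ^ idim V J"
  have u: "fps_nth ?u 0 \<noteq> 0" by (simp add: fps_nth_power_0)
  have "hilbert_series V J = fps_of_poly g / ?u \<longleftrightarrow> g = h" for g
  proof -
    have "hilbert_series V J = fps_of_poly g / ?u \<longleftrightarrow> ?u * hilbert_series V J = fps_of_poly g"
    proof
      assume "hilbert_series V J = fps_of_poly g / ?u"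
      then have "?u * hilbert_series V J = (inverse ?u * ?u) * fps_of_poly g"
        unfolding fps_divide_unit[OF u] by (simp only: mult_ac)
      then show "?u * hilbert_series V J = fps_of_poly g"
        unfolding inverse_mult_eq_1[OF u] by (simp only: mult_1)
    next
      assume "?u * hilbert_series V J = fps_of_poly g"
      then have "fps_of_poly g / ?u = inverse ?u * (?u * hilbert_series V J)"
        unfolding fps_divide_unit[OF u] by (simp only: mult.commute)
      then have "fps_of_poly g / ?u = (inverse ?u * ?u) * hilbert_series V J"
        by (simp only: mult.assoc)
      then show "hilbert_series V J = fps_of_poly g / ?u"
        unfolding inverse_mult_eq_1[OF u] by (simp only: mult_1)
    qed
    also have "?u * hilbert_series V J = fps_of_poly h"
      using h by (simp add: has_h_polynomial_def hilbert_series_eq[OF assms(1-3)])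
    finally show ?thesis by (auto simp: fps_of_poly_eq_iff)
  qed
  then show ?thesis
    unfolding h_polynomial_def krull_dim_eq_idim[OF assms(1,2)] by simp
qed

subsection \<open>Ideals generated by variables\<close>

text \<open>
  The substitution whose kernel is the ideal generated by the variables in \<open>W\<close>.
\<close>

definition kill :: "nat set \<Rightarrow> nat \<Rightarrow> 'k::field mpoly" where
  "kill W i = (if i \<in> W then 0 else var i)"

lemma genideal_vars:
  assumes "W \<subseteq> V"
  shows "genideal (mpoly_ring V) (var ` W) = {f \<in> polys V. subst (kill W) f = (0 :: 'k::field mpoly)}"
proof
  have WV: "(var ` W :: 'k mpoly set) \<subseteq> polys V" using assms by auto
  note J = pideal_genideal[OF WV]
  have "pideal V {f \<in> polys V. subst (kill W) f = (0 :: 'k mpoly)}"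
    by (rule pidealI) (auto simp: subst_simps)
  then show "genideal (mpoly_ring V) (var ` W) \<subseteq> {f \<in> polys V. subst (kill W) f = (0 :: 'k mpoly)}"
    by (rule genideal_least) (use WV in \<open>auto simp: subst_simps kill_def\<close>)
  show "{f \<in> polys V. subst (kill W) f = (0 :: 'k mpoly)} \<subseteq> genideal (mpoly_ring V) (var ` W)"
  proof
    fix f :: "'k mpoly" assume f: "f \<in> {f \<in> polys V. subst (kill W) f = 0}"
    then have "f \<in> polys V" by simp
    then have "f - subst (kill W) f \<in> genideal (mpoly_ring V) (var ` W)"
    proof (induction rule: polys_induct)
      case (const c)
      then show ?case by (simp add: subst_simps pideal_0[OF J])
    next
      case (add f g)
      then show ?case using pideal_add[OF J add.IH] by (simp add: subst_simps algebra_simps)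
    next
      case (var f i)
      have fV: "subst (kill W) f \<in> polys V"
        using var.hyps(1) by (rule subst_in_polys) (auto simp: kill_def)
      have iV: "(var i :: 'k mpoly) \<in> polys V" using var.hyps(2) by simp
      have diff: "(var i :: 'k mpoly) - kill W i \<in> genideal (mpoly_ring V) (var ` W)"
        using genideal_subset[OF WV] by (auto simp: kill_def pideal_0[OF J])
      have "var i * (f - subst (kill W) f) + subst (kill W) f * (var i - kill W i) \<in> genideal (mpoly_ring V) (var ` W)"
        by (rule pideal_add[OF J pideal_mult[OF J iV var.IH] pideal_mult[OF J fV diff]])
      then show ?case by (simp add: subst_simps algebra_simps)
    qed
    then show "f \<in> genideal (mpoly_ring V) (var ` W)" using f by simp
  qed
qed

lemma pideal_vars: "W \<subseteq> V \<Longrightarrow> pideal V {f \<in> polys V. subst (kill W) f = 0}"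
  by (rule pidealI) (auto simp: subst_simps)

lemma component_var: "component (Suc 0) (var i) = var i"
  by (simp add: var_def component_single)

lemma graded_vars:
  assumes "W \<subseteq> V"
  shows "graded_ideal {f \<in> polys V. subst (kill W) f = (0 :: 'k::field mpoly)}"
proof -
  have "(var ` W :: 'k mpoly set) \<subseteq> (\<Union>d. homogeneous_part V d)"
  proof
    fix x :: "'k mpoly" assume "x \<in> var ` W"
    then have "x \<in> homogeneous_part V 1"
      using assms by (auto simp: homogeneous_part_iff component_var)
    then show "x \<in> (\<Union>d. homogeneous_part V d)" by blast
  qed
  then have "homogeneous_ideal V (genideal (mpoly_ring V) (var ` W :: 'k mpoly set))"
    unfolding homogeneous_ideal_def by blast
  then show ?thesis unfolding genideal_vars[OF assms] by (rule homogeneous_ideal_graded)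
qed

lemma quotient_series_no_variables: "quotient_series {} {0 :: 'k::field mpoly} = 1"
proof -
  have dim0: "mp.dim ({0} :: 'k mpoly set) = 0"
    using mp.dim_eq_card_independent[OF mp.independent_empty] mp.dim_span[of "{} :: 'k mpoly set"] by simp
  have polys0: "(polys {} :: 'k mpoly set) = range const"
    by (auto elim: polys_emptyE)
  have "graded_dim {} (polys {} :: 'k mpoly set) 0 = 1"
  proof -
    have "range const = mp.span {1 :: 'k mpoly}" by (simp add: mp.span_singleton)
    moreover have "mp.dim {1 :: 'k mpoly} = 1"
      using mp.dim_eq_card_independent[of "{1 :: 'k mpoly}"] by simp
    ultimately show ?thesis by (simp add: graded_dim_def homogeneous_part_0 polys0 mp.dim_span)
  qed
  moreover have "graded_dim {} (polys {} :: 'k mpoly set) n = 0" if "n > 0" for n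
  proof -
    have "polys {} \<inter> homogeneous_part {} n = {0 :: 'k mpoly}"
      using that by (auto simp: polys0 homogeneous_part_iff component_single total_degree_def)
    then show ?thesis by (simp add: graded_dim_def dim0)
  qed
  moreover have "graded_dim {} {0 :: 'k mpoly} n = 0" for n
  proof -
    have "{0} \<inter> homogeneous_part {} n = {0 :: 'k mpoly}" by (auto simp: homogeneous_part_iff)
    then show ?thesis by (simp add: graded_dim_def dim0)
  qed
  ultimately show ?thesis
    by (intro fps_ext) (auto simp: quotient_series_def graded_series_def)
qed

lemma quotient_series_vars:
  assumes "finite V" "W \<subseteq> V"
  shows "(1 - fps_X) ^ card (V - W) * quotient_series V {f \<in> polys V. subst (kill W) f = (0::'k::field mpoly)} = 1"
  using assms
proof (induction V arbitrary: W rule: finite_induct)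
  case empty
  have "kill W = (var :: nat \<Rightarrow> 'k mpoly)" using empty by (auto simp: kill_def fun_eq_iff)
  then have "{f \<in> polys {}. subst (kill W) f = (0::'k mpoly)} = {0}" using empty by auto
  then show ?case using empty by (simp add: quotient_series_no_variables)
next
  case (insert j V)
  let ?V = "insert j V" and ?W = "W - {j}"
  let ?A = "{f \<in> polys ?V. subst (kill W) f = (0::'k mpoly)}"
  let ?A' = "{f \<in> polys V. subst (kill ?W) f = (0::'k mpoly)}"
  have V: "?V - {j} = V" using insert.hyps by auto
  have W: "?W \<subseteq> V" using insert.prems by auto
  have finV: "finite ?V" using insert.hyps by simp
  have kill: "subst (kill W) f = subst (kill ?W) f" if "f \<in> polys V" for f :: "'k mpoly"
    using that insert.hyps by (intro subst_cong[of _ V]) (auto simp: kill_def)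
  have expand: "subst (kill W) f = poly (map_poly (subst (kill W)) (expansion j f)) (kill W j)" for f :: "'k mpoly"
    using subst_poly[of "kill W" "expansion j f" "var j"] by (simp add: subst_simps)
  have coV: "coeff (expansion j f) k \<in> polys V" if "f \<in> polys ?V" for f :: "'k mpoly" and k
    using coeff_expansion_in_polys[OF that, of j k] V by simp
  have A: "pideal ?V ?A" "graded_ideal ?A" and A': "pideal (?V - {j}) ?A'"
    using pideal_vars[OF insert.prems] graded_vars[OF insert.prems] pideal_vars[OF W] unfolding V by auto
  note IH = insert.IH[OF W]
  show ?case
  proof (cases "j \<in> W")
    case True
    have iff: "f \<in> ?A \<longleftrightarrow> f \<in> polys ?V \<and> coeff (expansion j f) 0 \<in> ?A'" for f :: "'k mpoly"
    proof -
      have "subst (kill W) f = subst (kill W) (coeff (expansion j f) 0)"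
        using True by (subst expand) (simp add: kill_def poly_0_coeff_0 coeff_map_poly subst_simps)
      then show ?thesis using coV[of f 0] kill[of "coeff (expansion j f) 0"] by auto
    qed
    have "coeff_ideal j 0 ?A = ?A'"
    proof
      show "coeff_ideal j 0 ?A \<subseteq> ?A'" using iff by (auto simp: coeff_ideal_def)
      show "?A' \<subseteq> coeff_ideal j 0 ?A"
      proof
        fix a assume a: "a \<in> ?A'"
        have ea: "expansion j a = [:a:]" using a insert.hyps by (intro expansion_free[of _ V]) auto
        have "a \<in> ?A" using iff[of a] a ea polys_mono[of V ?V] by auto
        then show "a \<in> coeff_ideal j 0 ?A" using coeff_idealI[of a ?A j 0] ea by simp
      qed
    qed
    moreover have "coeff_ideal j (Suc k) ?A = polys V" for k
    proof
      show "coeff_ideal j (Suc k) ?A \<subseteq> polys V" using coV by (auto simp: coeff_ideal_def)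
      show "polys V \<subseteq> coeff_ideal j (Suc k) ?A"
      proof
        fix a :: "'k mpoly" assume a: "a \<in> polys V"
        have e: "expansion j (a * var j ^ Suc k) = monom a (Suc k)"
          using expansion_free[OF a insert.hyps(2)] by (simp add: monom_altdef)
        have "a * var j ^ Suc k \<in> polys ?V" using a polys_mono[of V ?V] by (intro polys_mult polys_power) auto
        moreover have "coeff (monom a (Suc k)) 0 \<in> ?A'" by (simp add: subst_simps)
        ultimately have "a * var j ^ Suc k \<in> ?A" unfolding iff e by blast
        from coeff_idealI[OF this, of j "Suc k", unfolded e] show "a \<in> coeff_ideal j (Suc k) ?A"
          by (simp add: degree_monom_le)
      qed
    qed
    ultimately have "(1 - fps_X) * quotient_series ?V ?A = (1 - fps_X) * quotient_series V ?A'"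
      using quotient_series_split[OF finV _ A, of j ?A' "polys V"] V by simp
    then have "quotient_series ?V ?A = quotient_series V ?A'"
      using one_minus_fps_X_nonzero by simp
    moreover have "?V - W = V - ?W" using True insert.hyps by auto
    ultimately show ?thesis using IH by simp
  next
    case False
    then have WV: "W \<subseteq> V" "?W = W" using insert.prems by auto
    have "?A = extend_ideal ?V j ?A'"
    proof -
      have "subst (kill W) f = 0 \<longleftrightarrow> (\<forall>k. coeff (expansion j f) k \<in> ?A')" if f: "f \<in> polys ?V" for f :: "'k mpoly"
      proof -
        let ?F = "map_poly (subst (kill W)) (expansion j f)"
        have coF: "coeff ?F k = subst (kill W) (coeff (expansion j f) k)" for k
          by (simp add: coeff_map_poly subst_simps)
        have "coeff ?F k \<in> polys V" for k
          unfolding coF using coV[OF f] by (rule subst_in_polys) (auto simp: kill_def)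
        then have e: "expansion j (poly ?F (var j)) = ?F"
          using insert.hyps(2) by (rule expansion_poly)
        have "subst (kill W) f = poly ?F (var j)" using expand[of f] False by (simp add: kill_def)
        then have "subst (kill W) f = 0 \<longleftrightarrow> ?F = 0" using e by (metis expansion_eq_0_iff)
        also have "\<dots> \<longleftrightarrow> (\<forall>k. subst (kill W) (coeff (expansion j f) k) = 0)"
          by (simp add: poly_eq_iff coF)
        finally show ?thesis using coV[OF f] WV(2) by simp
      qed
      then show ?thesis by (auto simp: extend_ideal_def)
    qed
    then have "coeff_ideal j k ?A = ?A'" for k
      using coeff_ideal_extend_ideal[OF _ A', of k] by simp
    then have "(1 - fps_X) * quotient_series ?V ?A = (1 - fps_X) * quotient_series V ?A' + fps_X * quotient_series V ?A'"
      using quotient_series_split[OF finV _ A, of j ?A' ?A'] V by simp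
    then have step: "(1 - fps_X) * quotient_series ?V ?A = quotient_series V ?A'" by (simp add: algebra_simps)
    have "?V - W = insert j (V - W)" using False by auto
    then have card: "card (?V - W) = Suc (card (V - W))" using insert.hyps by simp
    have "(1 - fps_X) ^ Suc (card (V - W)) * quotient_series ?V ?A =
        (1 - fps_X) ^ card (V - W) * ((1 - fps_X) * quotient_series ?V ?A)"
      by (simp only: power_Suc mult_ac)
    also have "\<dots> = 1" unfolding step using IH unfolding WV(2) .
    finally show ?thesis unfolding card .
  qed
qed



section \<open>Recursion along geometric vertex decompositions\<close>

lemma radical_polys: "radical_ideal V (polys V)"
  by (simp add: radical_ideal_def)

lemma radical_vars: "radical_ideal V {f \<in> polys V. subst (kill W) f = 0}"
  by (auto simp: radical_ideal_def subst_simps)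

context vertex_split
begin

lemma quotient_series_eq:
  assumes "graded_ideal I"
  shows "(1 - fps_X) * quotient_series V I =
    (1 - fps_X) * quotient_series V' N + fps_X * quotient_series V' C"
  by (rule quotient_series_split[OF fin j I assms coeff_0 coeff_Suc])

lemma has_h_polynomial_split:
  assumes "graded_ideal I" and hN: "has_h_polynomial V' N d hN" and hC: "has_h_polynomial V' C e hC" and d: "d = Suc e"
  shows "has_h_polynomial V I d (hN + [:0, 1:] * hC)"
proof -
  have "(1 - fps_X) ^ d * quotient_series V I = (1 - fps_X) ^ e * ((1 - fps_X) * quotient_series V I)"
    unfolding d by (simp only: power_Suc mult_ac)
  also have "\<dots> = (1 - fps_X) ^ d * quotient_series V' N + fps_X * ((1 - fps_X) ^ e * quotient_series V' C)"
    unfolding quotient_series_eq[OF assms(1)] d by (simp only: power_Suc distrib_left mult_ac)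
  also have "\<dots> = fps_of_poly hN + fps_X * fps_of_poly hC"
    using hN hC by (simp only: has_h_polynomial_def)
  also have "\<dots> = fps_of_poly (hN + [:0, 1:] * hC)"
    by (simp only: fps_of_poly_add fps_of_poly_mult fps_of_poly_fps_X)
  finally show ?thesis unfolding has_h_polynomial_def .
qed

text \<open>
  The Hilbert series of \<open>I\<close> has at \<open>1\<close> a pole of at most the order for \<open>N\<close> or one more than that for \<open>C\<close>, and
  \<open>idim V I\<close> is at least as large. The unit ideal \<open>C\<close> contributes nothing.
\<close>

lemma exists_h_polynomial:
  assumes gr: "graded_ideal I" and rad: "radical_ideal V' N"
    and hN: "has_h_polynomial V' N (idim V' N) hN" and hC: "has_h_polynomial V' C (idim V' C) hC"
  shows "\<exists>h. has_h_polynomial V I (idim V I) h"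
proof (cases "1 \<in> C")
  case True
  then have "C = polys V'" by (rule pideal_eq_iff[OF C])
  then have "(1 - fps_X) * quotient_series V I = (1 - fps_X) * quotient_series V' N"
    using quotient_series_eq[OF gr] by simp
  then have "quotient_series V I = quotient_series V' N" using one_minus_fps_X_nonzero by simp
  then have "has_h_polynomial V I (idim V' N) hN" using hN by (simp add: has_h_polynomial_def)
  then show ?thesis using has_h_polynomial_mono idim_N_le by blast
next
  case False
  then have "Suc (idim V' C) \<le> idim V I" by (rule Suc_idim_C_le[OF _ rad])
  then obtain e where e: "idim V I = Suc e" "idim V' C \<le> e" by (cases "idim V I") auto
  obtain hN' where hN': "has_h_polynomial V' N (idim V I) hN'" using has_h_polynomial_mono[OF hN idim_N_le] by blast
  obtain hC' where hC': "has_h_polynomial V' C e hC'" using has_h_polynomial_mono[OF hC e(2)] by blast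
  show ?thesis using has_h_polynomial_split[OF gr hN' hC' e(1)] by blast
qed

end

lemma has_h_polynomial_extend_ideal:
  assumes "finite V" "j \<in> V" and J: "pideal (V - {j}) J" and gr: "graded_ideal (extend_ideal V j J)"
    and h: "has_h_polynomial (V - {j}) J d h"
  shows "has_h_polynomial V (extend_ideal V j J) (Suc d) h"
proof -
  have "(1 - fps_X) * quotient_series V (extend_ideal V j J) =
      (1 - fps_X) * quotient_series (V - {j}) J + fps_X * quotient_series (V - {j}) J"
    by (rule quotient_series_split[OF assms(1,2) pideal_extend_ideal[OF J] gr])
       (rule coeff_ideal_extend_ideal[OF assms(2) J])+
  then have "(1 - fps_X) * quotient_series V (extend_ideal V j J) = quotient_series (V - {j}) J"
    by (simp add: algebra_simps)
  moreover have "(1 - fps_X) ^ Suc d * quotient_series V (extend_ideal V j J) =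
      (1 - fps_X) ^ d * ((1 - fps_X) * quotient_series V (extend_ideal V j J))"
    by (simp only: power_Suc mult_ac)
  ultimately show ?thesis using h unfolding has_h_polynomial_def by simp
qed

lemma graded_extend_ideal:
  assumes "pideal (V - {j}) J" "graded_ideal J"
  shows "graded_ideal (extend_ideal V j J)"
  unfolding graded_ideal_def
proof (intro ballI allI)
  fix f d assume f: "f \<in> extend_ideal V j J"
  have "coeff (expansion j (component d f)) k \<in> J" for k
  proof (cases "d < k")
    case True
    then show ?thesis using pideal_0[OF assms(1)] by (simp add: coeff_expansion_component_less)
  next
    case False
    then show ?thesis
      using coeff_expansion_component[of j "d - k" k f] f assms(2) by (simp add: extend_ideal_def graded_ideal_def)
  qed
  then show "component d f \<in> extend_ideal V j J" using f by (simp add: extend_ideal_def component_in_polys)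
qed

text \<open>
  Radicality has to be carried along, since \<open>exists_h_polynomial\<close> needs it for \<open>N\<close>.
\<close>

theorem geometrically_vertex_decomposable_properties:
  fixes I :: "'k::field_char_0 mpoly set"
  assumes "geometrically_vertex_decomposable V I" "finite V"
  shows "radical_ideal V I \<and> (graded_ideal I \<longrightarrow> (\<exists>h. has_h_polynomial V I (idim V I) h))"
  using assms
proof (induction rule: geometrically_vertex_decomposable.induct)
  case (unit V I)
  have "1 \<in> I" using genideal_subset[of "{1 :: 'k mpoly}" V] unit.hyps(2) by auto
  then have "I = polys V" using pideal_genideal[of "{1 :: 'k mpoly}" V] pideal_eq_iff unit.hyps(2) by auto
  moreover have "has_h_polynomial V (polys V :: 'k mpoly set) d 0" for d by (simp add: has_h_polynomial_def)
  ultimately show ?case using radical_polys by blast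
next
  case (variables V I W)
  let ?A = "{f \<in> polys V. subst (kill W) f = (0 :: 'k mpoly)}"
  have I: "I = ?A" using genideal_vars[OF variables.hyps(2)] variables.hyps(3) by simp
  have "indep_mod ?A (V - W)"
  proof
    fix f assume f: "f \<in> ?A \<inter> polys (V - W)"
    then have "subst (kill W) f = subst var f" by (intro subst_cong[of _ "V - W"]) (auto simp: kill_def)
    then show "f \<in> {0}" using f by simp
  qed
  then have "card (V - W) \<le> idim V ?A" using variables.prems by (intro card_le_idim) auto
  moreover have "has_h_polynomial V ?A (card (V - W)) 1"
    using quotient_series_vars[OF variables.prems variables.hyps(2)] by (simp add: has_h_polynomial_def)
  ultimately have "\<exists>h. has_h_polynomial V ?A (idim V ?A) h" by (intro has_h_polynomial_mono)
  then show ?case using radical_vars unfolding I by blast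
next
  case (decompose V I j r G)
  interpret vertex_split V j I "contraction V j (C_ideal V j G)" "contraction V j (N_ideal V j G)"
    by (rule vertex_split_of_decomposition[OF decompose.prems decompose.hyps(2)])
  have fin: "finite (V - {j})" using decompose.prems by simp
  note C = decompose.IH(1)[OF fin] and N = decompose.IH(2)[OF fin]
  have "\<exists>h. has_h_polynomial V I (idim V I) h" if gr: "graded_ideal I"
  proof -
    have "graded_ideal (contraction V j (C_ideal V j G))" "graded_ideal (contraction V j (N_ideal V j G))"
      using graded_coeff_ideal[OF gr, of j 1] graded_coeff_ideal[OF gr, of j 0] coeff_0 coeff_Suc[of 0] by simp_all
    then show ?thesis using C N exists_h_polynomial[OF gr] by blast
  qed
  then show ?case using radical C N by blast
qed

theorem theorem2p4:
  fixes n j :: nat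
    and r :: "monomial rel"
    and I G :: "'k::{alg_closed_field, field_char_0} mpoly set"
  assumes "homogeneous_ideal {1..n} I"
    and "geometrically_vertex_decomposable {1..n} I"
    and "geometric_vertex_decomposition {1..n} j r G I"
    and "geometrically_vertex_decomposable ({1..n} - {j}) (contraction {1..n} j (C_ideal {1..n} j G))"
    and "geometrically_vertex_decomposable ({1..n} - {j}) (contraction {1..n} j (N_ideal {1..n} j G))"
    and "\<not> degenerate {1..n} j G"
  shows "h_polynomial {1..n} I =
           h_polynomial {1..n} (N_ideal {1..n} j G) + [:0, 1:] * h_polynomial {1..n} (C_ideal {1..n} j G)"
proof -
  let ?V = "{1..n}"
  define C where "C = contraction ?V j (C_ideal ?V j G)"
  define N where "N = contraction ?V j (N_ideal ?V j G)"
  have finV: "finite ?V" by simp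
  interpret vertex_split ?V j I C N
    unfolding C_def N_def by (rule vertex_split_of_decomposition[OF finV assms(3)])
  have ext: "N_ideal ?V j G = extend_ideal ?V j N" "C_ideal ?V j G = extend_ideal ?V j C"
    using coeff_ideals_of_decomposition(3,4)[OF assms(3)] by (simp_all only: N_def C_def)
  have gr: "graded_ideal I" by (rule homogeneous_ideal_graded[OF assms(1)])
  have grC: "graded_ideal C" and grN: "graded_ideal N"
    using graded_coeff_ideal[OF gr, of j 1] graded_coeff_ideal[OF gr, of j 0] coeff_0 coeff_Suc[of 0] by simp_all
  obtain hC where hC: "has_h_polynomial V' C (idim V' C) hC"
    using geometrically_vertex_decomposable_properties[OF assms(4)] grC by (auto simp: C_def)
  obtain hN where hN: "has_h_polynomial V' N (idim V' N) hN"
    using geometrically_vertex_decomposable_properties[OF assms(5)] grN by (auto simp: N_def)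
  have radN: "radical_ideal V' N"
    using geometrically_vertex_decomposable_properties[OF assms(5)] by (simp add: N_def)
  have C1: "1 \<notin> C"
  proof
    assume "1 \<in> C"
    then have "extend_ideal ?V j C = polys ?V"
      using pideal_eq_iff[OF pideal_extend_ideal[OF local.C] extend_ideal_base[OF local.C]] by blast
    moreover have "genideal (mpoly_ring ?V) {1 :: 'k mpoly} = polys ?V"
      using pideal_eq_iff[OF pideal_genideal[of "{1 :: 'k mpoly}" ?V]] genideal_subset[of "{1 :: 'k mpoly}" ?V] by auto
    ultimately show False using assms(6) ext(2) by (simp add: degenerate_def)
  qed
  have "C \<noteq> N" using assms(6) ext by (auto simp: degenerate_def)
  then obtain c where c: "c \<in> C" "c \<notin> N" using N_subset_C by blast
  have "c ^ m \<notin> N" for m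
    using radN c pideal_subset[OF local.C] by (auto simp: radical_ideal_def)
  moreover have "unmixed ?V I"
    using assms(2) by (cases rule: geometrically_vertex_decomposable.cases) auto
  ultimately have dims: "idim V' N = idim ?V I" "Suc (idim V' C) = idim ?V I"
    using idims_nondegenerate[OF _ C1 radN c(1)] by blast+
  have N1: "1 \<notin> N" using C1 N_subset_C by blast
  then have I1: "1 \<notin> I" unfolding N_eq by simp
  have proper: "1 \<notin> extend_ideal ?V j J" if "1 \<notin> J" for J :: "'k mpoly set"
  proof
    assume "1 \<in> extend_ideal ?V j J"
    then have "coeff (expansion j (1 :: 'k mpoly)) 0 \<in> J" unfolding extend_ideal_def by blast
    then show False using that by simp
  qed
  have "h_polynomial ?V I = hN + [:0, 1:] * hC"
    using has_h_polynomial_split[OF gr hN[unfolded dims(1)] hC dims(2)[symmetric]]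
    by (rule h_polynomial_eqI[OF finV I I1])
  moreover have "h_polynomial ?V (N_ideal ?V j G) = hN"
    unfolding ext(1)
    using has_h_polynomial_extend_ideal[OF finV j local.N graded_extend_ideal[OF local.N grN] hN]
    by (intro h_polynomial_eqI[OF finV pideal_extend_ideal[OF local.N] proper[OF N1]])
       (simp only: idim_extend_ideal[OF finV j local.N N1])
  moreover have "h_polynomial ?V (C_ideal ?V j G) = hC"
    unfolding ext(2)
    using has_h_polynomial_extend_ideal[OF finV j local.C graded_extend_ideal[OF local.C grC] hC]
    by (intro h_polynomial_eqI[OF finV pideal_extend_ideal[OF local.C] proper[OF C1]])
       (simp only: idim_extend_ideal[OF finV j local.C C1])
  ultimately show ?thesis by simp
qed

end
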